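(* Let $I$ be an index set and $F_I$ the free group on letters $\{g_i\}_{i\in I}$. The assignment $\lambda_i\mapsto\bar g_i$, $m_{ij}\mapsto\vec g_i\cdot\vec g_j$, $w_{ijk}\mapsto[\vec g_i,\vec g_j]\cdot\vec g_k$ ($i,j,k\in I$) defines a well-defined ring isomorphism $R_I\to\kappa F_I^\#$.
   Context: Let $\kappa$ be a field of characteristic $0$. For a group $G$, let $*:\kappa G\to\kappa G$ be the $\kappa$-linear map with $g^*=g^{-1}$, $(\kappa G)^*$ its fixed points, and $A_G$ the quotient of $\kappa G$ by the two-sided ideal generated by all $ab-ba$, $a\in\kappa G$, $b\in(\kappa G)^*$; $*$ descends to $A_G$. $\kappa G^\#=\{x\in A_G:x^*=x\}$, $\Lambda_G=\{x\in A_G:x^*=-x\}$; group elements are identified with their images in $A_G$; $\bar x=\tfrac12(x+x^* )$, $\vec x=\tfrac12(x-x^* )$; for $\vec x,\vec y\in\Lambda_G$, $\vec x\cdot\vec y=-\tfrac12(\vec x\vec y+\vec y\vec x)$ and $[\vec x,\vec y]=\tfrac12(\vec x\vec y-\vec y\vec x)$. $R_I$ is the quotient of the polynomial ring $\kappa[\lambda_i,m_{ij},w_{ijk}: i,j,k\in I]$ by the relations, for all $i,j,k,l,s,t\in I$: (R1) $m_{ij}=m_{ji}$, $w_{ijk}=w_{kij}$, $w_{ijk}=-w_{kji}$; (R2) $m_{ii}=1-\lambda_i^2$; (R3) $w_{jkl}m_{is}-w_{ikl}m_{js}+w_{ijl}m_{ks}-w_{ijk}m_{ls}=0$; (R4)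 $w_{ijk}w_{lst}=\det\begin{pmatrix}m_{il}&m_{is}&m_{it}\\ m_{jl}&m_{js}&m_{jt}\\ m_{kl}&m_{ks}&m_{kt}\end{pmatrix}$. *)

theory Defs
  imports "HOL-Algebra.QuotRing" "HOL-Library.Poly_Mapping"
begin

text \<open>A letter (i, True) stands for g_i, (i, False) for g_i^{-1}.\<close>

definition inv_letter :: "'i \<times> bool \<Rightarrow> 'i \<times> bool" where
  "inv_letter x = (fst x, \<not> snd x)"

fun red_cons :: "'i \<times> bool \<Rightarrow> ('i \<times> bool) list \<Rightarrow> ('i \<times> bool) list" where
  "red_cons x [] = [x]"
| "red_cons x (y # ys) = (if y = inv_letter x then ys else x # y # ys)"

definition reduce :: "('i \<times> bool) list \<Rightarrow> ('i \<times> bool) list" where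
  "reduce xs = foldr red_cons xs []"

definition reduced :: "('i \<times> bool) list \<Rightarrow> bool" where
  "reduced xs \<longleftrightarrow> (\<forall>n. Suc n < length xs \<longrightarrow> xs ! Suc n \<noteq> inv_letter (xs ! n))"

definition free_group :: "'i set \<Rightarrow> ('i \<times> bool) list monoid" where
  "free_group I = \<lparr>carrier = {xs. set xs \<subseteq> I \<times> UNIV \<and> reduced xs},
                   mult = (\<lambda>xs ys. reduce (xs @ ys)), one = []\<rparr>"

definition free_gen :: "'i \<Rightarrow> ('i \<times> bool) list" where
  "free_gen i = [(i, True)]"

definition supp :: "('g \<Rightarrow> 'k::zero) \<Rightarrow> 'g set" where
  "supp f = {x. f x \<noteq> 0}"

definition group_ring :: "('g, 'm) monoid_scheme \<Rightarrow> ('g \<Rightarrow> 'k::field) ring" where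
  "group_ring G = \<lparr>carrier = {f. finite (supp f) \<and> supp f \<subseteq> carrier G},
     mult = (\<lambda>f h x. \<Sum>u\<in>supp f. \<Sum>v\<in>supp h. if u \<otimes>\<^bsub>G\<^esub> v = x then f u * h v else 0),
     one = (\<lambda>x. if x = \<one>\<^bsub>G\<^esub> then 1 else 0),
     zero = (\<lambda>x. 0),
     add = (\<lambda>f h x. f x + h x)\<rparr>"

definition gr_basis :: "'g \<Rightarrow> ('g \<Rightarrow> 'k::field)" where
  "gr_basis g = (\<lambda>x. if x = g then 1 else 0)"

definition gr_scale :: "'k::field \<Rightarrow> ('g \<Rightarrow> 'k) \<Rightarrow> ('g \<Rightarrow> 'k)" where
  "gr_scale c f = (\<lambda>x. c * f x)"

definition gr_add :: "('g \<Rightarrow> 'k::field) \<Rightarrow> ('g \<Rightarrow> 'k) \<Rightarrow> ('g \<Rightarrow> 'k)" where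
  "gr_add f h = (\<lambda>x. f x + h x)"

definition gr_sub :: "('g \<Rightarrow> 'k::field) \<Rightarrow> ('g \<Rightarrow> 'k) \<Rightarrow> ('g \<Rightarrow> 'k)" where
  "gr_sub f h = (\<lambda>x. f x - h x)"

text \<open>The k-linear involution * with g* = g^{-1}.\<close>
definition gr_star :: "('g, 'm) monoid_scheme \<Rightarrow> ('g \<Rightarrow> 'k::field) \<Rightarrow> ('g \<Rightarrow> 'k)" where
  "gr_star G f = (\<lambda>x. if x \<in> carrier G then f (inv\<^bsub>G\<^esub> x) else 0)"

definition star_ideal :: "('g, 'm) monoid_scheme \<Rightarrow> ('g \<Rightarrow> 'k::field) set" where
  "star_ideal G = genideal (group_ring G)
     {gr_sub (a \<otimes>\<^bsub>group_ring G\<^esub> b) (b \<otimes>\<^bsub>group_ring G\<^esub> a) | a b.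
        a \<in> carrier (group_ring G) \<and> b \<in> carrier (group_ring G) \<and> gr_star G b = b}"

definition A_ring :: "('g, 'm) monoid_scheme \<Rightarrow> ('g \<Rightarrow> 'k::field) set ring" where
  "A_ring G = group_ring G Quot star_ideal G"

definition A_cls :: "('g, 'm) monoid_scheme \<Rightarrow> ('g \<Rightarrow> 'k::field) \<Rightarrow> ('g \<Rightarrow> 'k) set" where
  "A_cls G x = star_ideal G +>\<^bsub>group_ring G\<^esub> x"

definition A_star :: "('g, 'm) monoid_scheme \<Rightarrow> ('g \<Rightarrow> 'k::field) set \<Rightarrow> ('g \<Rightarrow> 'k) set" where
  "A_star G X = gr_star G ` X"

definition sharp :: "('g, 'm) monoid_scheme \<Rightarrow> ('g \<Rightarrow> 'k::field) set set" where
  "sharp G = {X \<in> carrier (A_ring G). A_star G X = X}"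

text \<open>bar x = (x + x*)/2, vec x = (x - x*)/2, dot and bracket (computed in kG; the
  quotient map to A_G is a ring homomorphism).\<close>
definition gbar :: "('g, 'm) monoid_scheme \<Rightarrow> ('g \<Rightarrow> 'k::field) \<Rightarrow> ('g \<Rightarrow> 'k)" where
  "gbar G x = gr_scale (1/2) (gr_add x (gr_star G x))"

definition gvec :: "('g, 'm) monoid_scheme \<Rightarrow> ('g \<Rightarrow> 'k::field) \<Rightarrow> ('g \<Rightarrow> 'k)" where
  "gvec G x = gr_scale (1/2) (gr_sub x (gr_star G x))"

definition gdot :: "('g, 'm) monoid_scheme \<Rightarrow> ('g \<Rightarrow> 'k::field) \<Rightarrow> ('g \<Rightarrow> 'k) \<Rightarrow> ('g \<Rightarrow> 'k)" where
  "gdot G x y = gr_scale (- 1/2) (gr_add (x \<otimes>\<^bsub>group_ring G\<^esub> y) (y \<otimes>\<^bsub>group_ring G\<^esub> x))"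

definition gbrk :: "('g, 'm) monoid_scheme \<Rightarrow> ('g \<Rightarrow> 'k::field) \<Rightarrow> ('g \<Rightarrow> 'k) \<Rightarrow> ('g \<Rightarrow> 'k)" where
  "gbrk G x y = gr_scale (1/2) (gr_sub (x \<otimes>\<^bsub>group_ring G\<^esub> y) (y \<otimes>\<^bsub>group_ring G\<^esub> x))"

datatype 'i pvar = Lam 'i | Mv 'i 'i | Wv 'i 'i 'i

fun pvar_idx :: "'i pvar \<Rightarrow> 'i set" where
  "pvar_idx (Lam i) = {i}"
| "pvar_idx (Mv i j) = {i, j}"
| "pvar_idx (Wv i j k) = {i, j, k}"

type_synonym ('i, 'k) mpoly = "('i pvar \<Rightarrow>\<^sub>0 nat) \<Rightarrow>\<^sub>0 'k"

definition PV :: "'i pvar \<Rightarrow> ('i, 'k::comm_ring_1) mpoly" where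
  "PV v = Poly_Mapping.single (Poly_Mapping.single v 1) 1"

definition PC :: "'k::comm_ring_1 \<Rightarrow> ('i, 'k) mpoly" where
  "PC c = Poly_Mapping.single 0 c"

definition poly_ring :: "'i set \<Rightarrow> ('i, 'k::comm_ring_1) mpoly ring" where
  "poly_ring I = \<lparr>carrier = {p :: (('i, 'k) mpoly). \<forall>m\<in>Poly_Mapping.keys p. \<forall>v\<in>Poly_Mapping.keys m. pvar_idx v \<subseteq> I},
     mult = (*), one = 1, zero = 0, add = (+)\<rparr>"

definition det3 :: "'a::comm_ring_1 \<Rightarrow> 'a \<Rightarrow> 'a \<Rightarrow> 'a \<Rightarrow> 'a \<Rightarrow> 'a \<Rightarrow> 'a \<Rightarrow> 'a \<Rightarrow> 'a \<Rightarrow> 'a" where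
  "det3 a b c d e f g h i = a * (e * i - f * h) - b * (d * i - f * g) + c * (d * h - e * g)"

definition R_rels :: "'i set \<Rightarrow> ('i, 'k::comm_ring_1) mpoly set" where
  "R_rels I =
     {PV (Mv i j) - PV (Mv j i) | i j. i \<in> I \<and> j \<in> I}
   \<union> {PV (Wv i j k) - PV (Wv k i j) | i j k. i \<in> I \<and> j \<in> I \<and> k \<in> I}
   \<union> {PV (Wv i j k) + PV (Wv k j i) | i j k. i \<in> I \<and> j \<in> I \<and> k \<in> I}
   \<union> {PV (Mv i i) - (1 - PV (Lam i) ^ 2) | i. i \<in> I}
   \<union> {PV (Wv j k l) * PV (Mv i s) - PV (Wv i k l) * PV (Mv j s)
        + PV (Wv i j l) * PV (Mv k s) - PV (Wv i j k) * PV (Mv l s)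
      | i j k l s. i \<in> I \<and> j \<in> I \<and> k \<in> I \<and> l \<in> I \<and> s \<in> I}
   \<union> {PV (Wv i j k) * PV (Wv l s t)
        - det3 (PV (Mv i l)) (PV (Mv i s)) (PV (Mv i t))
               (PV (Mv j l)) (PV (Mv j s)) (PV (Mv j t))
               (PV (Mv k l)) (PV (Mv k s)) (PV (Mv k t))
      | i j k l s t. i \<in> I \<and> j \<in> I \<and> k \<in> I \<and> l \<in> I \<and> s \<in> I \<and> t \<in> I}"

definition R_ideal :: "'i set \<Rightarrow> ('i, 'k::comm_ring_1) mpoly set" where
  "R_ideal I = genideal (poly_ring I) (R_rels I)"

definition R_ring :: "'i set \<Rightarrow> ('i, 'k::comm_ring_1) mpoly set ring" where
  "R_ring I = poly_ring I Quot R_ideal I"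

definition R_cls :: "'i set \<Rightarrow> ('i, 'k::comm_ring_1) mpoly \<Rightarrow> ('i, 'k) mpoly set" where
  "R_cls I p = R_ideal I +>\<^bsub>poly_ring I\<^esub> p"

end

theory Submission
  imports Defs
begin

text \<open>In \<open>A\<close> the skew elements behave like vectors of an oriented three-space: anticommutators are
  central and give the dot product, commutators give the bracket, and the double bracket formula
  \<open>[x, [y, z]] = (x . z) y - (x . y) z\<close> implies the relations (R1)-(R4) and shows that \<open>A\<close> is spanned
  over the image of \<open>R\<close> by \<open>1\<close>, the vectors of the generators and their brackets. Hence the map is
  well defined and surjective.

  For injectivity, let \<open>R\<close> act on triples consisting of a scalar, the dot products of a vector with
  the vectors of the generators, and its dot products with their brackets, subject to the linear
  relations that such dot products satisfy. Left multiplication by a vector has a formula in these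
  coordinates, and (R1)-(R4) imply that it preserves the relations. So the free group acts,
  every \<open>g + g\<^sup>-\<^sup>1\<close> acts as a scalar, and the scalar by which a symmetric element acts recovers the
  preimage in \<open>R\<close>.\<close>

section \<open>Free groups\<close>

text \<open>A module generated over \<open>R\<close> by scalars, vectors and brackets would have to
  be divided by linear dependences, and equality in such a quotient is hard to test, as nothing is
  known beforehand about torsion in \<open>R\<close>. Recording a vector by its dot products
  replaces the quotient by a submodule of functions, where membership and equality are polynomial
  identities. The equations of \<open>vmod\<close> are \<open>triple_scale_vector\<close> dotted
  with the unknown vector, and (R4) with the unknown vector in place of one generator. The triple
  (1, 0, 0) solves them, so a scalar operator determines its scalar.

  The operators of a word and of its inverse have the form a + X and a - X, like conjugate
  quaternions. This is why symmetric elements act as scalars, their commutators act as zero, and the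
  action descends to \<open>A\<close>.

  Both rings depend on the set \<open>I\<close>, while noncommutative normalisation is convenient in
  type class rings. The products over all index sets are such rings, and statements about one
  \<open>I\<close> are read off from one component.\<close>

lemma inv_letter_inv_letter [simp]: "inv_letter (inv_letter x) = x"
  by (simp add: inv_letter_def)

lemma inv_letter_pair [simp]: "inv_letter (i, b) = (i, \<not> b)"
  by (simp add: inv_letter_def)

lemma fst_inv_letter [simp]: "fst (inv_letter x) = fst x"
  by (simp add: inv_letter_def)

lemma reduced_Nil [simp]: "reduced []"
  by (simp add: reduced_def)

lemma reduced_Cons:
  "reduced (x # w) \<longleftrightarrow> reduced w \<and> (case w of [] \<Rightarrow> True | y # _ \<Rightarrow> y \<noteq> inv_letter x)"
  unfolding reduced_def
  by (cases w) (auto simp: nth_Cons split: nat.splits)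

lemma reduced_single [simp]: "reduced [x]"
  by (simp add: reduced_Cons)

lemma reduced_red_cons: "reduced w \<Longrightarrow> reduced (red_cons x w)"
  by (cases w) (auto simp: reduced_Cons)

lemma red_cons_eq_Cons: "reduced (x # w) \<Longrightarrow> red_cons x w = x # w"
  by (cases w) (auto simp: reduced_Cons)

text \<open>Prefixing a letter with cancellation is thus a permutation of the reduced words.
  Associativity of the free group is derived from this action (van der Waerden's argument), with no
  discussion of confluence.\<close>

lemma red_cons_cancel: "reduced w \<Longrightarrow> red_cons x (red_cons (inv_letter x) w) = w"
  using red_cons_eq_Cons[of x "tl w"] by (cases w) auto

lemma reduced_foldr: "reduced w \<Longrightarrow> reduced (foldr red_cons v w)"
  by (induction v) (auto simp: reduced_red_cons)

lemma reduced_reduce [simp]: "reduced (reduce w)"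
  by (simp add: reduce_def reduced_foldr)

lemma reduce_id: "reduced w \<Longrightarrow> reduce w = w"
proof (induction w)
  case (Cons x w)
  then have "reduce w = w" by (simp add: reduced_Cons)
  then show ?case using Cons.prems by (simp add: reduce_def red_cons_eq_Cons)
qed (simp add: reduce_def)

lemma set_red_cons: "set (red_cons x w) \<subseteq> insert x (set w)"
  by (cases w) auto

lemma set_reduce: "set (reduce w) \<subseteq> set w"
proof (induction w)
  case (Cons x w)
  then show ?case using set_red_cons[of x "reduce w"] by (auto simp: reduce_def)
qed (simp add: reduce_def)

lemma reduce_append: "reduce (v @ w) = foldr red_cons v (reduce w)"
  by (simp add: reduce_def)

lemma foldr_red_cons:
  assumes "reduced u" "reduced w"
  shows "foldr red_cons (red_cons x u) w = red_cons x (foldr red_cons u w)"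
proof (cases u)
  case (Cons y ys)
  show ?thesis
  proof (cases "y = inv_letter x")
    case True
    then show ?thesis using Cons red_cons_cancel[OF reduced_foldr[OF assms(2), of ys], of x]
      by simp
  qed (use Cons in simp)
qed simp

text \<open>A word and its reduced form act in the same way on reduced words, since cancelling
  \<open>x\<close> against \<open>inv_letter x\<close> drops two mutually inverse permutations. Both
  bracketings in \<open>reduce_assoc\<close> therefore become the same composite action.\<close>

lemma foldr_reduce:
  "reduced w \<Longrightarrow> foldr red_cons (reduce v) w = foldr red_cons v w"
proof (induction v)
  case (Cons x v)
  have "foldr red_cons (reduce (x # v)) w = red_cons x (foldr red_cons (reduce v) w)"
    using foldr_red_cons[OF reduced_reduce[of v] Cons.prems, of x] by (simp add: reduce_def)
  then show ?case using Cons by simp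
qed (simp add: reduce_def)

lemma reduce_assoc: "reduce (reduce (u @ v) @ w) = reduce (u @ reduce (v @ w))"
proof -
  have "reduce (reduce (u @ v) @ w) = foldr red_cons (u @ v) (reduce w)"
    by (simp only: reduce_append[of "reduce (u @ v)"] foldr_reduce reduced_reduce)
  also have "\<dots> = foldr red_cons u (reduce (v @ w))"
    by (simp add: reduce_append)
  also have "\<dots> = reduce (u @ reduce (v @ w))"
    by (simp only: reduce_append[of u] reduce_id reduced_reduce)
  finally show ?thesis .
qed

definition inv_word :: "('i \<times> bool) list \<Rightarrow> ('i \<times> bool) list" where
  "inv_word w = rev (map inv_letter w)"

lemma inv_word_simps [simp]:
  "inv_word [] = []" "inv_word (x # w) = inv_word w @ [inv_letter x]"
  "inv_word (inv_word w) = w"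
  by (simp_all add: inv_word_def rev_map o_def)

lemma reduced_append_single:
  "reduced (w @ [x]) \<longleftrightarrow> reduced w \<and> (w \<noteq> [] \<longrightarrow> x \<noteq> inv_letter (last w))"
proof (induction w)
  case (Cons y w)
  then show ?case by (cases w) (simp_all add: reduced_Cons conj_ac)
qed simp

lemma reduced_inv_word: "reduced w \<Longrightarrow> reduced (inv_word w)"
proof (induction w)
  case (Cons x w)
  have "last (inv_word w) = inv_letter (hd w)" if "w \<noteq> []"
    using that by (cases w) simp_all
  moreover have "inv_word w \<noteq> [] \<longleftrightarrow> w \<noteq> []" by (simp add: inv_word_def)
  moreover have "reduced w" "w \<noteq> [] \<Longrightarrow> hd w \<noteq> inv_letter x"
    using Cons.prems by (cases w; simp add: reduced_Cons)+
  ultimately show ?case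
    using Cons.IH by (auto simp: reduced_append_single)
qed simp

lemma reduce_inv_word: "reduce (inv_word w @ w) = []"
proof (induction w)
  case (Cons x w)
  have "red_cons (inv_letter x) (red_cons x (reduce w)) = reduce w"
    using red_cons_cancel[of "reduce w" "inv_letter x"] by simp
  then have "reduce (inv_word (x # w) @ x # w) = reduce (inv_word w @ w)"
    by (simp add: reduce_append reduce_def)
  then show ?case using Cons by simp
qed (simp add: reduce_def)

lemma carrier_free_group: "carrier (free_group I) = {w. fst ` set w \<subseteq> I \<and> reduced w}"
  by (force simp: free_group_def)

lemma free_group_simps [simp]:
  "mult (free_group I) = (\<lambda>v w. reduce (v @ w))" "one (free_group I) = []"
  by (simp_all add: free_group_def)

lemma inv_word_closed: "w \<in> carrier (free_group I) \<Longrightarrow> inv_word w \<in> carrier (free_group I)"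
proof -
  have "fst ` set (inv_word w) = fst ` set w"
    by (simp add: inv_word_def image_image)
  then show "w \<in> carrier (free_group I) \<Longrightarrow> inv_word w \<in> carrier (free_group I)"
    by (simp add: carrier_free_group reduced_inv_word)
qed

lemma group_free_group: "group (free_group I)"
proof (rule groupI)
  fix v w assume "v \<in> carrier (free_group I)" "w \<in> carrier (free_group I)"
  then show "v \<otimes>\<^bsub>free_group I\<^esub> w \<in> carrier (free_group I)"
    using set_reduce[of "v @ w"] by (fastforce simp: carrier_free_group)
next
  fix w assume w: "w \<in> carrier (free_group I)"
  show "\<exists>v\<in>carrier (free_group I). v \<otimes>\<^bsub>free_group I\<^esub> w = \<one>\<^bsub>free_group I\<^esub>"
    using inv_word_closed[OF w] reduce_inv_word[of w] by auto
qed (auto simp: carrier_free_group reduce_assoc reduce_id)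

lemma inv_free_group:
  assumes "w \<in> carrier (free_group I)"
  shows "inv\<^bsub>free_group I\<^esub> w = inv_word w"
  by (rule group.inv_equality[OF group_free_group _ assms inv_word_closed[OF assms]])
     (simp add: reduce_inv_word)

section \<open>Evaluation of words in a monoid\<close>

definition word_prod :: "('i \<times> bool \<Rightarrow> 'b::monoid_mult) \<Rightarrow> ('i \<times> bool) list \<Rightarrow> 'b" where
  "word_prod h w = prod_list (map h w)"

lemma word_prod_simps [simp]:
  "word_prod h [] = 1" "word_prod h (x # w) = h x * word_prod h w"
  "word_prod h (v @ w) = word_prod h v * word_prod h w"
  by (simp_all add: word_prod_def)

text \<open>A cancellation only removes a factor \<open>h x * h (inv_letter x)\<close>. This is the
  universal property of the free group; it is applied to the letters \<open>agen\<close> of the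
  quotient rings and to the operators \<open>egen\<close>.\<close>

lemma word_prod_reduce:
  assumes "\<And>x. h x * h (inv_letter x) = 1"
  shows "word_prod h (reduce w) = word_prod h w"
proof (induction w)
  case (Cons x w)
  have "word_prod h (red_cons x v) = h x * word_prod h v" for v
  proof (cases v)
    case (Cons y ys)
    have "h x * (h (inv_letter x) * word_prod h ys) = word_prod h ys"
      using assms[of x] by (metis mult.assoc mult_1)
    then show ?thesis using Cons by simp
  qed simp
  then show ?case using Cons by (simp add: reduce_def)
qed (simp add: reduce_def)

section \<open>Group rings\<close>

text \<open>An algebra structure over \<open>'k\<close> on a type class ring: a unital homomorphism
  into the centre. One linear extension \<open>lift\<close> then serves for single coefficients of a
  product, for the quotient rings \<open>A\<close> and for the operators on the module of
  coordinates.\<close>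

locale central_scalars =
  fixes c :: "'k::field \<Rightarrow> 'b::ring_1"
  assumes add: "c (a + b) = c a + c b"
    and mult: "c (a * b) = c a * c b"
    and one [simp]: "c 1 = 1"
    and commute: "c a * x = x * c a"
begin

lemma zero [simp]: "c 0 = 0"
  using add[of 0 0] by simp

lemma minus: "c (- a) = - c a"
  using add[of a "- a"] by (simp add: eq_neg_iff_add_eq_0 add.commute)

lemma sum: "c (sum f A) = (\<Sum>x\<in>A. c (f x))"
  by (induction A rule: infinite_finite_induct) (simp_all add: add)

definition lift :: "('g \<Rightarrow> 'b) \<Rightarrow> ('g \<Rightarrow> 'k) \<Rightarrow> 'b" where
  "lift h f = (\<Sum>u\<in>supp f. c (f u) * h u)"

lemma lift_superset:
  assumes "finite U" "supp f \<subseteq> U"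
  shows "lift h f = (\<Sum>u\<in>U. c (f u) * h u)"
  unfolding lift_def by (rule sum.mono_neutral_left) (use assms in \<open>auto simp: supp_def\<close>)

lemma lift_add:
  assumes "finite (supp f)" "finite (supp g)"
  shows "lift h (\<lambda>x. f x + g x) = lift h f + lift h g"
proof -
  have "supp (\<lambda>x. f x + g x) \<subseteq> supp f \<union> supp g" by (auto simp: supp_def)
  then show ?thesis
    using assms by (simp add: lift_superset[of "supp f \<union> supp g"] add distrib_right sum.distrib)
qed

lemma lift_scale:
  assumes "finite (supp f)"
  shows "lift h (gr_scale a f) = c a * lift h f"
proof -
  have "supp (gr_scale a f) \<subseteq> supp f" by (auto simp: supp_def gr_scale_def)
  then show ?thesis
    using assms
    by (simp add: lift_superset[of "supp f"] gr_scale_def mult sum_distrib_left mult.assoc)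
qed

lemma lift_basis [simp]: "lift h (gr_basis g) = h g"
proof -
  have "supp (gr_basis g :: _ \<Rightarrow> 'k) = {g}" by (auto simp: supp_def gr_basis_def)
  then show ?thesis by (simp add: lift_def gr_basis_def)
qed

end

lemma supp_mult:
  "supp (f \<otimes>\<^bsub>group_ring G\<^esub> g) \<subseteq> (\<lambda>(u, v). u \<otimes>\<^bsub>G\<^esub> v) ` (supp f \<times> supp g)"
proof
  fix x assume "x \<in> supp (f \<otimes>\<^bsub>group_ring G\<^esub> g)"
  then have "(\<Sum>u\<in>supp f. \<Sum>v\<in>supp g. if u \<otimes>\<^bsub>G\<^esub> v = x then f u * g v else 0) \<noteq> 0"
    by (simp add: supp_def group_ring_def)
  then obtain u v where "u \<in> supp f" "v \<in> supp g" "u \<otimes>\<^bsub>G\<^esub> v = x"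
    by (auto elim!: sum.not_neutral_contains_not_neutral split: if_splits)
  then show "x \<in> (\<lambda>(u, v). u \<otimes>\<^bsub>G\<^esub> v) ` (supp f \<times> supp g)"
    by force
qed

lemma (in central_scalars) lift_mult_sum:
  assumes "finite (supp f)" "finite (supp g)"
  shows "lift h (f \<otimes>\<^bsub>group_ring G\<^esub> g) =
    (\<Sum>u\<in>supp f. \<Sum>v\<in>supp g. c (f u) * c (g v) * h (u \<otimes>\<^bsub>G\<^esub> v))"
proof -
  \<comment> \<open>The product is supported in the finite set \<open>?P\<close>, so the outer sum
    may be moved inside, where it collapses to the single term x = uv.\<close>
  let ?P = "(\<lambda>(u, v). u \<otimes>\<^bsub>G\<^esub> v) ` (supp f \<times> supp g)"
  have P: "finite ?P" using assms by simp
  have "lift h (f \<otimes>\<^bsub>group_ring G\<^esub> g) = (\<Sum>x\<in>?P. c ((f \<otimes>\<^bsub>group_ring G\<^esub> g) x) * h x)"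
    by (rule lift_superset[OF P supp_mult])
  also have "\<dots> = (\<Sum>x\<in>?P. \<Sum>u\<in>supp f. \<Sum>v\<in>supp g.
      if u \<otimes>\<^bsub>G\<^esub> v = x then c (f u) * c (g v) * h x else 0)"
    by (simp add: group_ring_def sum sum_distrib_right if_distrib[of c] mult
        if_distrib[of "\<lambda>y. y * _"] cong: if_cong)
  also have "\<dots> = (\<Sum>u\<in>supp f. \<Sum>v\<in>supp g. \<Sum>x\<in>?P.
      if u \<otimes>\<^bsub>G\<^esub> v = x then c (f u) * c (g v) * h x else 0)"
    by (simp add: sum.swap[of _ "supp f" ?P] sum.swap[of _ "supp g" ?P])
  also have "\<dots> = (\<Sum>u\<in>supp f. \<Sum>v\<in>supp g. c (f u) * c (g v) * h (u \<otimes>\<^bsub>G\<^esub> v))"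
    using P by (intro sum.cong refl) (auto simp: sum.delta')
  finally show ?thesis .
qed

lemma (in central_scalars) lift_mult:
  assumes "f \<in> carrier (group_ring G)" "g \<in> carrier (group_ring G)"
    and "\<And>u v. u \<in> carrier G \<Longrightarrow> v \<in> carrier G \<Longrightarrow> h (u \<otimes>\<^bsub>G\<^esub> v) = h u * h v"
  shows "lift h (f \<otimes>\<^bsub>group_ring G\<^esub> g) = lift h f * lift h g"
proof -
  have f: "finite (supp f)" "supp f \<subseteq> carrier G" and g: "finite (supp g)" "supp g \<subseteq> carrier G"
    using assms by (auto simp: group_ring_def)
  have *: "c (f u) * c (g v) * h (u \<otimes>\<^bsub>G\<^esub> v) = (c (f u) * h u) * (c (g v) * h v)"
    if "u \<in> supp f" "v \<in> supp g" for u v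
  proof -
    have "h (u \<otimes>\<^bsub>G\<^esub> v) = h u * h v" using assms(3)[of u v] that f g by auto
    then have "c (f u) * c (g v) * h (u \<otimes>\<^bsub>G\<^esub> v) = c (f u) * (c (g v) * h u) * h v"
      by (simp only: mult.assoc)
    also have "\<dots> = (c (f u) * h u) * (c (g v) * h v)"
      by (simp only: commute[of "g v" "h u"] mult.assoc)
    finally show ?thesis .
  qed
  have "lift h (f \<otimes>\<^bsub>group_ring G\<^esub> g) =
      (\<Sum>u\<in>supp f. \<Sum>v\<in>supp g. (c (f u) * h u) * (c (g v) * h v))"
    unfolding lift_mult_sum[OF f(1) g(1)] by (intro sum.cong refl) (rule *)
  then show ?thesis by (simp add: lift_def sum_product)
qed

interpretation self_scalars: central_scalars "id :: 'k::field \<Rightarrow> 'k"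
  by (rule central_scalars.intro) (simp_all add: mult.commute)

lemma group_ring_simps [simp]:
  "add (group_ring G) = gr_add" "zero (group_ring G) = (\<lambda>x. 0)"
  "one (group_ring G) = gr_basis \<one>\<^bsub>G\<^esub>"
  by (auto simp: group_ring_def gr_add_def gr_basis_def fun_eq_iff)

lemma carrier_group_ring:
  "f \<in> carrier (group_ring G) \<longleftrightarrow> finite (supp f) \<and> supp f \<subseteq> carrier G"
  by (simp add: group_ring_def)

lemma supp_gr_add: "supp (gr_add f g) \<subseteq> supp f \<union> supp g"
  by (auto simp: supp_def gr_add_def)

lemma supp_gr_scale: "supp (gr_scale a f) \<subseteq> supp f"
  by (auto simp: supp_def gr_scale_def)

lemma finite_supp_gr_basis [simp]: "finite (supp (gr_basis g))"
  by (auto simp: supp_def gr_basis_def)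

lemma finite_supp_gr_scale: "finite (supp f) \<Longrightarrow> finite (supp (gr_scale a f))"
  using supp_gr_scale finite_subset by metis

lemma gr_add_closed:
  "f \<in> carrier (group_ring G) \<Longrightarrow> g \<in> carrier (group_ring G) \<Longrightarrow> gr_add f g \<in> carrier (group_ring G)"
  using supp_gr_add[of f g] by (auto simp: carrier_group_ring intro: finite_subset)

lemma gr_scale_closed:
  "f \<in> carrier (group_ring G) \<Longrightarrow> gr_scale a f \<in> carrier (group_ring G)"
  using supp_gr_scale[of a f] by (auto simp: carrier_group_ring intro: finite_subset)

lemma gr_basis_closed: "g \<in> carrier G \<Longrightarrow> gr_basis g \<in> carrier (group_ring G)"
  by (auto simp: carrier_group_ring supp_def gr_basis_def)

lemma gr_sub_eq: "gr_sub f g = gr_add f (gr_scale (- 1) g)"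
  by (auto simp: gr_sub_def gr_add_def gr_scale_def)

lemma gr_sub_closed:
  "f \<in> carrier (group_ring G) \<Longrightarrow> g \<in> carrier (group_ring G) \<Longrightarrow> gr_sub f g \<in> carrier (group_ring G)"
  by (simp add: gr_sub_eq gr_add_closed gr_scale_closed)

lemma (in central_scalars) lift_sub:
  assumes "f \<in> carrier (group_ring G)" "g \<in> carrier (group_ring G)"
  shows "lift h (gr_sub f g) = lift h f - lift h g"
proof -
  have "finite (supp (gr_scale (- 1) g))"
    using assms gr_scale_closed[of g G "- 1"] by (simp add: carrier_group_ring)
  then have "lift h (gr_add f (gr_scale (- 1) g)) = lift h f + c (- 1) * lift h g"
    using assms by (simp add: gr_add_def lift_add lift_scale carrier_group_ring)
  then show ?thesis by (simp add: gr_sub_eq minus)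
qed

text \<open>A coefficient of the product is the linear extension of an indicator function in both
  arguments, so bilinearity of the product follows from the linearity of
  \<open>lift\<close>.\<close>

lemma gr_mult_apply:
  assumes "finite (supp f)" "finite (supp g)"
  shows "(f \<otimes>\<^bsub>group_ring G\<^esub> g) x =
    self_scalars.lift (\<lambda>u. self_scalars.lift (\<lambda>v. if u \<otimes>\<^bsub>G\<^esub> v = x then 1 else 0) g) f"
  by (simp add: group_ring_def self_scalars.lift_def sum_distrib_left
      if_distrib[of "\<lambda>y. _ * y"] cong: if_cong)

lemma (in group) gr_mult_closed:
  assumes "f \<in> carrier (group_ring G)" "g \<in> carrier (group_ring G)"
  shows "f \<otimes>\<^bsub>group_ring G\<^esub> g \<in> carrier (group_ring G)"
proof -
  have "(\<lambda>(u, v). u \<otimes> v) ` (supp f \<times> supp g) \<subseteq> carrier G"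
    "finite ((\<lambda>(u, v). u \<otimes> v) ` (supp f \<times> supp g))"
    using assms by (auto simp: carrier_group_ring)
  then show ?thesis
    unfolding carrier_group_ring using supp_mult[of G f g] by (meson finite_subset subset_trans)
qed

lemma gr_add_mult:
  assumes "finite (supp f)" "finite (supp f')" "finite (supp g)"
  shows "gr_add f f' \<otimes>\<^bsub>group_ring G\<^esub> g =
    gr_add (f \<otimes>\<^bsub>group_ring G\<^esub> g) (f' \<otimes>\<^bsub>group_ring G\<^esub> g)"
proof
  fix x
  have "finite (supp (gr_add f f'))"
    using assms supp_gr_add[of f f'] by (meson finite_UnI finite_subset)
  then show "(gr_add f f' \<otimes>\<^bsub>group_ring G\<^esub> g) x =
      gr_add (f \<otimes>\<^bsub>group_ring G\<^esub> g) (f' \<otimes>\<^bsub>group_ring G\<^esub> g) x"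
    using assms by (simp add: gr_mult_apply) (simp add: gr_add_def self_scalars.lift_add gr_mult_apply)
qed

lemma self_lift_add_fun:
  "self_scalars.lift (\<lambda>u. h u + h' u) f = self_scalars.lift h f + self_scalars.lift h' f"
  by (simp add: self_scalars.lift_def distrib_left sum.distrib)

lemma self_lift_scale_fun:
  "self_scalars.lift (\<lambda>u. a * h u) f = a * self_scalars.lift h f"
  by (simp add: self_scalars.lift_def sum_distrib_left mult.left_commute)

lemma gr_mult_add:
  assumes "finite (supp f)" "finite (supp g)" "finite (supp g')"
  shows "f \<otimes>\<^bsub>group_ring G\<^esub> gr_add g g' =
    gr_add (f \<otimes>\<^bsub>group_ring G\<^esub> g) (f \<otimes>\<^bsub>group_ring G\<^esub> g')"
proof
  fix x
  have "finite (supp (gr_add g g'))"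
    using assms supp_gr_add[of g g'] by (meson finite_UnI finite_subset)
  then show "(f \<otimes>\<^bsub>group_ring G\<^esub> gr_add g g') x =
      gr_add (f \<otimes>\<^bsub>group_ring G\<^esub> g) (f \<otimes>\<^bsub>group_ring G\<^esub> g') x"
    using assms
    by (simp add: gr_mult_apply)
       (simp add: gr_add_def self_scalars.lift_add self_lift_add_fun gr_mult_apply)
qed

lemma gr_scale_mult:
  assumes "finite (supp f)" "finite (supp g)"
  shows "gr_scale a f \<otimes>\<^bsub>group_ring G\<^esub> g = gr_scale a (f \<otimes>\<^bsub>group_ring G\<^esub> g)"
proof
  fix x
  have "finite (supp (gr_scale a f))"
    using assms supp_gr_scale[of a f] by (meson finite_subset)
  then show "(gr_scale a f \<otimes>\<^bsub>group_ring G\<^esub> g) x = gr_scale a (f \<otimes>\<^bsub>group_ring G\<^esub> g) x"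
    using assms by (simp add: gr_mult_apply self_scalars.lift_scale)
      (simp add: gr_scale_def gr_mult_apply)
qed

lemma gr_mult_scale:
  assumes "finite (supp f)" "finite (supp g)"
  shows "f \<otimes>\<^bsub>group_ring G\<^esub> gr_scale a g = gr_scale a (f \<otimes>\<^bsub>group_ring G\<^esub> g)"
proof
  fix x
  have "finite (supp (gr_scale a g))"
    using assms supp_gr_scale[of a g] by (meson finite_subset)
  then show "(f \<otimes>\<^bsub>group_ring G\<^esub> gr_scale a g) x = gr_scale a (f \<otimes>\<^bsub>group_ring G\<^esub> g) x"
    using assms by (simp add: gr_mult_apply self_scalars.lift_scale self_lift_scale_fun)
      (simp add: gr_scale_def gr_mult_apply)
qed

lemma gr_basis_mult:
  "(gr_basis u :: 'g \<Rightarrow> 'k::field) \<otimes>\<^bsub>group_ring G\<^esub> gr_basis v = gr_basis (u \<otimes>\<^bsub>G\<^esub> v)"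
proof
  fix x
  show "((gr_basis u :: 'g \<Rightarrow> 'k) \<otimes>\<^bsub>group_ring G\<^esub> gr_basis v) x = gr_basis (u \<otimes>\<^bsub>G\<^esub> v) x"
    by (simp add: gr_mult_apply) (auto simp: gr_basis_def)
qed

text \<open>Identities that are linear in each argument only have to be checked on group elements;
  associativity and the rule for \<open>gr_star\<close> of a product are proved in this way.\<close>

lemma group_ring_induct [consumes 1, case_names zero add]:
  fixes P :: "('g \<Rightarrow> 'k::field) \<Rightarrow> bool"
  assumes "f \<in> carrier (group_ring G)"
    and zero: "P (\<lambda>x. 0)"
    and add: "\<And>f g a. f \<in> carrier (group_ring G) \<Longrightarrow> P f \<Longrightarrow> g \<in> carrier G \<Longrightarrow>
      P (gr_add f (gr_scale a (gr_basis g)))"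
  shows "P f"
proof -
  have "\<forall>f. f \<in> carrier (group_ring G) \<longrightarrow> supp f \<subseteq> U \<longrightarrow> P f"
    if "finite U" "U \<subseteq> carrier G" for U
    using that
  proof (induction U rule: finite_induct)
    case empty
    then show ?case using zero by (auto simp: supp_def)
  next
    case (insert g U)
    show ?case
    proof (intro allI impI)
      fix f :: "'g \<Rightarrow> 'k"
      assume f: "f \<in> carrier (group_ring G)" "supp f \<subseteq> insert g U"
      let ?f = "f(g := 0)"
      have "supp ?f \<subseteq> supp f - {g}" by (auto simp: supp_def)
      then have "?f \<in> carrier (group_ring G)" "supp ?f \<subseteq> U"
        using f by (auto simp: carrier_group_ring intro: finite_subset)
      then have "P (gr_add ?f (gr_scale (f g) (gr_basis g)))"
        using insert by (intro add) auto
      also have "gr_add ?f (gr_scale (f g) (gr_basis g)) = f"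
        by (auto simp: gr_add_def gr_scale_def gr_basis_def)
      finally show "P f" .
    qed
  qed
  from this[of "supp f"] show ?thesis using assms(1) by (simp add: carrier_group_ring)
qed

lemma gr_mult_zero [simp]:
  "(\<lambda>x. 0) \<otimes>\<^bsub>group_ring G\<^esub> g = (\<lambda>x. 0)" "g \<otimes>\<^bsub>group_ring G\<^esub> (\<lambda>x. 0) = (\<lambda>x. 0)"
  by (simp_all add: group_ring_def supp_def)

lemma (in group) gr_mult_assoc:
  assumes "f \<in> carrier (group_ring G)" "g \<in> carrier (group_ring G)" "h \<in> carrier (group_ring G)"
  shows "(f \<otimes>\<^bsub>group_ring G\<^esub> g) \<otimes>\<^bsub>group_ring G\<^esub> h =
    f \<otimes>\<^bsub>group_ring G\<^esub> (g \<otimes>\<^bsub>group_ring G\<^esub> h)"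
proof -
  let ?m = "\<lambda>f g. f \<otimes>\<^bsub>group_ring G\<^esub> g"
  note fin = gr_mult_closed gr_basis_closed gr_scale_closed
  have C: "finite (supp f)" if "f \<in> carrier (group_ring G)" for f :: "'a \<Rightarrow> 'c"
    using that by (simp add: carrier_group_ring)
  show ?thesis
    using assms(1)
  proof (induction f rule: group_ring_induct)
    case (add f u a)
    have "?m (?m (gr_basis u) g) h = ?m (gr_basis u) (?m g h)"
      using assms(2)
    proof (induction g rule: group_ring_induct)
      case (add g v b)
      have "?m (?m (gr_basis u) (gr_basis v)) h = ?m (gr_basis u) (?m (gr_basis v) h)"
        using assms(3)
      proof (induction h rule: group_ring_induct)
        case (add h w c)
        then show ?case
          using \<open>u \<in> carrier G\<close> \<open>v \<in> carrier G\<close>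
          by (simp add: gr_mult_add gr_mult_scale C fin) (simp add: gr_basis_mult m_assoc)
      qed simp
      with add show ?case
        using \<open>u \<in> carrier G\<close> assms(3)
        by (simp add: gr_mult_add gr_add_mult gr_scale_mult gr_mult_scale C fin)
    qed simp
    with add show ?case
      using assms(2,3) by (simp add: gr_add_mult gr_scale_mult C fin)
  qed simp
qed

lemma (in group) ring_group_ring: "ring (group_ring G :: ('a \<Rightarrow> 'k::field) ring)"
proof (rule ringI)
  show "abelian_group (group_ring G :: ('a \<Rightarrow> 'k) ring)"
  proof (rule abelian_groupI)
    fix f :: "'a \<Rightarrow> 'k" assume "f \<in> carrier (group_ring G)"
    then show "\<exists>g\<in>carrier (group_ring G). g \<oplus>\<^bsub>group_ring G\<^esub> f = \<zero>\<^bsub>group_ring G\<^esub>"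
      by (intro bexI[OF _ gr_scale_closed[of f G "- 1"]]) (auto simp: gr_add_def gr_scale_def)
  qed (auto simp: gr_add_closed, auto simp: gr_add_def ac_simps carrier_group_ring supp_def)
  show "Group.monoid (group_ring G :: ('a \<Rightarrow> 'k) ring)"
  proof (rule monoidI)
    fix f :: "'a \<Rightarrow> 'k" assume f: "f \<in> carrier (group_ring G)"
    have C: "finite (supp f)" if "f \<in> carrier (group_ring G)" for f :: "'a \<Rightarrow> 'k"
      using that by (simp add: carrier_group_ring)
    show "\<one>\<^bsub>group_ring G\<^esub> \<otimes>\<^bsub>group_ring G\<^esub> f = f"
      using f by (induction f rule: group_ring_induct)
        (simp_all add: gr_mult_add gr_mult_scale gr_basis_mult C gr_scale_closed gr_basis_closed)
    show "f \<otimes>\<^bsub>group_ring G\<^esub> \<one>\<^bsub>group_ring G\<^esub> = f"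
      using f by (induction f rule: group_ring_induct)
        (simp_all add: gr_add_mult gr_scale_mult gr_basis_mult C gr_scale_closed gr_basis_closed)
  qed (auto simp: gr_mult_closed gr_basis_closed gr_mult_assoc)
qed (auto simp: gr_add_mult gr_mult_add carrier_group_ring)

section \<open>The involution and the quotient ring\<close>

lemma (in ring) ideal_of_closed:
  assumes "J \<subseteq> carrier R" "\<zero> \<in> J" "\<And>x y. x \<in> J \<Longrightarrow> y \<in> J \<Longrightarrow> x \<oplus> y \<in> J"
    and "\<And>x y. x \<in> J \<Longrightarrow> y \<in> carrier R \<Longrightarrow> y \<otimes> x \<in> J"
    and "\<And>x y. x \<in> J \<Longrightarrow> y \<in> carrier R \<Longrightarrow> x \<otimes> y \<in> J"
  shows "ideal J R"
proof (rule idealI[OF ring_axioms])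
  \<comment> \<open>Closure under negation is closure under multiplication by -1.\<close>
  have "\<ominus> x \<in> J" if "x \<in> J" for x
    using assms(4)[OF that, of "\<ominus> \<one>"] assms(1) that by (auto simp: l_minus)
  then show "subgroup J (add_monoid R)"
    using assms(1-3) by unfold_locales (auto simp: Units_def a_inv_def)
qed (use assms in auto)

context group
begin

lemma gr_star_add: "gr_star G (gr_add f g) = gr_add (gr_star G f) (gr_star G g)"
  by (auto simp: gr_star_def gr_add_def)

lemma gr_star_scale: "gr_star G (gr_scale a f) = gr_scale a (gr_star G f)"
  by (auto simp: gr_star_def gr_scale_def)

lemma gr_star_zero [simp]: "gr_star G (\<lambda>x. 0) = (\<lambda>x. 0)"
  by (auto simp: gr_star_def)

lemma gr_star_basis: "g \<in> carrier G \<Longrightarrow> gr_star G (gr_basis g) = gr_basis (inv g)"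
  by (auto simp: gr_star_def gr_basis_def fun_eq_iff)

lemma gr_star_closed:
  assumes "f \<in> carrier (group_ring G)"
  shows "gr_star G f \<in> carrier (group_ring G)"
proof -
  have "supp (gr_star G f) \<subseteq> m_inv G ` supp f"
  proof
    fix x assume "x \<in> supp (gr_star G f)"
    then have "x \<in> carrier G" "inv x \<in> supp f"
      by (auto simp: supp_def gr_star_def split: if_splits)
    then show "x \<in> m_inv G ` supp f"
      by (metis image_eqI inv_inv)
  qed
  moreover have "m_inv G ` supp f \<subseteq> carrier G" "finite (m_inv G ` supp f)"
    using assms by (auto simp: carrier_group_ring)
  ultimately show ?thesis
    unfolding carrier_group_ring by (meson finite_subset subset_trans)
qed

lemma gr_star_star: "f \<in> carrier (group_ring G) \<Longrightarrow> gr_star G (gr_star G f) = f"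
  by (auto simp: gr_star_def carrier_group_ring supp_def fun_eq_iff)

lemma gr_zero_closed [simp]: "(\<lambda>x. 0) \<in> carrier (group_ring G)"
  by (simp add: carrier_group_ring supp_def)

lemma gr_star_mult:
  assumes "f \<in> carrier (group_ring G)" "g \<in> carrier (group_ring G)"
  shows "gr_star G (f \<otimes>\<^bsub>group_ring G\<^esub> g) = gr_star G g \<otimes>\<^bsub>group_ring G\<^esub> gr_star G f"
proof -
  note cl = gr_mult_closed gr_basis_closed gr_scale_closed gr_star_closed gr_add_closed
  have C: "finite (supp f)" if "f \<in> carrier (group_ring G)" for f :: "'a \<Rightarrow> 'c"
    using that by (simp add: carrier_group_ring)
  show ?thesis
    using assms(1)
  proof (induction f rule: group_ring_induct)
    case (add f u a)
    have "gr_star G (gr_basis u \<otimes>\<^bsub>group_ring G\<^esub> g) = gr_star G g \<otimes>\<^bsub>group_ring G\<^esub> gr_star G (gr_basis u)"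
      using assms(2)
    proof (induction g rule: group_ring_induct)
      case (add g v b)
      then show ?case
        using \<open>u \<in> carrier G\<close>
        by (simp add: gr_mult_add gr_mult_scale gr_add_mult gr_scale_mult C cl gr_star_add
            gr_star_scale) (simp add: gr_basis_mult gr_star_basis inv_mult_group)
    qed simp
    with add assms(2) show ?case
      by (simp add: gr_mult_add gr_mult_scale gr_add_mult gr_scale_mult C cl gr_star_add
            gr_star_scale)
  qed simp
qed

text \<open>Ideals and quotient maps know ring operations only; multiplying by a multiple of the
  identity carries scalars through them.\<close>

lemma gr_scale_eq_mult:
  fixes f :: "'a \<Rightarrow> 'k::field"
  assumes "f \<in> carrier (group_ring G)"
  shows "gr_scale a f = gr_scale a (gr_basis \<one>) \<otimes>\<^bsub>group_ring G\<^esub> f"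
proof -
  interpret K: ring "group_ring G :: ('a \<Rightarrow> 'k) ring" by (rule ring_group_ring)
  show ?thesis
    using assms K.one_closed K.l_one[OF assms] by (simp add: gr_scale_mult carrier_group_ring)
qed

lemma ideal_star_ideal: "ideal (star_ideal G :: ('a \<Rightarrow> 'k::field) set) (group_ring G)"
  unfolding star_ideal_def
  by (rule ring.genideal_ideal[OF ring_group_ring]) (auto simp: gr_sub_closed gr_mult_closed)

lemma star_ideal_minimal:
  assumes "ideal J (group_ring G)"
    and "\<And>a b :: 'a \<Rightarrow> 'k::field. a \<in> carrier (group_ring G) \<Longrightarrow> b \<in> carrier (group_ring G) \<Longrightarrow>
      gr_star G b = b \<Longrightarrow> gr_sub (a \<otimes>\<^bsub>group_ring G\<^esub> b) (b \<otimes>\<^bsub>group_ring G\<^esub> a) \<in> J"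
  shows "star_ideal G \<subseteq> J"
  unfolding star_ideal_def
  by (rule ring.genideal_minimal[OF ring_group_ring assms(1)]) (use assms(2) in auto)

lemma commutator_mem_star_ideal:
  assumes "a \<in> carrier (group_ring G)" "b \<in> carrier (group_ring G)" "gr_star G b = b"
  shows "gr_sub (a \<otimes>\<^bsub>group_ring G\<^esub> b) (b \<otimes>\<^bsub>group_ring G\<^esub> a) \<in> star_ideal G"
  unfolding star_ideal_def
  by (rule ring.genideal_self[OF ring_group_ring, THEN subsetD])
     (use assms in \<open>auto simp: gr_sub_closed gr_mult_closed\<close>)

text \<open>The involution reverses products, so the elements whose image lies in the ideal form a
  two-sided ideal. If a' is the image of a and b is symmetric, then ab - ba goes to -(a'b - ba'),
  again a commutator with b up to sign. This lets the involution descend to the quotient.\<close>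

lemma gr_star_mem_star_ideal:
  fixes x :: "'a \<Rightarrow> 'k::field"
  assumes "x \<in> star_ideal G"
  shows "gr_star G x \<in> star_ideal G"
proof -
  interpret S: ideal "star_ideal G :: ('a \<Rightarrow> 'k) set" "group_ring G" by (rule ideal_star_ideal)
  let ?J = "{x \<in> carrier (group_ring G). gr_star G x \<in> (star_ideal G :: ('a \<Rightarrow> 'k) set)}"
  have "ideal ?J (group_ring G)"
    using additive_subgroup.a_closed[OF S.additive_subgroup_axioms]
      additive_subgroup.zero_closed[OF S.additive_subgroup_axioms] gr_zero_closed
    by (intro S.ideal_of_closed)
       (auto simp: gr_star_add gr_star_mult gr_add_closed gr_mult_closed gr_star_closed
         S.I_l_closed S.I_r_closed)
  moreover have "gr_sub (a \<otimes>\<^bsub>group_ring G\<^esub> b) (b \<otimes>\<^bsub>group_ring G\<^esub> a) \<in> ?J"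
    if "a \<in> carrier (group_ring G)" "b \<in> carrier (group_ring G)" "gr_star G b = b" for a b :: "'a \<Rightarrow> 'k"
  proof -
    have "gr_star G (gr_sub (a \<otimes>\<^bsub>group_ring G\<^esub> b) (b \<otimes>\<^bsub>group_ring G\<^esub> a)) =
      gr_scale (- 1) (gr_sub (gr_star G a \<otimes>\<^bsub>group_ring G\<^esub> b) (b \<otimes>\<^bsub>group_ring G\<^esub> gr_star G a))"
      using that by (simp add: gr_sub_eq gr_star_add gr_star_scale gr_star_mult)
        (simp add: gr_add_def gr_scale_def)
    also have "\<dots> = gr_scale (- 1) (gr_basis \<one>) \<otimes>\<^bsub>group_ring G\<^esub>
        (gr_sub (gr_star G a \<otimes>\<^bsub>group_ring G\<^esub> b) (b \<otimes>\<^bsub>group_ring G\<^esub> gr_star G a))"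
      using that by (intro gr_scale_eq_mult) (auto simp: gr_sub_closed gr_mult_closed gr_star_closed)
    also have "\<dots> \<in> star_ideal G"
      using that by (intro S.I_l_closed commutator_mem_star_ideal)
        (auto simp: gr_star_closed gr_scale_closed gr_basis_closed)
    finally show ?thesis using that by (simp add: gr_sub_closed gr_mult_closed)
  qed
  ultimately show ?thesis using star_ideal_minimal[of ?J] assms by auto
qed

lemma ring_A_ring: "ring (A_ring G :: ('a \<Rightarrow> 'k::field) set ring)"
  unfolding A_ring_def by (rule ideal.quotient_is_ring[OF ideal_star_ideal])

lemma A_cls_ring_hom:
  "(A_cls G :: ('a \<Rightarrow> 'k::field) \<Rightarrow> _) \<in> ring_hom (group_ring G) (A_ring G)"
proof -
  interpret S: ideal "star_ideal G :: ('a \<Rightarrow> 'k) set" "group_ring G" by (rule ideal_star_ideal)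
  show ?thesis using S.rcos_ring_hom by (simp add: A_cls_def[abs_def] A_ring_def)
qed

lemma carrier_A_ring: "carrier (A_ring G) = A_cls G ` carrier (group_ring G)"
  by (auto simp: A_ring_def FactRing_def A_RCOSETS_def' A_cls_def)

lemmas A_cls_closed = ring_hom_closed[OF A_cls_ring_hom]
lemmas A_cls_mult = ring_hom_mult[OF A_cls_ring_hom]
lemmas A_cls_add = ring_hom_add[OF A_cls_ring_hom, unfolded group_ring_simps]
lemmas A_cls_one = ring_hom_one[OF A_cls_ring_hom, unfolded group_ring_simps]

lemma A_cls_eq_zero_iff:
  fixes x :: "'a \<Rightarrow> 'k::field"
  assumes "x \<in> carrier (group_ring G)"
  shows "A_cls G x = \<zero>\<^bsub>A_ring G\<^esub> \<longleftrightarrow> x \<in> star_ideal G"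
proof -
  interpret S: ideal "star_ideal G :: ('a \<Rightarrow> 'k) set" "group_ring G" by (rule ideal_star_ideal)
  show ?thesis
    using S.a_rcos_zero[OF S.ideal_axioms] S.rcos_const_imp_mem[OF assms]
    by (auto simp only: A_cls_def A_ring_def FactRing_def ring.simps)
qed

text \<open>\<open>A_star\<close> takes images of whole cosets. The image of a coset is again a full
  coset because the involution maps the ideal onto itself, not merely into itself.\<close>

lemma A_star_A_cls:
  fixes x :: "'a \<Rightarrow> 'k::field"
  assumes "x \<in> carrier (group_ring G)"
  shows "A_star G (A_cls G x) = A_cls G (gr_star G x)"
proof -
  interpret S: ideal "star_ideal G :: ('a \<Rightarrow> 'k) set" "group_ring G" by (rule ideal_star_ideal)
  have "gr_star G ` star_ideal G = (star_ideal G :: ('a \<Rightarrow> 'k) set)"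
    using gr_star_mem_star_ideal gr_star_star[OF S.Icarr] by (auto simp: image_iff) metis
  then have "(\<lambda>s. gr_add s (gr_star G x)) ` (gr_star G ` star_ideal G) =
      (\<lambda>s. gr_add s (gr_star G x)) ` star_ideal G"
    by simp
  then show ?thesis
    by (simp add: A_star_def A_cls_def a_r_coset_def r_coset_def UNION_singleton_eq_range
        image_image gr_star_add)
qed

lemma A_star_closed: "X \<in> carrier (A_ring G) \<Longrightarrow> A_star G X \<in> carrier (A_ring G)"
  by (auto simp: carrier_A_ring A_star_A_cls gr_star_closed)

lemma A_star_star: "X \<in> carrier (A_ring G) \<Longrightarrow> A_star G (A_star G X) = X"
  by (auto simp: carrier_A_ring A_star_A_cls gr_star_closed gr_star_star)

lemma A_star_add:
  "X \<in> carrier (A_ring G) \<Longrightarrow> Y \<in> carrier (A_ring G) \<Longrightarrow>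
    A_star G (X \<oplus>\<^bsub>A_ring G\<^esub> Y) = A_star G X \<oplus>\<^bsub>A_ring G\<^esub> A_star G Y"
  by (auto simp: carrier_A_ring A_star_A_cls gr_star_closed gr_star_add gr_add_closed simp flip: A_cls_add)

lemma A_star_mult:
  "X \<in> carrier (A_ring G) \<Longrightarrow> Y \<in> carrier (A_ring G) \<Longrightarrow>
    A_star G (X \<otimes>\<^bsub>A_ring G\<^esub> Y) = A_star G Y \<otimes>\<^bsub>A_ring G\<^esub> A_star G X"
  by (auto simp: carrier_A_ring A_star_A_cls gr_star_closed gr_star_mult gr_mult_closed simp flip: A_cls_mult)

lemma A_cls_commute:
  fixes a b :: "'a \<Rightarrow> 'k::field"
  assumes "a \<in> carrier (group_ring G)" "b \<in> carrier (group_ring G)" "gr_star G b = b"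
  shows "A_cls G a \<otimes>\<^bsub>A_ring G\<^esub> A_cls G b = A_cls G b \<otimes>\<^bsub>A_ring G\<^esub> A_cls G a"
proof -
  interpret A: ring "A_ring G :: ('a \<Rightarrow> 'k) set ring" by (rule ring_A_ring)
  let ?d = "gr_sub (a \<otimes>\<^bsub>group_ring G\<^esub> b) (b \<otimes>\<^bsub>group_ring G\<^esub> a)"
  note cl = assms gr_mult_closed gr_sub_closed A_cls_closed
  have "A_cls G (a \<otimes>\<^bsub>group_ring G\<^esub> b) = A_cls G (gr_add ?d (b \<otimes>\<^bsub>group_ring G\<^esub> a))"
    by (simp add: gr_add_def gr_sub_def)
  also have "\<dots> = A_cls G ?d \<oplus>\<^bsub>A_ring G\<^esub> A_cls G (b \<otimes>\<^bsub>group_ring G\<^esub> a)"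
    by (rule A_cls_add) (simp_all add: cl)
  also have "A_cls G ?d = \<zero>\<^bsub>A_ring G\<^esub>"
    using A_cls_eq_zero_iff[of ?d] commutator_mem_star_ideal[OF assms] by (simp add: cl)
  finally show ?thesis by (simp add: A_cls_mult cl)
qed

text \<open>The ideal is generated by commutators with elements that are symmetric in the group ring
  itself, whereas a member of \<open>sharp G\<close> is symmetric only modulo the ideal. Averaging a
  representative with its image under the involution repairs this without changing the class, so
  that centrality follows in \<open>sharp_commute\<close>.\<close>

lemma sharp_lift:
  fixes X :: "('a \<Rightarrow> 'k::field_char_0) set"
  assumes "X \<in> sharp G"
  obtains b where "b \<in> carrier (group_ring G)" "gr_star G b = b" "X = A_cls G b"
proof -
  obtain x where x: "x \<in> carrier (group_ring G)" "X = A_cls G x"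
    using assms by (auto simp: sharp_def carrier_A_ring)
  define b where "b = gr_scale (1/2) (gr_add x (gr_star G x))"
  let ?h = "gr_scale (1/2) (gr_basis \<one>) :: 'a \<Rightarrow> 'k"
  have cl: "?h \<in> carrier (group_ring G)" "gr_star G x \<in> carrier (group_ring G)"
    using x by (auto simp: gr_scale_closed gr_basis_closed gr_star_closed)
  note scale = gr_scale_eq_mult[of _ "1/2"]
  have "A_cls G b = A_cls G ?h \<otimes>\<^bsub>A_ring G\<^esub> (A_cls G x \<oplus>\<^bsub>A_ring G\<^esub> A_cls G (gr_star G x))"
    unfolding b_def using x cl by (simp add: scale gr_add_closed A_cls_mult A_cls_add)
  also have "A_cls G (gr_star G x) = A_cls G x"
    using assms x A_star_A_cls[of x] by (simp add: sharp_def)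
  also have "A_cls G ?h \<otimes>\<^bsub>A_ring G\<^esub> (A_cls G x \<oplus>\<^bsub>A_ring G\<^esub> A_cls G x) =
      A_cls G (gr_scale (1/2) (gr_add x x))"
    using x cl by (simp add: scale gr_add_closed A_cls_mult A_cls_add)
  also have "gr_scale (1/2) (gr_add x x) = x"
    by (auto simp: gr_scale_def gr_add_def)
  finally have "A_cls G b = X" using x by simp
  moreover have "gr_star G b = b"
    unfolding b_def using x by (simp add: gr_star_scale gr_star_add gr_star_star)
      (simp add: gr_add_def add.commute)
  moreover have "b \<in> carrier (group_ring G)"
    unfolding b_def using x cl by (simp add: gr_scale_closed gr_add_closed)
  ultimately show ?thesis using that by metis
qed

lemma sharp_commute:
  fixes X :: "('a \<Rightarrow> 'k::field_char_0) set"
  assumes "X \<in> sharp G" "Y \<in> carrier (A_ring G)"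
  shows "Y \<otimes>\<^bsub>A_ring G\<^esub> X = X \<otimes>\<^bsub>A_ring G\<^esub> Y"
  using assms by (auto elim!: sharp_lift simp: carrier_A_ring A_cls_commute)

text \<open>The augmentation kills all commutators.\<close>
lemma A_ring_nontrivial: "\<one>\<^bsub>A_ring G\<^esub> \<noteq> (\<zero>\<^bsub>A_ring G\<^esub> :: ('a \<Rightarrow> 'k::field) set)"
proof
  assume eq: "\<one>\<^bsub>A_ring G\<^esub> = (\<zero>\<^bsub>A_ring G\<^esub> :: ('a \<Rightarrow> 'k) set)"
  interpret K: ring "group_ring G :: ('a \<Rightarrow> 'k) ring" by (rule ring_group_ring)
  let ?\<epsilon> = "self_scalars.lift (\<lambda>_. 1) :: ('a \<Rightarrow> 'k) \<Rightarrow> 'k"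
  let ?J = "{x \<in> carrier (group_ring G). ?\<epsilon> x = 0}"
  have add: "?\<epsilon> (gr_add x y) = ?\<epsilon> x + ?\<epsilon> y"
    if "x \<in> carrier (group_ring G)" "y \<in> carrier (group_ring G)" for x y
    using that self_scalars.lift_add[of x y] by (simp add: carrier_group_ring gr_add_def)
  have mult: "?\<epsilon> (x \<otimes>\<^bsub>group_ring G\<^esub> y) = ?\<epsilon> x * ?\<epsilon> y"
    if "x \<in> carrier (group_ring G)" "y \<in> carrier (group_ring G)" for x y
    using that by (intro self_scalars.lift_mult) simp_all
  have zero: "?\<epsilon> (\<lambda>x. 0) = 0"
    by (simp add: self_scalars.lift_def supp_def)
  have "ideal ?J (group_ring G)"
    by (rule K.ideal_of_closed)
       (auto simp: add mult gr_add_closed gr_mult_closed zero)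
  moreover have "gr_sub (a \<otimes>\<^bsub>group_ring G\<^esub> b) (b \<otimes>\<^bsub>group_ring G\<^esub> a) \<in> ?J"
    if "a \<in> carrier (group_ring G)" "b \<in> carrier (group_ring G)" for a b :: "'a \<Rightarrow> 'k"
    using that gr_mult_closed[of a b] gr_mult_closed[of b a]
    by (simp add: gr_sub_closed self_scalars.lift_sub[where G = G] mult mult.commute)
  ultimately have "star_ideal G \<subseteq> ?J" by (rule star_ideal_minimal)
  moreover have "gr_basis \<one> \<in> (star_ideal G :: ('a \<Rightarrow> 'k) set)"
    by (subst A_cls_eq_zero_iff[symmetric]) (simp_all add: gr_basis_closed A_cls_one eq)
  ultimately show False by auto
qed

end

section \<open>Rings with central anticommutators of vectors\<close>

text \<open>Passing x through a product by anticommutators gives xuv - uvx = (xu + ux)v - u(xv +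
  vx), and here both anticommutators are central. They are kept as variables \<open>p\<close> and
  \<open>q\<close> so that the operators, where they are explicit scalars, can use the same
  identity.\<close>

lemma double_commutator:
  fixes x y z :: "'a::ring_1"
  assumes p: "p = x * y + y * x" "\<And>t. p * t = t * p" and q: "q = x * z + z * x" "\<And>t. q * t = t * q"
  shows "x * (y * z - z * y) - (y * z - z * y) * x = 2 * (p * z - q * y)"
proof -
  have *: "x * u * v - u * v * x = r * v - s * u"
    if "r = x * u + u * x" "s = x * v + v * x" "\<And>t. s * t = t * s" for u v r s
  proof -
    have "s * u = u * (x * v + v * x)" using that by metis
    then show ?thesis using that(1) by (simp add: algebra_simps)
  qed
  have "x * (y * z - z * y) - (y * z - z * y) * x =
      (x * y * z - y * z * x) - (x * z * y - z * y * x)"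
    by (simp add: algebra_simps)
  also have "\<dots> = (p * z - q * y) - (q * y - p * z)"
    using *[OF p(1) q(1) q(2)] *[OF q(1) p(1) p(2)] by simp
  finally show ?thesis by (simp add: mult_2)
qed

text \<open>Here \<open>h\<close> is one half and \<open>L\<close> will be the set of skew elements.
  Since \<open>L\<close> contains commutators, the anticommutator of a vector with a bracket is
  central as well; this central volume element is what separates dimension three from higher
  Clifford algebras.\<close>

locale vector_ring =
  fixes h :: "'a::ring_1" and L :: "'a set"
  assumes h_commute: "x * h = h * x"
    and h_half: "h + h = 1"
    and L_h: "x \<in> L \<Longrightarrow> h * x \<in> L"
    and L_commutator: "x \<in> L \<Longrightarrow> y \<in> L \<Longrightarrow> x * y - y * x \<in> L"
    and L_anticommutator: "x \<in> L \<Longrightarrow> y \<in> L \<Longrightarrow> (x * y + y * x) * z = z * (x * y + y * x)"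
begin

definition dot :: "'a \<Rightarrow> 'a \<Rightarrow> 'a" where "dot x y = - (h * (x * y + y * x))"
definition brk :: "'a \<Rightarrow> 'a \<Rightarrow> 'a" where "brk x y = h * (x * y - y * x)"

lemma h_left_commute: "x * (h * y) = h * (x * y)"
  by (metis h_commute mult.assoc)

lemma h_add: "h * x + h * x = x"
  by (metis h_half distrib_right mult_1)

lemma brk_closed: "x \<in> L \<Longrightarrow> y \<in> L \<Longrightarrow> brk x y \<in> L"
  by (simp add: brk_def L_h L_commutator)

lemma dot_commute: "dot x y = dot y x"
  by (simp add: dot_def add.commute)

lemma brk_commute: "brk x y = - brk y x"
  by (simp add: brk_def algebra_simps)

lemma dot_central: "x \<in> L \<Longrightarrow> y \<in> L \<Longrightarrow> dot x y * z = z * dot x y"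
  by (simp add: dot_def L_anticommutator mult.assoc h_left_commute)

lemma mult_eq_brk_dot: "x * y = brk x y - dot x y"
proof -
  have "brk x y - dot x y = h * (x * y) + h * (x * y)" by (simp add: brk_def dot_def algebra_simps)
  then show ?thesis by (simp add: h_add)
qed

lemma dot_add: "dot (x + y) z = dot x z + dot y z"
  by (simp add: dot_def algebra_simps)

lemma dot_diff: "dot (x - y) z = dot x z - dot y z"
  by (simp add: dot_def algebra_simps)

lemma dot_scale:
  assumes "\<And>t. c * t = t * c"
  shows "dot (c * x) y = c * dot x y"
proof -
  have "y * (c * x) = c * (y * x)" by (metis assms mult.assoc)
  then show ?thesis by (simp add: dot_def mult.assoc h_left_commute flip: distrib_left)
qed

lemma brk_scale:
  assumes "\<And>t. c * t = t * c"
  shows "brk x (c * y) = c * brk x y"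
proof -
  have "x * (c * y) = c * (x * y)" by (metis assms mult.assoc)
  then show ?thesis by (simp add: brk_def mult.assoc h_left_commute flip: right_diff_distrib)
qed

lemma brk_minus: "brk x (- y) = - brk x y"
  by (simp add: brk_def algebra_simps)

lemma dot_scale_dot: "a \<in> L \<Longrightarrow> b \<in> L \<Longrightarrow> dot (dot a b * x) y = dot a b * dot x y"
  by (intro dot_scale dot_central)

lemma brk_scale_dot: "a \<in> L \<Longrightarrow> b \<in> L \<Longrightarrow> brk x (dot a b * y) = dot a b * brk x y"
  by (intro brk_scale dot_central)

lemma brk_diff: "brk x (y - z) = brk x y - brk x z"
  by (simp add: brk_def algebra_simps)

lemma brk_brk:
  assumes "x \<in> L" "y \<in> L" "z \<in> L"
  shows "brk x (brk y z) = dot x z * y - dot x y * z"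
proof -
  have "brk x (brk y z) = h * (h * (x * (y * z - z * y) - (y * z - z * y) * x))"
    by (simp add: brk_def right_diff_distrib h_left_commute[of x] h_left_commute[of y]
        h_left_commute[of z] mult.assoc left_diff_distrib)
  also have "\<dots> = h * (h * (2 * ((x * y + y * x) * z - (x * z + z * x) * y)))"
    using double_commutator[OF refl L_anticommutator refl L_anticommutator, of x y z] assms by simp
  \<comment> \<open>The factor 2 absorbs one of the two halves of the nested brackets; the other
    half goes into the dot products.\<close>
  also have "\<dots> = h * ((x * y + y * x) * z - (x * z + z * x) * y)"
    using h_add[of "(x * y + y * x) * z - (x * z + z * x) * y"] by (simp only: mult_2 distrib_left)
  finally show ?thesis by (simp add: dot_def algebra_simps)
qed

definition triple :: "'a \<Rightarrow> 'a \<Rightarrow> 'a \<Rightarrow> 'a" where "triple x y z = dot (brk x y) z"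

lemma triple_eq: "triple x y z = - (h * (h * ((x * y - y * x) * z + z * (x * y - y * x))))"
  by (simp add: triple_def dot_def brk_def mult.assoc h_left_commute[of z] flip: distrib_left)

text \<open>The two sides differ, up to a factor, by the commutator of x with yz + zy, which is
  central.\<close>

lemma triple_rotate:
  assumes "x \<in> L" "y \<in> L" "z \<in> L"
  shows "triple x y z = triple z x y"
proof -
  have "(x * y - y * x) * z + z * (x * y - y * x) = (z * x - x * z) * y + y * (z * x - x * z)"
    using L_anticommutator[OF assms(2,3), of x] by (simp add: algebra_simps)
  then show ?thesis by (simp add: triple_eq)
qed

lemma triple_swap: "triple x y z = - triple y x z"
  by (simp add: triple_eq algebra_simps)

lemma triple_reverse:
  assumes "x \<in> L" "y \<in> L" "z \<in> L"
  shows "triple x y z = - triple z y x"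
  using assms triple_rotate triple_swap by metis

text \<open>This is (R3). Expanding [[i, j], [k, l]] by the double bracket formula, with either
  bracket in the outer role, gives a linear dependence between the four vectors; its dot product
  with s is the claim.\<close>

lemma triple_exchange:
  assumes L: "i \<in> L" "j \<in> L" "k \<in> L" "l \<in> L" "s \<in> L"
  shows "triple j k l * dot i s - triple i k l * dot j s + triple i j l * dot k s - triple i j k * dot l s = 0"
proof -
  have C: "triple x y z * t = t * triple x y z" if "x \<in> L" "y \<in> L" "z \<in> L" for x y z t
    using that by (simp add: triple_def dot_central brk_closed)
  have "triple i j l * k - triple i j k * l = brk (brk i j) (brk k l)"
    using L by (simp add: brk_brk brk_closed triple_def)
  also have "\<dots> = - (triple k l j * i - triple k l i * j)"
    by (subst brk_commute) (use L in \<open>simp add: brk_brk brk_closed triple_def\<close>)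
  finally have "triple i j l * k - triple i j k * l = triple k l i * j - triple k l j * i" by simp
  then have "dot (triple i j l * k - triple i j k * l) s = dot (triple k l i * j - triple k l j * i) s"
    by simp
  moreover have "dot (triple x y z * t) s = triple x y z * dot t s"
    if "x \<in> L" "y \<in> L" "z \<in> L" for x y z t
    using that by (intro dot_scale C)
  ultimately have "triple i j l * dot k s - triple i j k * dot l s =
      triple k l i * dot j s - triple k l j * dot i s"
    using L by (simp add: dot_diff)
  moreover have "triple k l i = triple i k l" "triple k l j = triple j k l"
    using L triple_rotate[of k l] triple_rotate[of l] by metis+
  ultimately show ?thesis by (simp add: algebra_simps)
qed

text \<open>Expanding \<open>[k, [[i, j], l]]\<close> by the double bracket formula in two ways.\<close>
lemma triple_scale_vector:
  assumes L: "i \<in> L" "j \<in> L" "k \<in> L" "l \<in> L"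
  shows "triple i j k * l = dot k l * brk i j + dot j l * brk k i + dot i l * brk j k"
proof -
  have "brk (brk i j) l = - (dot l j * i - dot l i * j)"
    by (subst brk_commute) (use L in \<open>simp add: brk_brk\<close>)
  then have "brk k (brk (brk i j) l) = dot l i * brk k j - dot l j * brk k i"
    using L by (simp add: brk_minus brk_diff brk_scale_dot)
  moreover have "brk k (brk (brk i j) l) = dot k l * brk i j - dot k (brk i j) * l"
    using L by (simp add: brk_brk brk_closed)
  ultimately have "dot k (brk i j) * l = dot k l * brk i j + dot l j * brk k i - dot l i * brk k j"
    by (simp add: algebra_simps)
  moreover have "dot k (brk i j) = triple i j k" "dot l i = dot i l" "dot l j = dot j l"
    by (simp_all add: triple_def dot_commute)
  ultimately show ?thesis by (simp add: brk_commute[of k j])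
qed

text \<open>Lagrange's identity. Rotating the triple product of s, t and [i, j] turns the dot
  product of two brackets into that of a double bracket with t.\<close>

lemma dot_brk_brk:
  assumes L: "i \<in> L" "j \<in> L" "s \<in> L" "t \<in> L"
  shows "dot (brk i j) (brk s t) = dot i s * dot j t - dot j s * dot i t"
proof -
  have "dot (brk i j) (brk s t) = triple s t (brk i j)"
    by (simp add: triple_def dot_commute)
  also have "\<dots> = triple (brk i j) s t"
    using L by (simp add: triple_rotate brk_closed)
  also have "\<dots> = dot (- brk s (brk i j)) t"
    by (subst brk_commute) (simp add: triple_def)
  also have "\<dots> = dot (dot s i * j - dot s j * i) t"
    using L by (simp add: brk_brk)
  also have "\<dots> = dot s i * dot j t - dot s j * dot i t"
    using L by (simp add: dot_diff dot_scale_dot)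
  finally show ?thesis by (simp add: dot_commute[of s])
qed

text \<open>This is (R4), expanded along the column of l: scaling the vector l by the first triple
  product and dotting with [s, t] leaves dot products of brackets, which Lagrange's identity
  evaluates.\<close>

lemma triple_mult_triple:
  assumes L: "i \<in> L" "j \<in> L" "k \<in> L" "l \<in> L" "s \<in> L" "t \<in> L"
  shows "triple i j k * triple l s t =
    dot k l * (dot i s * dot j t - dot j s * dot i t) +
    dot j l * (dot k s * dot i t - dot i s * dot k t) +
    dot i l * (dot j s * dot k t - dot k s * dot j t)"
proof -
  have "triple l s t = dot l (brk s t)"
    using L triple_rotate[of s t l] by (simp add: triple_def dot_commute)
  then have "triple i j k * triple l s t = dot (triple i j k * l) (brk s t)"
    using L by (simp add: dot_scale_dot triple_def brk_closed)
  also have "\<dots> = dot k l * dot (brk i j) (brk s t) + dot j l * dot (brk k i) (brk s t)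
      + dot i l * dot (brk j k) (brk s t)"
    using L by (simp add: triple_scale_vector dot_add dot_scale_dot)
  finally show ?thesis using L by (simp add: dot_brk_brk)
qed

end

section \<open>The rings \<open>A\<close> for all index sets\<close>

lemmas ring_AR = group.ring_A_ring[OF group_free_group]
lemmas A_cls_Nil = group.A_cls_one[OF group_free_group, simplified]

text \<open>An element has one component for every \<open>I\<close>, so that the type does not depend on \<open>I\<close>.\<close>
typedef (overloaded) ('i, 'k) afam =
  "{F :: 'i set \<Rightarrow> (('i \<times> bool) list \<Rightarrow> 'k::field_char_0) set.
     \<forall>I. F I \<in> carrier (A_ring (free_group I))}"
  morphisms acomp Abs_afam
  by (rule exI[of _ "\<lambda>I. \<zero>\<^bsub>A_ring (free_group I)\<^esub>"]) (simp add: ring.ring_simprules(2)[OF ring_AR])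

setup_lifting type_definition_afam

instantiation afam :: (type, field_char_0) ring_1
begin

lift_definition zero_afam :: "('a, 'b) afam" is "\<lambda>I. \<zero>\<^bsub>A_ring (free_group I)\<^esub>"
  by (simp add: ring.ring_simprules(2)[OF ring_AR])
lift_definition one_afam :: "('a, 'b) afam" is "\<lambda>I. \<one>\<^bsub>A_ring (free_group I)\<^esub>"
  by (simp add: ring.ring_simprules(6)[OF ring_AR])
lift_definition plus_afam :: "('a, 'b) afam \<Rightarrow> ('a, 'b) afam \<Rightarrow> ('a, 'b) afam"
  is "\<lambda>F F' I. F I \<oplus>\<^bsub>A_ring (free_group I)\<^esub> F' I"
  by (simp add: ring.ring_simprules(1)[OF ring_AR])
lift_definition times_afam :: "('a, 'b) afam \<Rightarrow> ('a, 'b) afam \<Rightarrow> ('a, 'b) afam"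
  is "\<lambda>F F' I. F I \<otimes>\<^bsub>A_ring (free_group I)\<^esub> F' I"
  by (simp add: ring.ring_simprules(5)[OF ring_AR])
lift_definition uminus_afam :: "('a, 'b) afam \<Rightarrow> ('a, 'b) afam"
  is "\<lambda>F I. \<ominus>\<^bsub>A_ring (free_group I)\<^esub> F I"
  by (simp add: ring.ring_simprules(3)[OF ring_AR])
definition minus_afam :: "('a, 'b) afam \<Rightarrow> ('a, 'b) afam \<Rightarrow> ('a, 'b) afam" where
  "minus_afam F F' = F + - F'"

instance
proof
  fix a b c :: "('a, 'b) afam"
  note R = ring.ring_simprules[OF ring_AR]
  show "a + b + c = a + (b + c)" by transfer (simp add: R(7))
  show "a + b = b + a" by transfer (simp add: R(10))
  show "0 + a = a" by transfer (simp add: R(8))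
  show "- a + a = 0" by transfer (simp add: R(9))
  show "a * b * c = a * (b * c)" by transfer (simp add: R(11))
  show "1 * a = a" by transfer (simp add: R(12))
  show "a * 1 = a" by transfer (simp add: monoid.r_one[OF ring.is_monoid[OF ring_AR]])
  show "(a + b) * c = a * c + b * c" by transfer (simp add: R(13))
  show "a * (b + c) = a * b + a * c" by transfer (simp add: R)
  show "a - b = a + - b" by (simp add: minus_afam_def)
  show "(0 :: ('a, 'b) afam) \<noteq> 1"
    by transfer (metis group.A_ring_nontrivial[OF group_free_group])
qed

end


lemma afam_eqI: "(\<And>I. acomp x I = acomp y I) \<Longrightarrow> x = y"
  by (metis acomp_inject ext)

lemma acomp_closed [simp]: "acomp x I \<in> carrier (A_ring (free_group I))"
  using acomp[of x] by simp

lemmas acomp_simps = zero_afam.rep_eq one_afam.rep_eq plus_afam.rep_eq times_afam.rep_eq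

section \<open>Involution, scalars and letters in the families over all index sets\<close>

lift_definition astar :: "('i, 'k::field_char_0) afam \<Rightarrow> ('i, 'k) afam"
  is "\<lambda>F I. A_star (free_group I) (F I)"
  by (simp add: group.A_star_closed[OF group_free_group])

lift_definition ascal :: "'k::field_char_0 \<Rightarrow> ('i, 'k) afam"
  is "\<lambda>c I. A_cls (free_group I) (gr_scale c (gr_basis []))"
  by (simp add: group.A_cls_closed[OF group_free_group] gr_scale_closed gr_basis_closed carrier_free_group)

text \<open>In a component whose index set misses the letter the value is 1, which equals its
  inverse and its image under the involution; so \<open>agen_inv\<close> and
  \<open>astar_agen\<close> hold in every component.\<close>

lift_definition agen :: "'i \<times> bool \<Rightarrow> ('i, 'k::field_char_0) afam"
  is "\<lambda>x I. if fst x \<in> I then A_cls (free_group I) (gr_basis [x]) else \<one>\<^bsub>A_ring (free_group I)\<^esub>"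
  by (simp add: group.A_cls_closed[OF group_free_group] gr_basis_closed carrier_free_group
      ring.ring_simprules(6)[OF ring_AR])

lemma astar_add: "astar (x + y) = astar x + astar y"
  by transfer (simp add: group.A_star_add[OF group_free_group])

lemma astar_mult: "astar (x * y) = astar y * astar x"
  by transfer (simp add: group.A_star_mult[OF group_free_group])

lemma astar_astar [simp]: "astar (astar x) = x"
  by transfer (simp add: group.A_star_star[OF group_free_group])

lemma astar_commute: "astar x = x \<Longrightarrow> y * x = x * y"
  by transfer (auto simp: fun_eq_iff sharp_def intro!: group.sharp_commute[OF group_free_group])

lemma astar_zero [simp]: "astar 0 = 0"
  using astar_add[of 0 0] by simp

lemma astar_minus: "astar (- x) = - astar x"
  using astar_add[of x "- x"] by (simp add: eq_neg_iff_add_eq_0 add.commute)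

lemma astar_diff: "astar (x - y) = astar x - astar y"
  using astar_add[of x "- y"] by (simp add: astar_minus)

lemma Nil_free_group: "[] \<in> carrier (free_group I)"
  by (simp add: carrier_free_group)

lemma astar_ascal [simp]: "astar (ascal c) = ascal c"
  by transfer
     (simp add: group.A_star_A_cls[OF group_free_group] gr_scale_closed gr_basis_closed
       Nil_free_group group.gr_star_scale[OF group_free_group] group.gr_star_basis[OF group_free_group]
       inv_free_group)

interpretation ascal: central_scalars "ascal :: 'k::field_char_0 \<Rightarrow> ('i, 'k) afam"
proof
  note cl = gr_scale_closed gr_basis_closed Nil_free_group
  fix a b :: 'k and x :: "('i, 'k) afam"
  have "gr_scale (a + b) (gr_basis []) =
      gr_add (gr_scale a (gr_basis [])) (gr_scale b (gr_basis ([] :: ('i \<times> bool) list)))"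
    by (auto simp: gr_scale_def gr_add_def distrib_right)
  then show "ascal (a + b) = ascal a + (ascal b :: ('i, 'k) afam)"
    by transfer (simp add: group.A_cls_add[OF group_free_group] cl)
  have "gr_scale (a * b) (gr_basis []) =
      gr_scale a (gr_basis []) \<otimes>\<^bsub>group_ring (free_group I)\<^esub> gr_scale b (gr_basis [])" for I :: "'i set"
    using group.gr_scale_eq_mult[OF group_free_group, of "gr_scale b (gr_basis [])" I a]
    by (simp add: cl) (simp add: gr_scale_def mult.assoc)
  then have "A_cls (free_group I) (gr_scale (a * b) (gr_basis [])) =
      A_cls (free_group I) (gr_scale a (gr_basis [])) \<otimes>\<^bsub>A_ring (free_group I)\<^esub>
      A_cls (free_group I) (gr_scale b (gr_basis []))" for I :: "'i set"
    by (subst group.A_cls_mult[OF group_free_group, symmetric]) (simp_all add: cl)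
  then show "ascal (a * b) = ascal a * (ascal b :: ('i, 'k) afam)"
    by transfer (rule ext)
  have "gr_scale 1 (gr_basis []) = (gr_basis [] :: ('i \<times> bool) list \<Rightarrow> 'k)"
    by (simp add: gr_scale_def)
  then show "ascal 1 = (1 :: ('i, 'k) afam)"
    by (intro afam_eqI)
       (simp add: ascal.rep_eq one_afam.rep_eq A_cls_Nil)
  show "ascal a * x = x * ascal a"
    by (rule astar_commute[symmetric]) simp
qed

lemma agen_inv: "agen x * agen (inv_letter x) = 1"
proof (rule afam_eqI)
  fix I
  have "reduce [x, inv_letter x] = []"
    by (simp add: reduce_def)
  then show "acomp (agen x * agen (inv_letter x)) I = acomp 1 I"
    by (simp add: acomp_simps A_cls_Nil agen.rep_eq gr_basis_closed carrier_free_group gr_basis_mult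
        ring.ring_simprules[OF ring_AR] flip: group.A_cls_mult[OF group_free_group])
qed

lemma astar_one [simp]: "astar 1 = 1"
  using astar_ascal[of 1] by simp

lemma A_star_one:
  fixes I :: "'i set"
  shows "A_star (free_group I) \<one>\<^bsub>A_ring (free_group I)\<^esub> = (\<one>\<^bsub>A_ring (free_group I)\<^esub> :: (_ \<Rightarrow> 'k::field_char_0) set)"
  using arg_cong[OF astar_one, of "\<lambda>x :: ('i, 'k) afam. acomp x I"] by (simp add: astar.rep_eq acomp_simps del: astar_one)

lemma astar_agen: "astar (agen x) = agen (inv_letter x)"
  by transfer
     (auto simp: fun_eq_iff A_star_one group.A_star_A_cls[OF group_free_group] gr_basis_closed
        carrier_free_group group.gr_star_basis[OF group_free_group] inv_free_group)

lemma acomp_word_prod: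
  "w \<in> carrier (free_group I) \<Longrightarrow>
    acomp (word_prod agen w :: ('i, 'k::field_char_0) afam) I = A_cls (free_group I) (gr_basis w)"
proof (induction w)
  case Nil
  then show ?case by (simp add: acomp_simps A_cls_Nil)
next
  case (Cons x w)
  then have w: "w \<in> carrier (free_group I)" "[x] \<in> carrier (free_group I)" "reduce (x # w) = x # w"
    by (auto simp: carrier_free_group reduced_Cons reduce_id simp del: reduced_def)
  then have "acomp (word_prod agen (x # w) :: ('i, 'k) afam) I =
      A_cls (free_group I) (gr_basis [x]) \<otimes>\<^bsub>A_ring (free_group I)\<^esub> A_cls (free_group I) (gr_basis w)"
    using Cons by (simp add: acomp_simps agen.rep_eq carrier_free_group)
  also have "\<dots> = A_cls (free_group I) (gr_basis [x] \<otimes>\<^bsub>group_ring (free_group I)\<^esub> gr_basis w)"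
    using w by (simp add: group.A_cls_mult[OF group_free_group] gr_basis_closed)
  finally show ?case using w by (simp add: gr_basis_mult)
qed

text \<open>The component at \<open>I\<close> of the linear extension is the quotient map, so
  elements of \<open>A_ring (free_group I)\<close> can be handled through elements of the type class
  ring.\<close>

lemma acomp_lift:
  assumes "f \<in> carrier (group_ring (free_group I))"
  shows "acomp (ascal.lift (word_prod agen) f) I = A_cls (free_group I) f"
  using assms
proof (induction f rule: group_ring_induct)
  case zero
  have "A_cls (free_group I) (\<lambda>x. 0 :: 'b) = \<zero>\<^bsub>A_ring (free_group I)\<^esub>"
    using additive_subgroup.zero_closed[OF ideal.axioms(1)[OF group.ideal_star_ideal[OF group_free_group]]]
    by (simp add: group.A_cls_eq_zero_iff[OF group_free_group] group.gr_zero_closed[OF group_free_group])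
  then show ?case by (simp add: ascal.lift_def supp_def acomp_simps)
next
  case (add f w a)
  note f = \<open>f \<in> carrier (group_ring (free_group I))\<close>
    and w = \<open>w \<in> carrier (free_group I)\<close>
  note cl = gr_scale_closed gr_basis_closed Nil_free_group
  have "A_cls (free_group I) (gr_scale a (gr_basis w)) =
      A_cls (free_group I) (gr_scale a (gr_basis [])) \<otimes>\<^bsub>A_ring (free_group I)\<^esub>
      A_cls (free_group I) (gr_basis w)"
    using group.gr_scale_eq_mult[OF group_free_group gr_basis_closed[OF w], of a]
    by (subst group.A_cls_mult[OF group_free_group, symmetric]) (simp_all add: cl w)
  moreover have "finite (supp f)" using f by (simp add: carrier_group_ring)
  ultimately show ?case
    using add.IH f w
    by (simp add: group.A_cls_add[OF group_free_group] cl)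
       (simp add: gr_add_def ascal.lift_add ascal.lift_scale finite_supp_gr_scale acomp_simps acomp_word_prod ascal.rep_eq)
qed

lemma ascal_half: "ascal (1/2) + ascal (1/2) = (1 :: ('i, 'k::field_char_0) afam)"
  using ascal.add[of "1/2" "1/2"] by simp

text \<open>The anticommutator of two skew elements is symmetric and therefore central; their
  commutator is skew.\<close>

interpretation A: vector_ring "ascal (1/2)" "{x :: ('i, 'k::field_char_0) afam. astar x = - x}"
proof
  fix x y z :: "('i, 'k) afam"
  assume "x \<in> {x. astar x = - x}" "y \<in> {x. astar x = - x}"
  then have xy: "astar x = - x" "astar y = - y" by auto
  then show "x * y - y * x \<in> {x. astar x = - x}"
    by (simp add: astar_diff astar_mult)
  have "astar (x * y + y * x) = x * y + y * x" using xy by (simp add: astar_add astar_mult add.commute)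
  then show "(x * y + y * x) * z = z * (x * y + y * x)" by (rule astar_commute[symmetric])
next
  fix x :: "('i, 'k) afam"
  show "x * ascal (1/2) = ascal (1/2) * x" by (rule ascal.commute[symmetric])
  show "ascal (1/2) * x \<in> {x. astar x = - x}" if "x \<in> {x. astar x = - x}"
    using that by (simp add: astar_mult ascal.commute)
qed (rule ascal_half)

section \<open>Polynomials and the ring \<open>R\<close>\<close>

locale comm_scalars = central_scalars c for c :: "'k::field \<Rightarrow> 'b::comm_ring_1"
begin

definition monom :: "('v \<Rightarrow> 'b) \<Rightarrow> ('v \<Rightarrow>\<^sub>0 nat) \<Rightarrow> 'b" where
  "monom X m = (\<Prod>v\<in>Poly_Mapping.keys m. X v ^ Poly_Mapping.lookup m v)"

definition eval :: "('v \<Rightarrow> 'b) \<Rightarrow> (('v \<Rightarrow>\<^sub>0 nat) \<Rightarrow>\<^sub>0 'k) \<Rightarrow> 'b" where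
  "eval X p = (\<Sum>m\<in>Poly_Mapping.keys p. c (Poly_Mapping.lookup p m) * monom X m)"

lemma monom_superset:
  assumes "finite V" "Poly_Mapping.keys m \<subseteq> V"
  shows "monom X m = (\<Prod>v\<in>V. X v ^ Poly_Mapping.lookup m v)"
  unfolding monom_def
  by (rule prod.mono_neutral_left) (use assms in \<open>auto simp: in_keys_iff\<close>)

lemma monom_add: "monom X (m + n) = monom X m * monom X n"
proof -
  let ?V = "Poly_Mapping.keys m \<union> Poly_Mapping.keys n"
  have "Poly_Mapping.keys (m + n) \<subseteq> ?V" by (rule keys_add)
  then show ?thesis
    by (simp add: monom_superset[of ?V] lookup_add power_add prod.distrib)
qed

lemma eval_superset:
  assumes "finite M" "Poly_Mapping.keys p \<subseteq> M"
  shows "eval X p = (\<Sum>m\<in>M. c (Poly_Mapping.lookup p m) * monom X m)"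
  unfolding eval_def
  by (rule sum.mono_neutral_left) (use assms in \<open>auto simp: in_keys_iff\<close>)

lemma eval_add: "eval X (p + q) = eval X p + eval X q"
proof -
  let ?M = "Poly_Mapping.keys p \<union> Poly_Mapping.keys q"
  have "Poly_Mapping.keys (p + q) \<subseteq> ?M" by (rule keys_add)
  then show ?thesis
    by (simp add: eval_superset[of ?M] lookup_add add distrib_right sum.distrib)
qed

lemma eval_single: "eval X (Poly_Mapping.single m a) = c a * monom X m"
  by (simp add: eval_superset[of "{m}"])

lemma eval_zero [simp]: "eval X 0 = 0"
  by (simp add: eval_def)

lemma eval_sum: "eval X (sum f A) = (\<Sum>x\<in>A. eval X (f x))"
  by (induction A rule: infinite_finite_induct) (simp_all add: eval_add)

lemma eval_minus: "eval X (- p) = - eval X p"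
  using eval_add[of X p "- p"] by (simp add: eq_neg_iff_add_eq_0 add.commute)

lemma eval_diff: "eval X (p - q) = eval X p - eval X q"
  using eval_add[of X p "- q"] by (simp add: eval_minus)

end

lemma poly_mapping_eq_sum_single:
  "p = (\<Sum>m\<in>Poly_Mapping.keys p. Poly_Mapping.single m (Poly_Mapping.lookup p m))"
  by (rule poly_mapping_eqI) (auto simp: lookup_sum lookup_single when_def in_keys_iff)

context comm_scalars
begin

lemma eval_mult: "eval X (p * q) = eval X p * eval X q"
proof -
  have "p * q = (\<Sum>m\<in>Poly_Mapping.keys p. \<Sum>n\<in>Poly_Mapping.keys q.
      Poly_Mapping.single (m + n) (Poly_Mapping.lookup p m * Poly_Mapping.lookup q n))"
    by (subst (1) poly_mapping_eq_sum_single[of p], subst (1) poly_mapping_eq_sum_single[of q])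
       (simp add: sum_product mult_single)
  then have "eval X (p * q) = (\<Sum>m\<in>Poly_Mapping.keys p. \<Sum>n\<in>Poly_Mapping.keys q.
      (c (Poly_Mapping.lookup p m) * monom X m) * (c (Poly_Mapping.lookup q n) * monom X n))"
    by (simp add: eval_sum eval_single monom_add mult ac_simps)
  then show ?thesis by (simp add: eval_def sum_product)
qed

lemma eval_PC [simp]: "eval X (PC a) = c a"
  by (simp add: PC_def eval_single monom_def)

lemma eval_PV [simp]: "eval X (PV v) = X v"
  by (simp add: PV_def eval_single monom_def)

lemma eval_one [simp]: "eval X 1 = 1"
  using eval_single[of X 0 1] by (simp add: monom_def)

lemma eval_power: "eval X (p ^ n) = eval X p ^ n"
  by (induction n) (simp_all add: eval_mult)

lemma eval_det3:
  "eval X (det3 p\<^sub>1 p\<^sub>2 p\<^sub>3 p\<^sub>4 p\<^sub>5 p\<^sub>6 p\<^sub>7 p\<^sub>8 p\<^sub>9) =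
   det3 (eval X p\<^sub>1) (eval X p\<^sub>2) (eval X p\<^sub>3) (eval X p\<^sub>4) (eval X p\<^sub>5) (eval X p\<^sub>6)
     (eval X p\<^sub>7) (eval X p\<^sub>8) (eval X p\<^sub>9)"
  by (simp add: det3_def eval_add eval_diff eval_mult)

end

section \<open>Polynomials with indices in \<open>I\<close>\<close>

lemma poly_ring_simps [simp]:
  "mult (poly_ring I) = (*)" "add (poly_ring I) = (+)" "one (poly_ring I) = 1" "zero (poly_ring I) = 0"
  by (simp_all add: poly_ring_def)

lemma carrier_poly_ring:
  "p \<in> carrier (poly_ring I) \<longleftrightarrow>
    (\<forall>m\<in>Poly_Mapping.keys p. \<forall>v\<in>Poly_Mapping.keys m. pvar_idx v \<subseteq> I)"
  by (simp add: poly_ring_def)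

lemma PC_closed: "PC c \<in> carrier (poly_ring I)"
  by (auto simp: carrier_poly_ring PC_def)

lemma PV_closed: "pvar_idx v \<subseteq> I \<Longrightarrow> PV v \<in> carrier (poly_ring I)"
  by (auto simp: carrier_poly_ring PV_def split: if_splits)

lemma poly_add_closed:
  "p \<in> carrier (poly_ring I) \<Longrightarrow> q \<in> carrier (poly_ring I) \<Longrightarrow> p + q \<in> carrier (poly_ring I)"
  using keys_add[of p q] by (fastforce simp: carrier_poly_ring)

lemma poly_mult_closed:
  assumes "p \<in> carrier (poly_ring I)" "q \<in> carrier (poly_ring I)"
  shows "p * q \<in> carrier (poly_ring I)"
  unfolding carrier_poly_ring
proof (intro ballI)
  fix m v assume "m \<in> Poly_Mapping.keys (p * q)" "v \<in> Poly_Mapping.keys m"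
  then obtain a b where "a \<in> Poly_Mapping.keys p" "b \<in> Poly_Mapping.keys q" "v \<in> Poly_Mapping.keys (a + b)"
    using keys_mult[of p q] by auto
  then show "pvar_idx v \<subseteq> I"
    using keys_add[of a b] assms unfolding carrier_poly_ring by blast
qed

lemma one_poly_closed: "1 \<in> carrier (poly_ring I)"
  using PC_closed[of 1] by (simp add: PC_def)

lemma zero_poly_closed: "0 \<in> carrier (poly_ring I)"
  by (simp add: carrier_poly_ring)

lemma poly_minus_closed: "p \<in> carrier (poly_ring I) \<Longrightarrow> - p \<in> carrier (poly_ring I)"
  by (simp add: carrier_poly_ring in_keys_iff)

lemma poly_diff_closed:
  "p \<in> carrier (poly_ring I) \<Longrightarrow> q \<in> carrier (poly_ring I) \<Longrightarrow> p - q \<in> carrier (poly_ring I)"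
  using poly_add_closed[OF _ poly_minus_closed, of p I q] by simp

lemma poly_power_closed: "p \<in> carrier (poly_ring I) \<Longrightarrow> p ^ n \<in> carrier (poly_ring I)"
  by (induction n) (simp_all add: poly_mult_closed one_poly_closed)

lemma poly_det3_closed:
  assumes "p\<^sub>1 \<in> carrier (poly_ring I)" "p\<^sub>2 \<in> carrier (poly_ring I)" "p\<^sub>3 \<in> carrier (poly_ring I)"
    "p\<^sub>4 \<in> carrier (poly_ring I)" "p\<^sub>5 \<in> carrier (poly_ring I)" "p\<^sub>6 \<in> carrier (poly_ring I)"
    "p\<^sub>7 \<in> carrier (poly_ring I)" "p\<^sub>8 \<in> carrier (poly_ring I)" "p\<^sub>9 \<in> carrier (poly_ring I)"
  shows "det3 p\<^sub>1 p\<^sub>2 p\<^sub>3 p\<^sub>4 p\<^sub>5 p\<^sub>6 p\<^sub>7 p\<^sub>8 p\<^sub>9 \<in> carrier (poly_ring I)"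
  using assms by (simp add: det3_def poly_add_closed poly_diff_closed poly_mult_closed)

lemma cring_poly_ring: "cring (poly_ring I :: ('i, 'k::comm_ring_1) mpoly ring)"
proof (rule cringI)
  show "abelian_group (poly_ring I :: ('i, 'k) mpoly ring)"
  proof (rule abelian_groupI)
    fix p :: "('i, 'k) mpoly" assume "p \<in> carrier (poly_ring I)"
    then show "\<exists>q\<in>carrier (poly_ring I). q \<oplus>\<^bsub>poly_ring I\<^esub> p = \<zero>\<^bsub>poly_ring I\<^esub>"
      using poly_minus_closed by (intro bexI[of _ "- p"]) auto
  qed (simp_all add: poly_add_closed zero_poly_closed ac_simps)
  show "comm_monoid (poly_ring I :: ('i, 'k) mpoly ring)"
    by (rule comm_monoidI) (simp_all add: poly_mult_closed one_poly_closed ac_simps)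
qed (simp add: distrib_right)

lemma poly_ring_induct [consumes 1, case_names PC PV add mult]:
  fixes P :: "('i, 'k::comm_ring_1) mpoly \<Rightarrow> bool"
  assumes "p \<in> carrier (poly_ring I)"
    and PC: "\<And>a. P (PC a)" and PV: "\<And>v. pvar_idx v \<subseteq> I \<Longrightarrow> P (PV v)"
    and add: "\<And>p q. p \<in> carrier (poly_ring I) \<Longrightarrow> q \<in> carrier (poly_ring I) \<Longrightarrow>
      P p \<Longrightarrow> P q \<Longrightarrow> P (p + q)"
    and mult: "\<And>p q. p \<in> carrier (poly_ring I) \<Longrightarrow> q \<in> carrier (poly_ring I) \<Longrightarrow>
      P p \<Longrightarrow> P q \<Longrightarrow> P (p * q)"
  shows "P p"
proof -
  let ?Q = "\<lambda>p. p \<in> carrier (poly_ring I) \<and> P p"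
  have Q1: "?Q 1" using PC[of 1] by (simp add: PC_def one_poly_closed)
  have Q0: "?Q 0" using PC[of 0] by (simp add: PC_def zero_poly_closed)
  have Qmult: "?Q (p * q)" if "?Q p" "?Q q" for p q using that mult poly_mult_closed by blast
  have Qpower: "?Q (p ^ n)" if "?Q p" for p n
    by (induction n) (use Q1 Qmult that in auto)
  have single_power: "Poly_Mapping.single (Poly_Mapping.single v n) 1 = (PV v :: ('i, 'k) mpoly) ^ n" for v n
  proof (induction n)
    case (Suc n)
    have "(PV v :: ('i, 'k) mpoly) ^ Suc n = PV v * Poly_Mapping.single (Poly_Mapping.single v n) 1"
      using Suc by simp
    then show ?case by (simp add: PV_def mult_single flip: single_add)
  qed simp
  have monom: "?Q (Poly_Mapping.single m 1)" if "\<forall>v\<in>Poly_Mapping.keys m. pvar_idx v \<subseteq> I" for m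
  proof -
    have "?Q (Poly_Mapping.single (\<Sum>v\<in>V. Poly_Mapping.single v (f v)) 1)"
      if "finite V" "\<forall>v\<in>V. pvar_idx v \<subseteq> I" for V f
      using that
    proof (induction V rule: finite_induct)
      case (insert v V)
      have "?Q (PV v ^ f v)" using insert PV by (intro Qpower) (auto simp: PV_closed)
      then have "?Q (PV v ^ f v * Poly_Mapping.single (\<Sum>v\<in>V. Poly_Mapping.single v (f v)) 1)"
        using insert by (intro Qmult) auto
      then show ?case using insert by (simp add: mult_single flip: single_power)
    qed (use Q1 in simp)
    from this[of "Poly_Mapping.keys m" "Poly_Mapping.lookup m"] that show ?thesis
      by (simp flip: poly_mapping_eq_sum_single)
  qed
  have term_closed: "?Q (Poly_Mapping.single m a)" if "\<forall>v\<in>Poly_Mapping.keys m. pvar_idx v \<subseteq> I" for m a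
    using Qmult[of "PC a" "Poly_Mapping.single m 1"] monom[OF that] PC[of a]
    by (simp add: PC_closed) (simp add: PC_def mult_single)
  have "?Q (\<Sum>m\<in>M. Poly_Mapping.single m (Poly_Mapping.lookup p m))"
    if "finite M" "M \<subseteq> Poly_Mapping.keys p" for M
    using that
  proof (induction M rule: finite_induct)
    case (insert m M)
    have "?Q (Poly_Mapping.single m (Poly_Mapping.lookup p m))"
      using insert assms(1) by (intro term_closed) (auto simp: carrier_poly_ring)
    then show ?case using insert add by (simp add: poly_add_closed)
  qed (use Q0 in simp)
  from this[of "Poly_Mapping.keys p"] show ?thesis
    by (simp flip: poly_mapping_eq_sum_single)
qed

section \<open>The ideal of relations and its quotient\<close>

lemma R_rels_closed: "R_rels I \<subseteq> carrier (poly_ring I)"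
  unfolding R_rels_def
  by (auto intro!: poly_add_closed poly_diff_closed poly_mult_closed poly_power_closed
      poly_det3_closed one_poly_closed PV_closed)

lemma ideal_R_ideal: "ideal (R_ideal I) (poly_ring I)"
  unfolding R_ideal_def
  by (rule ring.genideal_ideal[OF cring.axioms(1)[OF cring_poly_ring] R_rels_closed])

lemma R_ideal_minimal: "ideal J (poly_ring I) \<Longrightarrow> R_rels I \<subseteq> J \<Longrightarrow> R_ideal I \<subseteq> J"
  unfolding R_ideal_def by (rule ring.genideal_minimal[OF cring.axioms(1)[OF cring_poly_ring]])

lemma cring_R_ring: "cring (R_ring I)"
  unfolding R_ring_def by (rule ideal.quotient_is_cring[OF ideal_R_ideal cring_poly_ring])

lemma R_cls_ring_hom: "R_cls I \<in> ring_hom (poly_ring I) (R_ring I)"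
  using ideal.rcos_ring_hom[OF ideal_R_ideal[of I]] by (simp add: R_cls_def[abs_def] R_ring_def)

lemmas R_cls_closed = ring_hom_closed[OF R_cls_ring_hom]
lemmas R_cls_mult = ring_hom_mult[OF R_cls_ring_hom, unfolded poly_ring_simps]
lemmas R_cls_add = ring_hom_add[OF R_cls_ring_hom, unfolded poly_ring_simps]
lemmas R_cls_one = ring_hom_one[OF R_cls_ring_hom, unfolded poly_ring_simps]

lemma carrier_R_ring: "carrier (R_ring I) = R_cls I ` carrier (poly_ring I)"
  by (auto simp: R_ring_def FactRing_def A_RCOSETS_def' R_cls_def)

lemma R_cls_zero_iff:
  assumes "p \<in> carrier (poly_ring I)"
  shows "R_cls I p = \<zero>\<^bsub>R_ring I\<^esub> \<longleftrightarrow> p \<in> R_ideal I"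
  using ring.a_rcos_zero[OF cring.axioms(1)[OF cring_poly_ring] ideal_R_ideal, of p I]
    ideal.rcos_const_imp_mem[OF ideal_R_ideal assms]
  by (auto simp only: R_cls_def R_ring_def FactRing_def ring.simps)

lemma R_cls_rel: "r \<in> R_rels I \<Longrightarrow> R_cls I r = \<zero>\<^bsub>R_ring I\<^esub>"
  using R_rels_closed[of I] ring.genideal_self[OF cring.axioms(1)[OF cring_poly_ring] R_rels_closed, of I]
  by (subst R_cls_zero_iff) (auto simp: R_ideal_def)

lemma mem_R_clsE:
  assumes "q \<in> R_cls I p"
  obtains r where "r \<in> R_ideal I" "q = r + p"
  using assms by (auto simp: R_cls_def a_r_coset_def r_coset_def)

lemma mem_R_cls_self: "p \<in> R_cls I p"
  using additive_subgroup.zero_closed[OF ideal.axioms(1)[OF ideal_R_ideal[of I]]]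
  by (force simp: R_cls_def a_r_coset_def r_coset_def)

section \<open>Symmetric elements\<close>

text \<open>Polynomials are evaluated in commutative rings. The symmetric elements form one, being
  central, and so get a type of their own.\<close>

typedef (overloaded) ('i, 'k) asharp = "{x :: ('i, 'k::field_char_0) afam. astar x = x}"
  morphisms sval Abs_asharp
  by (rule exI[of _ 0]) simp

setup_lifting type_definition_asharp

instantiation asharp :: (type, field_char_0) comm_ring_1
begin

lift_definition zero_asharp :: "('a, 'b) asharp" is 0 by simp
lift_definition one_asharp :: "('a, 'b) asharp" is 1 by simp
lift_definition plus_asharp :: "('a, 'b) asharp \<Rightarrow> ('a, 'b) asharp \<Rightarrow> ('a, 'b) asharp" is "(+)"
  by (simp add: astar_add)
lift_definition times_asharp :: "('a, 'b) asharp \<Rightarrow> ('a, 'b) asharp \<Rightarrow> ('a, 'b) asharp" is "(*)"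
  by (simp add: astar_mult astar_commute)
lift_definition uminus_asharp :: "('a, 'b) asharp \<Rightarrow> ('a, 'b) asharp" is uminus
  by (simp add: astar_minus)
lift_definition minus_asharp :: "('a, 'b) asharp \<Rightarrow> ('a, 'b) asharp \<Rightarrow> ('a, 'b) asharp" is "(-)"
  by (simp add: astar_diff)

instance
  by standard (transfer; simp add: algebra_simps astar_commute)+

end

lemmas sval_simps = zero_asharp.rep_eq one_asharp.rep_eq plus_asharp.rep_eq times_asharp.rep_eq
  uminus_asharp.rep_eq minus_asharp.rep_eq

lemma astar_sval: "astar (sval x) = sval x"
  using sval[of x] by simp

lemma sval_commute: "y * sval x = sval x * y"
  by (rule astar_commute) (rule astar_sval)

definition avec :: "'i \<Rightarrow> ('i, 'k::field_char_0) afam" where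
  "avec i = ascal (1/2) * (agen (i, True) - agen (i, False))"

lemma astar_ascal_mult: "astar (ascal c * x) = ascal c * astar x"
  by (simp add: astar_mult ascal.commute)

lemma astar_avec: "astar (avec i) = - avec i"
  by (simp add: avec_def astar_ascal_mult astar_diff astar_agen flip: mult_minus_right)

lemma astar_dot:
  assumes "astar x = - x" "astar y = - y"
  shows "astar (A.dot x y) = A.dot x y"
  using assms
  by (simp add: A.dot_def astar_minus astar_add astar_mult ascal.commute[of _ "x * y + y * x"] add.commute)

lemma astar_brk:
  assumes "astar x = - x" "astar y = - y"
  shows "astar (A.brk x y) = - A.brk x y"
  using A.brk_closed[of x y] assms by simp

lemma astar_agen_add:
  "astar (ascal c * (agen (i, True) + agen (i, False))) = ascal c * (agen (i, True) + agen (i, False))"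
  unfolding astar_ascal_mult astar_add astar_agen inv_letter_pair by (simp add: add.commute)

definition slam :: "'i \<Rightarrow> ('i, 'k::field_char_0) asharp" where
  "slam i = Abs_asharp (ascal (1/2) * (agen (i, True) + agen (i, False)))"

definition sdot :: "'i \<Rightarrow> 'i \<Rightarrow> ('i, 'k::field_char_0) asharp" where
  "sdot i j = Abs_asharp (A.dot (avec i) (avec j))"

definition striple :: "'i \<Rightarrow> 'i \<Rightarrow> 'i \<Rightarrow> ('i, 'k::field_char_0) asharp" where
  "striple i j k = Abs_asharp (A.triple (avec i) (avec j) (avec k))"

definition sscal :: "'k::field_char_0 \<Rightarrow> ('i, 'k) asharp" where
  "sscal c = Abs_asharp (ascal c)"

lemma sval_Abs: "astar x = x \<Longrightarrow> sval (Abs_asharp x) = x"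
  by (simp add: Abs_asharp_inverse)

lemma sval_slam: "sval (slam i) = ascal (1/2) * (agen (i, True) + agen (i, False))"
  unfolding slam_def by (rule sval_Abs) (rule astar_agen_add)

lemma sval_sdot: "sval (sdot i j) = A.dot (avec i) (avec j)"
  unfolding sdot_def by (intro sval_Abs astar_dot astar_avec)

lemma sval_striple: "sval (striple i j k) = A.triple (avec i) (avec j) (avec k)"
  unfolding striple_def A.triple_def by (intro sval_Abs astar_dot astar_brk astar_avec)

lemma sval_sscal: "sval (sscal c) = ascal c"
  unfolding sscal_def by (intro sval_Abs astar_ascal)

lemma asharp_eqI: "sval x = sval y \<Longrightarrow> x = y"
  by (simp add: sval_inject)

interpretation sscal: comm_scalars "sscal :: 'k::field_char_0 \<Rightarrow> ('i, 'k) asharp"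
  by standard
    ((rule asharp_eqI, simp add: sval_simps sval_sscal ascal.add ascal.mult; fail) | rule mult.commute)+

fun sgen :: "'i pvar \<Rightarrow> ('i, 'k::field_char_0) asharp" where
  "sgen (Lam i) = slam i"
| "sgen (Mv i j) = sdot i j"
| "sgen (Wv i j k) = striple i j k"

abbreviation seval :: "('i, 'k::field_char_0) mpoly \<Rightarrow> ('i, 'k) asharp" where
  "seval \<equiv> sscal.eval sgen"

lemma agen_mult: "agen (i, True) * agen (i, False) = 1" "agen (i, False) * agen (i, True) = 1"
  using agen_inv[of "(i, True)"] agen_inv[of "(i, False)"] by simp_all

text \<open>From gg' = g'g = 1 one gets (g + g')^2 - (g - g')^2 = 4, and a quarter of this is
  \<open>slam i ^ 2 + sdot i i = 1\<close>. The minus sign in the dot product turns the difference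
  into a sum.\<close>

lemma sdot_self: "sdot i i = (1 - slam i ^ 2 :: ('i, 'k::field_char_0) asharp)"
proof -
  let ?g = "agen (i, True) :: ('i, 'k) afam" and ?g' = "agen (i, False) :: ('i, 'k) afam"
    and ?v = "avec i :: ('i, 'k) afam" and ?h = "ascal (1/2) :: ('i, 'k) afam"
  have dot: "A.dot (?v) (?v) = - (?v * ?v)"
    using A.h_add[of "?v * ?v"] by (simp add: A.dot_def distrib_left)
  have sq: "(?h * x) * (?h * x) = ?h * (?h * (x * x))" for x
    by (metis ascal.commute mult.assoc)
  have "(?g + ?g') * (?g + ?g') - (?g - ?g') * (?g - ?g') = 1 + 1 + (1 + 1)"
    by (simp add: algebra_simps agen_mult)
  then have "?h * (?h * ((?g + ?g') * (?g + ?g'))) - ?h * (?h * ((?g - ?g') * (?g - ?g'))) =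
      ?h * (?h * (1 + 1 + (1 + 1)))"
    by (simp flip: right_diff_distrib)
  also have "\<dots> = 1"
    by (simp only: distrib_left mult_1_right A.h_half)
  finally have "?h * (?h * ((?g + ?g') * (?g + ?g'))) + A.dot (?v) (?v) = 1"
    unfolding dot by (simp add: avec_def sq)
  then have "sval (slam i * slam i + sdot i i) = sval (1 :: ('i, 'k) asharp)"
    by (simp add: sval_simps sval_slam sval_sdot sq)
  then show ?thesis by (simp add: sval_inject power2_eq_square algebra_simps)
qed

lemma seval_R_rels:
  assumes "r \<in> R_rels I"
  shows "seval r = 0"
proof -
  have 1: "sdot i j = sdot j i" for i j
    by (rule asharp_eqI) (simp only: sval_sdot A.dot_commute)
  have 2: "striple i j k = striple k i j" for i j k
    by (rule asharp_eqI) (simp add: sval_simps sval_sdot sval_striple A.triple_rotate astar_avec)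
  have 3: "striple i j k + striple k j i = 0" for i j k
    by (rule asharp_eqI) (simp add: sval_simps sval_sdot sval_striple A.triple_reverse[of "avec i"] astar_avec)
  have 4: "striple j k l * sdot i s - striple i k l * sdot j s + striple i j l * sdot k s
      - striple i j k * sdot l s = 0" for i j k l s
    by (rule asharp_eqI) (simp add: sval_simps sval_sdot sval_striple A.triple_exchange astar_avec)
  have "striple i j k * striple l s t =
      sdot k l * (sdot i s * sdot j t - sdot j s * sdot i t) +
      sdot j l * (sdot k s * sdot i t - sdot i s * sdot k t) +
      sdot i l * (sdot j s * sdot k t - sdot k s * sdot j t)" for i j k l s t
    by (rule asharp_eqI) (simp add: sval_simps sval_sdot sval_striple A.triple_mult_triple astar_avec)
  then have 5: "striple i j k * striple l s t = det3 (sdot i l) (sdot i s) (sdot i t)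
      (sdot j l) (sdot j s) (sdot j t) (sdot k l) (sdot k s) (sdot k t)" for i j k l s t
    by (simp add: det3_def algebra_simps)
  show ?thesis
    using assms unfolding R_rels_def
    by (auto simp: sscal.eval_add sscal.eval_diff sscal.eval_mult sscal.eval_power sscal.eval_det3
        sdot_self 3 4 5 intro: 1 2)
qed

lemma seval_R_ideal:
  fixes p :: "('i, 'k::field_char_0) mpoly"
  assumes "p \<in> R_ideal I"
  shows "seval p = 0"
proof -
  interpret P: cring "poly_ring I :: ('i, 'k) mpoly ring" by (rule cring_poly_ring)
  let ?J = "{p :: ('i, 'k) mpoly. p \<in> carrier (poly_ring I) \<and> seval p = 0}"
  have "ideal ?J (poly_ring I)"
    by (rule P.ideal_of_closed)
       (auto simp: sscal.eval_add sscal.eval_mult poly_add_closed poly_mult_closed zero_poly_closed)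
  moreover have "R_rels I \<subseteq> ?J"
    using R_rels_closed seval_R_rels by auto
  ultimately show ?thesis using R_ideal_minimal assms by blast
qed

section \<open>Spanning over the image of \<open>R\<close>\<close>

inductive_set vspan :: "'i set \<Rightarrow> ('i, 'k::field_char_0) afam set" for I :: "'i set" where
  vec: "p \<in> carrier (poly_ring I) \<Longrightarrow> i \<in> I \<Longrightarrow> sval (seval p) * avec i \<in> vspan I"
| bivec: "p \<in> carrier (poly_ring I) \<Longrightarrow> i \<in> I \<Longrightarrow> j \<in> I \<Longrightarrow>
    sval (seval p) * A.brk (avec i) (avec j) \<in> vspan I"
| plus: "x \<in> vspan I \<Longrightarrow> y \<in> vspan I \<Longrightarrow> x + y \<in> vspan I"

lemma vspan_skew: "x \<in> vspan I \<Longrightarrow> astar x = - x"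
  by (induction rule: vspan.induct)
     (simp_all add: astar_mult astar_sval astar_avec astar_brk astar_add sval_commute)

text \<open>For empty \<open>I\<close> the inductive set \<open>vspan I\<close> is empty, hence the
  separate alternative 0 for the vector part.\<close>

definition aspan :: "'i set \<Rightarrow> ('i, 'k::field_char_0) afam set" where
  "aspan I = {sval (seval p) + x | p x. p \<in> carrier (poly_ring I) \<and> x \<in> vspan I \<union> {0}}"

lemma seval_mem_aspan: "p \<in> carrier (poly_ring I) \<Longrightarrow> sval (seval p) \<in> aspan I"
  by (force simp: aspan_def)

lemma vspan_mem_aspan:
  assumes "x \<in> vspan I"
  shows "x \<in> aspan I"
proof -
  have "x = sval (seval 0) + x" by (simp add: sval_simps)
  then show ?thesis using assms zero_poly_closed unfolding aspan_def by blast
qed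

lemma aspan_add:
  assumes "x \<in> aspan I" "y \<in> aspan I"
  shows "x + y \<in> aspan I"
proof -
  obtain p x' where p: "p \<in> carrier (poly_ring I)" "x' \<in> vspan I \<union> {0}" "x = sval (seval p) + x'"
    using assms(1) by (auto simp: aspan_def)
  obtain q y' where q: "q \<in> carrier (poly_ring I)" "y' \<in> vspan I \<union> {0}" "y = sval (seval q) + y'"
    using assms(2) by (auto simp: aspan_def)
  have "x' + y' \<in> vspan I \<union> {0}" using p q by (auto intro: vspan.plus)
  moreover have "x + y = sval (seval (p + q)) + (x' + y')"
    using p q by (simp add: sscal.eval_add sval_simps)
  ultimately show ?thesis using p q poly_add_closed[of p I q] unfolding aspan_def by blast
qed

lemma vspan_scale:
  assumes "p \<in> carrier (poly_ring I)" "x \<in> vspan I"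
  shows "sval (seval p) * x \<in> vspan I"
  using assms(2)
proof (induction rule: vspan.induct)
  case (vec q i)
  then show ?case using vspan.vec[OF poly_mult_closed[of p I q], of i] assms(1)
    by (simp add: sscal.eval_mult sval_simps mult.assoc)
next
  case (bivec q i j)
  then show ?case using vspan.bivec[OF poly_mult_closed[of p I q], of i j] assms(1)
    by (simp add: sscal.eval_mult sval_simps mult.assoc)
qed (simp add: distrib_left vspan.plus)

lemma aspan_scale:
  assumes "p \<in> carrier (poly_ring I)" "x \<in> aspan I"
  shows "sval (seval p) * x \<in> aspan I"
proof -
  obtain q y where q: "q \<in> carrier (poly_ring I)" "y \<in> vspan I \<union> {0}" "x = sval (seval q) + y"
    using assms(2) by (auto simp: aspan_def)
  have "sval (seval p) * y \<in> vspan I \<union> {0}" using q(2) assms(1) by (auto intro: vspan_scale)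
  moreover have "sval (seval p) * x = sval (seval (p * q)) + sval (seval p) * y"
    using q by (simp add: sscal.eval_mult sval_simps distrib_left)
  ultimately show ?thesis using q assms(1) poly_mult_closed[of p I q] unfolding aspan_def by blast
qed

text \<open>A product of vectors is bracket minus dot product, and the double bracket formula sends
  [i, [j, k]] back to the vectors j and k; therefore no longer brackets arise.\<close>

lemma avec_mult_vspan:
  fixes x :: "('i, 'k::field_char_0) afam"
  assumes "i \<in> I" "x \<in> vspan I"
  shows "avec i * x \<in> aspan I"
  using assms(2)
proof (induction rule: vspan.induct)
  case (vec p j)
  have "avec i * avec j = A.brk (avec i) (avec j) - sval (sdot i j)"
    by (simp add: sval_sdot A.mult_eq_brk_dot)
  also have "\<dots> = sval (seval (- PV (Mv i j))) + sval (seval 1) * A.brk (avec i) (avec j)"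
    by (simp add: sscal.eval_minus sval_simps)
  also have "\<dots> \<in> aspan I"
    using assms vec by (intro aspan_add seval_mem_aspan vspan_mem_aspan vspan.bivec one_poly_closed
      poly_minus_closed PV_closed) auto
  finally have "sval (seval p) * (avec i * avec j) \<in> aspan I"
    by (rule aspan_scale[OF vec(1)])
  then show ?case by (metis sval_commute mult.assoc)
next
  case (bivec p j k)
  let ?v = "avec :: 'i \<Rightarrow> ('i, 'k) afam"
  have "A.brk (?v i) (A.brk (?v j) (?v k)) = sval (sdot i k) * ?v j - sval (sdot i j) * ?v k"
    by (simp add: sval_sdot A.brk_brk astar_avec)
  moreover have "A.dot (?v i) (A.brk (?v j) (?v k)) = sval (striple j k i)"
    by (simp add: sval_striple A.triple_def A.dot_commute)
  ultimately have "?v i * A.brk (?v j) (?v k) =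
      sval (sdot i k) * ?v j - sval (sdot i j) * ?v k - sval (striple j k i)"
    by (subst A.mult_eq_brk_dot) simp
  also have "\<dots> = sval (seval (- PV (Wv j k i))) + (sval (seval (PV (Mv i k))) * ?v j +
      sval (seval (- PV (Mv i j))) * ?v k)"
    by (simp add: sscal.eval_minus sval_simps)
  also have "\<dots> \<in> aspan I"
    using assms bivec by (intro aspan_add seval_mem_aspan vspan_mem_aspan vspan.vec
      poly_minus_closed PV_closed) auto
  finally have "sval (seval p) * (?v i * A.brk (?v j) (?v k)) \<in> aspan I"
    by (rule aspan_scale[OF bivec(1)])
  then show ?case by (metis sval_commute mult.assoc)
qed (simp add: distrib_left aspan_add)

lemma avec_mult_aspan:
  assumes "i \<in> I" "x \<in> aspan I"
  shows "avec i * x \<in> aspan I"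
proof -
  obtain p y where p: "p \<in> carrier (poly_ring I)" "y \<in> vspan I \<union> {0}" "x = sval (seval p) + y"
    using assms(2) by (auto simp: aspan_def)
  have "avec i * y \<in> aspan I"
    using p(2) avec_mult_vspan[OF assms(1)] seval_mem_aspan[OF zero_poly_closed] by (auto simp: sval_simps)
  moreover have "sval (seval p) * avec i \<in> aspan I"
    using vspan_mem_aspan vspan.vec[OF p(1) assms(1)] .
  ultimately show ?thesis
    using p aspan_add by (simp add: distrib_left sval_commute)
qed

lemma agen_eq: "agen (i, b) = sval (slam i) + (if b then avec i else - avec i)"
  by (cases b) (simp_all add: sval_slam avec_def algebra_simps A.h_add)

lemma agen_mult_aspan:
  assumes "i \<in> I" "x \<in> aspan I"
  shows "agen (i, b) * x \<in> aspan I"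
proof -
  have "sval (slam i) * x \<in> aspan I"
    using aspan_scale[OF PV_closed[of "Lam i"] assms(2)] assms(1) by simp
  moreover have "- (avec i * x) \<in> aspan I"
    using aspan_scale[OF poly_minus_closed[OF one_poly_closed] avec_mult_aspan[OF assms]]
    by (simp add: sscal.eval_minus sval_simps)
  ultimately show ?thesis
    using avec_mult_aspan[OF assms]
    by (cases b) (simp_all add: agen_eq distrib_right left_diff_distrib aspan_add
        add_uminus_conv_diff[symmetric] del: add_uminus_conv_diff)
qed

lemma word_prod_mem_aspan: "fst ` set w \<subseteq> I \<Longrightarrow> word_prod agen w \<in> aspan I"
proof (induction w)
  case Nil
  then show ?case using seval_mem_aspan[OF one_poly_closed] by (simp add: sval_simps)
next
  case (Cons x w)
  then show ?case using agen_mult_aspan[of "fst x" I _ "snd x"] by simp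
qed

lemma lift_mem_aspan:
  assumes "f \<in> carrier (group_ring (free_group I))"
  shows "ascal.lift (word_prod agen) f \<in> aspan I"
  using assms
proof (induction f rule: group_ring_induct)
  case zero
  then show ?case
    using seval_mem_aspan[OF zero_poly_closed] by (simp add: ascal.lift_def supp_def sval_simps)
next
  case (add f w a)
  have "ascal a * word_prod agen w = sval (seval (PC a)) * word_prod agen w"
    by (simp add: sval_sscal)
  then have "ascal a * word_prod agen w \<in> aspan I"
    using aspan_scale[OF PC_closed word_prod_mem_aspan, of w I a] add
    by (simp add: carrier_free_group)
  then show ?case
    using add by (simp add: gr_add_def ascal.lift_add ascal.lift_scale finite_supp_gr_scale
        carrier_group_ring aspan_add)
qed

text \<open>The involution changes the sign of the skew part and fixes the rest, so averaging a
  symmetric element with its image leaves only the value of a polynomial.\<close>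

lemma sharp_eq_seval:
  assumes "X \<in> sharp (free_group I)"
  obtains p where "p \<in> carrier (poly_ring I)" "X = acomp (sval (seval p)) I"
proof -
  obtain f where f: "f \<in> carrier (group_ring (free_group I))" "X = A_cls (free_group I) f"
    using assms by (auto simp: sharp_def group.carrier_A_ring[OF group_free_group])
  obtain p y where p: "p \<in> carrier (poly_ring I)" "y \<in> vspan I \<union> {0}"
    and lift: "ascal.lift (word_prod agen) f = sval (seval p) + y"
    using lift_mem_aspan[OF f(1)] by (auto simp: aspan_def)
  have "astar y = - y" using p(2) vspan_skew by auto
  then have "acomp (sval (seval p) - y) I = A_star (free_group I) (acomp (sval (seval p) + y) I)"
    using fun_cong[OF astar.rep_eq[of "sval (seval p) + y"], of I]
    by (simp add: astar_add astar_sval)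
  also have "\<dots> = acomp (sval (seval p) + y) I"
    using assms f acomp_lift[OF f(1)] by (simp add: lift sharp_def)
  finally have eq: "acomp (sval (seval p) - y) I = acomp (sval (seval p) + y) I" .
  \<comment> \<open>Symmetry is known at the component \<open>I\<close> only. The averaging
    therefore takes place in this component, and nothing is claimed about y as a whole.\<close>
  have "acomp (ascal (1/2) * (sval (seval p) - y) + ascal (1/2) * (sval (seval p) + y)) I =
      acomp (ascal (1/2) * (sval (seval p) + y) + ascal (1/2) * (sval (seval p) + y)) I"
    by (simp only: acomp_simps eq)
  moreover have "ascal (1/2) * (sval (seval p) - y) + ascal (1/2) * (sval (seval p) + y) = sval (seval p)"
    using A.h_add[of "sval (seval p)"] by (simp add: algebra_simps)
  ultimately have "acomp (sval (seval p)) I = acomp (sval (seval p) + y) I"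
    by (simp only: A.h_add)
  then show ?thesis
    using that p(1) f acomp_lift[OF f(1)] lift by metis
qed

section \<open>The module of coordinates\<close>

datatype 'i midx = Scal | Vec 'i | Biv 'i 'i

text \<open>These are (R1), (R3) and (R4); (R2), which ties the vectors to the letters, comes in
  with \<open>egen_inv\<close>. The rule \<open>w_self\<close> is an axiom of its own because over a
  general commutative ring the skew symmetry of \<open>w\<close> only gives
  \<open>2 * w i i k = 0\<close>.\<close>

locale vector_relations =
  fixes m :: "'i \<Rightarrow> 'i \<Rightarrow> 'r::comm_ring_1" and w :: "'i \<Rightarrow> 'i \<Rightarrow> 'i \<Rightarrow> 'r"
  assumes m_commute: "m i j = m j i"
    and w_rotate: "w i j k = w k i j"
    and w_reverse: "w i j k = - w k j i"
    and w_self: "w i i k = 0"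
    and w_exchange: "w j k l * m i s - w i k l * m j s + w i j l * m k s - w i j k * m l s = 0"
    and w_mult: "w i j k * w l s t =
      det3 (m i l) (m i s) (m i t) (m j l) (m j s) (m j t) (m k l) (m k s) (m k t)"
begin

text \<open>\<open>x Scal\<close> is the scalar part of an element; \<open>x (Vec s)\<close> and \<open>x (Biv s t)\<close> are the dot products of
  its vector part with the vectors \<open>v\<^sub>s\<close> and \<open>[v\<^sub>s, v\<^sub>t]\<close>.\<close>
definition vmod :: "('i midx \<Rightarrow> 'r) set" where
  "vmod = {x. (\<forall>i. x (Biv i i) = 0) \<and> (\<forall>i j. x (Biv i j) = - x (Biv j i)) \<and>
    (\<forall>i j k l. x (Vec l) * w i j k = m i l * x (Biv j k) + m k l * x (Biv i j) + m j l * x (Biv k i)) \<and>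
    (\<forall>i j k l p. x (Biv l p) * w i j k =
      det3 (x (Vec i)) (x (Vec j)) (x (Vec k)) (m l i) (m l j) (m l k) (m p i) (m p j) (m p k))}"

lemma vmod_lincomb:
  assumes "x \<in> vmod" "y \<in> vmod"
  shows "(\<lambda>d. a * x d + b * y d) \<in> vmod"
proof -
  have 0: "z (Biv i i) = 0" and 1: "z (Biv i j) = - z (Biv j i)"
    and 2: "z (Vec l) * w i j k = m i l * z (Biv j k) + m k l * z (Biv i j) + m j l * z (Biv k i)"
    and 3: "z (Biv l p) * w i j k =
      det3 (z (Vec i)) (z (Vec j)) (z (Vec k)) (m l i) (m l j) (m l k) (m p i) (m p j) (m p k)"
    if "z \<in> vmod" for z i j k l p
    using that unfolding vmod_def by blast+
  have *: "(a * u + b * v) * t = a * (u * t) + b * (v * t)" for u v t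
    by (simp add: algebra_simps)
  show ?thesis
    unfolding vmod_def mem_Collect_eq * 2[OF assms(1)] 2[OF assms(2)] 3[OF assms(1)] 3[OF assms(2)]
  proof (intro conjI allI)
    fix i j show "a * x (Biv i j) + b * y (Biv i j) = - (a * x (Biv j i) + b * y (Biv j i))"
      by (simp add: 1[OF assms(1), of i j] 1[OF assms(2), of i j])
  qed (simp_all add: 0[OF assms(1)] 0[OF assms(2)] det3_def algebra_simps)
qed

text \<open>Left multiplication by \<open>v\<^sub>i\<close>; the coordinates come from \<open>[v\<^sub>i, y] . z = y . [z, v\<^sub>i]\<close> and the
  double bracket formula.\<close>
definition vop :: "'i \<Rightarrow> ('i midx \<Rightarrow> 'r) \<Rightarrow> 'i midx \<Rightarrow> 'r" where
  "vop i x d = (case d of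
      Scal \<Rightarrow> - x (Vec i)
    | Vec s \<Rightarrow> x Scal * m i s + x (Biv s i)
    | Biv s t \<Rightarrow> x Scal * w s t i - m i t * x (Vec s) + m i s * x (Vec t))"

lemma vop_simps [simp]:
  "vop i x Scal = - x (Vec i)"
  "vop i x (Vec s) = x Scal * m i s + x (Biv s i)"
  "vop i x (Biv s t) = x Scal * w s t i - m i t * x (Vec s) + m i s * x (Vec t)"
  by (simp_all add: vop_def)

lemma w_swap: "w i j k = - w j i k"
  using w_rotate w_reverse by metis

text \<open>(R3) in the shape of the equation for \<open>Vec\<close> in \<open>vmod\<close>, written
  for the coordinates \<open>m p l\<close> and \<open>w j k p\<close> of the vector with index
  p.\<close>

lemma w_scale_m: "w i j k * m p l = m i l * w j k p + m k l * w i j p + m j l * w k i p"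
proof -
  have "w i j k * m p l = w j k p * m i l - w i k p * m j l + w i j p * m k l"
    using w_exchange[of j k p i l] by simp
  then show ?thesis by (simp add: w_swap[of i k p] ac_simps)
qed

lemma vop_closed:
  assumes "x \<in> vmod"
  shows "vop p x \<in> vmod"
proof -
  have 0: "x (Biv i i) = 0" and 1: "x (Biv i j) = - x (Biv j i)"
    and 2: "x (Vec l) * w i j k = m i l * x (Biv j k) + m k l * x (Biv i j) + m j l * x (Biv k i)"
    and 3: "x (Biv l p) * w i j k = 
      det3 (x (Vec i)) (x (Vec j)) (x (Vec k)) (m l i) (m l j) (m l k) (m p i) (m p j) (m p k)"
    for i j k l p
    using assms unfolding vmod_def by blast+
  show ?thesis
    unfolding vmod_def mem_Collect_eq
  proof (intro conjI allI)
    fix i show "vop p x (Biv i i) = 0" by (simp add: w_self)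
  next
    fix i j show "vop p x (Biv i j) = - vop p x (Biv j i)"
      by (simp add: w_swap[of i j p])
  next
    fix i j k l
    \<comment> \<open>The scalar part of x is covered by (R3), the vector part by the determinant
      equation of x. For the determinant equation of the product, further down, the scalar part
      needs (R4) and the vector part the equation for \<open>Vec\<close>.\<close>
    have "vop p x (Vec l) * w i j k = x Scal * (w i j k * m p l) + x (Biv l p) * w i j k"
      by (simp add: algebra_simps)
    also have "\<dots> = m i l * vop p x (Biv j k) + m k l * vop p x (Biv i j) + m j l * vop p x (Biv k i)"
      unfolding w_scale_m 3 by (simp add: det3_def algebra_simps m_commute)
    finally show "vop p x (Vec l) * w i j k =
      m i l * vop p x (Biv j k) + m k l * vop p x (Biv i j) + m j l * vop p x (Biv k i)" .
  next
    fix i j k l q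
    \<comment> \<open>Rewriting \<open>w i j k * m p l\<close> by (R3) puts the index p into each
      \<open>w\<close>. After the equation for \<open>Vec\<close> is applied, the terms with
      \<open>m p q\<close> cancel the second product in the difference, and only coordinates of
      brackets with p remain.\<close>
    have "m p l * (x (Vec q) * w i j k) = x (Vec q) * (w i j k * m p l)"
      by (simp add: ac_simps)
    also have "\<dots> = m i l * (x (Vec q) * w j k p) + m k l * (x (Vec q) * w i j p) + m j l * (x (Vec q) * w k i p)"
      unfolding w_scale_m by (simp add: algebra_simps)
    finally have *: "m p l * (x (Vec q) * w i j k) - m p q * (x (Vec l) * w i j k) =
        x (Biv i p) * (m l j * m q k - m l k * m q j) + x (Biv j p) * (m l k * m q i - m l i * m q k)
        + x (Biv k p) * (m l i * m q j - m l j * m q i)"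
      unfolding 2 by (simp add: 1[of p i] 1[of p j] 1[of p k] algebra_simps m_commute)
    have "vop p x (Biv l q) * w i j k = x Scal * (w i j k * w l q p)
        + (m p l * (x (Vec q) * w i j k) - m p q * (x (Vec l) * w i j k))"
      by (simp add: algebra_simps)
    also have "\<dots> = det3 (vop p x (Vec i)) (vop p x (Vec j)) (vop p x (Vec k))
        (m l i) (m l j) (m l k) (m q i) (m q j) (m q k)"
      unfolding * w_mult by (simp add: det3_def algebra_simps m_commute)
    finally show "vop p x (Biv l q) * w i j k =
      det3 (vop p x (Vec i)) (vop p x (Vec j)) (vop p x (Vec k)) (m l i) (m l j) (m l k) (m q i) (m q j) (m q k)" .
  qed
qed

text \<open>The Clifford relation of the dot product. In the coordinates \<open>Scal\<close> and
  \<open>Vec\<close> it follows from the skew symmetry of x and w; in the coordinate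
  \<open>Biv\<close> the products of w with coordinates of x are removed by the equation for
  \<open>Vec\<close>.\<close>

lemma vop_anticommute:
  assumes "x \<in> vmod"
  shows "vop i (vop j x) d + vop j (vop i x) d = - 2 * m i j * x d"
proof -
  have 1: "x (Biv i j) = - x (Biv j i)"
    and 2: "x (Vec l) * w i j k = m i l * x (Biv j k) + m k l * x (Biv i j) + m j l * x (Biv k i)"
    for i j k l
    using assms unfolding vmod_def by blast+
  show ?thesis
  proof (cases d)
    case Scal
    then show ?thesis by (simp add: 1[of i j] algebra_simps m_commute)
  next
    case (Vec s)
    have "w s i j = - w s j i" using w_swap w_rotate by metis
    then show ?thesis using Vec by (simp add: algebra_simps m_commute)
  next
    case (Biv s t)
    have "vop i (vop j x) d + vop j (vop i x) d =
        - (x (Vec j) * w s t i) - x (Vec i) * w s t j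
        - m i t * (x Scal * m j s + x (Biv s j)) + m i s * (x Scal * m j t + x (Biv t j))
        - m j t * (x Scal * m i s + x (Biv s i)) + m j s * (x Scal * m i t + x (Biv t i))"
      using Biv by simp
    also have "\<dots> = - 2 * m i j * x d"
      unfolding 2 Biv by (simp add: 1[of i s] 1[of j s] algebra_simps m_commute)
    finally show ?thesis .
  qed
qed

text \<open>In an oriented 3-space the volume element is central; its value is \<open>- 4 w\<close> because each of
  the four products contributes one copy of \<open>- w\<close>.\<close>
lemma vop_volume:
  fixes i j k
  defines "b x d \<equiv> vop j (vop k x) d - vop k (vop j x) d"
  assumes "x \<in> vmod"
  shows "vop i (b x) d + b (vop i x) d = - 4 * w i j k * x d"
proof -
  have 1: "x (Biv i j) = - x (Biv j i)"
    and 2: "x (Vec l) * w i j k = m i l * x (Biv j k) + m k l * x (Biv i j) + m j l * x (Biv k i)"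
    and 3: "x (Biv l p) * w i j k = 
      det3 (x (Vec i)) (x (Vec j)) (x (Vec k)) (m l i) (m l j) (m l k) (m p i) (m p j) (m p k)"
    for i j k l p
    using assms(2) unfolding vmod_def by blast+
  have w': "w a c b = - w a b c" for a b c using w_swap w_rotate by metis
  show ?thesis
  proof (cases d)
    case Scal
    then show ?thesis
      by (simp add: b_def w_rotate[of j k i] w_rotate[of k j i] w'[of i k j] 1[of k j] algebra_simps m_commute)
  next
    case (Vec s)
    have "vop i (b x) d + b (vop i x) d =
        - 2 * (x (Biv j k) * m i s) - x (Vec k) * w s i j + x (Vec j) * w s i k
        - 2 * (x (Vec i) * w s j k)
        - m i j * x (Biv s k) + m i k * x (Biv s j) + m j s * x (Biv i k) - m k s * x (Biv i j)
        - 2 * (x (Biv k i) * m j s) + 2 * (m k s * x (Biv j i))"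
      using Vec by (simp add: b_def w'[of s k j] 1[of k j] algebra_simps m_commute)
    also have "\<dots> = - 4 * (x (Vec s) * w i j k)"
      unfolding 2
      by (simp add: 1[of k j] 1[of j i] 1[of k i] 1[of s i] 1[of s j] 1[of s k] algebra_simps m_commute)
    finally show ?thesis using Vec by (simp add: ac_simps)
  next
    case (Biv s t)
    \<comment> \<open>The coefficient of the scalar part of x. Each bracket is the right-hand side
      of \<open>w_scale_m\<close>: the first two equal \<open>w i j k * m s t\<close> and occur with
      opposite signs, the third cancels the last term.\<close>
    let ?Z = "- (m i t * w j k s + m k t * w i j s + m j t * w k i s)
        + (m i s * w j k t + m k s * w i j t + m j s * w k i t)
        + (m s i * w t j k + m j i * w s t k + m t i * w j s k) - w s t j * m k i"
    have Z: "?Z = 0"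
      unfolding w_scale_m[symmetric] by (simp add: m_commute)
    have "w j k s = w s j k" "w i j s = - w s j i" "w k i s = w s k i"
      "w j k t = w t j k" "w i j t = - w t j i" "w k i t = w t k i" "w j s k = - w s j k"
      "w s k j = - w s j k" "w t k j = - w t j k"
      using w_rotate w_swap by metis+
    then have "vop i (b x) d + b (vop i x) d = x Scal * ?Z
        - 2 * (x (Biv j k) * w s t i) - x (Biv k i) * w s t j + x (Biv j i) * w s t k
        - 2 * m i t * (m k s * x (Vec j) - m j s * x (Vec k))
        + 2 * m i s * (m k t * x (Vec j) - m j t * x (Vec k))
        + 2 * x (Vec i) * (m j t * m k s - m j s * m k t)
        - m j t * (m i s * x (Vec k) - m i k * x (Vec s)) + m j s * (m i t * x (Vec k) - m i k * x (Vec t))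
        + m k t * (m i s * x (Vec j) - m i j * x (Vec s)) - m k s * (m i t * x (Vec j) - m i j * x (Vec t))"
      using Biv by (simp add: b_def 1[of k j] algebra_simps m_commute)
    also have "\<dots> = - 4 * (x (Biv s t) * w i j k)"
      unfolding Z 3 by (simp add: det3_def algebra_simps m_commute)
    finally have "vop i (b x) d + b (vop i x) d = - 4 * (x (Biv s t) * w i j k)" .
    then show ?thesis using Biv by (simp add: ac_simps)
  qed
qed

end

section \<open>The rings \<open>R\<close> for all index sets\<close>

typedef (overloaded) ('i, 'k) rfam =
  "{F :: 'i set \<Rightarrow> ('i, 'k::field) mpoly set. \<forall>I. F I \<in> carrier (R_ring I)}"
  morphisms rcomp Abs_rfam
  by (rule exI[of _ "\<lambda>I. \<zero>\<^bsub>R_ring I\<^esub>"]) (simp add: cring.cring_simprules(2)[OF cring_R_ring])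

setup_lifting type_definition_rfam

text \<open>One component in which 0 differs from 1 is enough for the whole family, and for empty
  \<open>I\<close> there are no relations.\<close>

lemma one_not_mem_R_ideal_empty: "(1 :: ('i, 'k::field) mpoly) \<notin> R_ideal {}"
proof -
  have "ideal {0 :: ('i, 'k) mpoly} (poly_ring {})"
    using ring.zeroideal[OF cring.axioms(1)[OF cring_poly_ring[of "{}"]]] by simp
  then have "R_ideal {} \<subseteq> {0 :: ('i, 'k) mpoly}"
    by (rule R_ideal_minimal) (auto simp: R_rels_def)
  then show ?thesis by auto
qed

instantiation rfam :: (type, field) comm_ring_1
begin

lift_definition zero_rfam :: "('a, 'b) rfam" is "\<lambda>I. \<zero>\<^bsub>R_ring I\<^esub>"
  by (simp add: cring.cring_simprules(2)[OF cring_R_ring])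
lift_definition one_rfam :: "('a, 'b) rfam" is "\<lambda>I. \<one>\<^bsub>R_ring I\<^esub>"
  by (simp add: cring.cring_simprules(6)[OF cring_R_ring])
lift_definition plus_rfam :: "('a, 'b) rfam \<Rightarrow> ('a, 'b) rfam \<Rightarrow> ('a, 'b) rfam"
  is "\<lambda>F F' I. F I \<oplus>\<^bsub>R_ring I\<^esub> F' I"
  by (simp add: cring.cring_simprules(1)[OF cring_R_ring])
lift_definition times_rfam :: "('a, 'b) rfam \<Rightarrow> ('a, 'b) rfam \<Rightarrow> ('a, 'b) rfam"
  is "\<lambda>F F' I. F I \<otimes>\<^bsub>R_ring I\<^esub> F' I"
  by (simp add: cring.cring_simprules(5)[OF cring_R_ring])
lift_definition uminus_rfam :: "('a, 'b) rfam \<Rightarrow> ('a, 'b) rfam"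
  is "\<lambda>F I. \<ominus>\<^bsub>R_ring I\<^esub> F I"
  by (simp add: cring.cring_simprules(3)[OF cring_R_ring])
definition minus_rfam :: "('a, 'b) rfam \<Rightarrow> ('a, 'b) rfam \<Rightarrow> ('a, 'b) rfam" where
  "minus_rfam F F' = F + - F'"

instance
proof
  fix a b c :: "('a, 'b) rfam"
  note R = ring.ring_simprules[OF cring.axioms(1)[OF cring_R_ring]]
  show "a + b + c = a + (b + c)" by transfer (simp add: R(7))
  show "a + b = b + a" by transfer (simp add: R(10))
  show "0 + a = a" by transfer (simp add: R(8))
  show "- a + a = 0" by transfer (simp add: R(9))
  show "a * b * c = a * (b * c)" by transfer (simp add: R(11))
  show "a * b = b * a" by transfer (simp add: cring.cring_simprules(14)[OF cring_R_ring])
  show "1 * a = a" by transfer (simp add: R(12))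
  show "(a + b) * c = a * c + b * c" by transfer (simp add: R(13))
  show "a - b = a + - b" by (simp add: minus_rfam_def)
  have "R_cls {} 1 \<noteq> (\<zero>\<^bsub>R_ring {}\<^esub> :: ('a, 'b) mpoly set)"
    using one_not_mem_R_ideal_empty by (simp add: R_cls_zero_iff one_poly_closed)
  then have "rcomp (0 :: ('a, 'b) rfam) {} \<noteq> rcomp 1 {}"
    by (simp add: zero_rfam.rep_eq one_rfam.rep_eq R_cls_one)
  then show "(0 :: ('a, 'b) rfam) \<noteq> 1" by auto
qed

end

lemma rfam_eqI: "(\<And>I. rcomp x I = rcomp y I) \<Longrightarrow> x = y"
  by (metis rcomp_inject ext)

lemma rcomp_closed [simp]: "rcomp x I \<in> carrier (R_ring I)"
  using rcomp[of x] by simp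

lemmas rcomp_simps = zero_rfam.rep_eq one_rfam.rep_eq plus_rfam.rep_eq times_rfam.rep_eq

definition rscal :: "'k::field \<Rightarrow> ('i, 'k) rfam" where
  "rscal c = Abs_rfam (\<lambda>I. R_cls I (PC c))"

text \<open>In the components where an index lies outside \<open>I\<close> the generator takes the value that belongs to
  \<open>g\<^sub>i = 1\<close>, so that the relations hold for all indices.\<close>
definition rgen :: "'i pvar \<Rightarrow> ('i, 'k::field) rfam" where
  "rgen v = Abs_rfam (\<lambda>I. if pvar_idx v \<subseteq> I then R_cls I (PV v) else
     (case v of Lam _ \<Rightarrow> \<one>\<^bsub>R_ring I\<^esub> | _ \<Rightarrow> \<zero>\<^bsub>R_ring I\<^esub>))"

lemma rcomp_rscal: "rcomp (rscal c) I = R_cls I (PC c)"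
  unfolding rscal_def by (subst Abs_rfam_inverse) (auto simp: R_cls_closed PC_closed)

lemma rcomp_rgen: "rcomp (rgen v) I = (if pvar_idx v \<subseteq> I then R_cls I (PV v) else
     (case v of Lam _ \<Rightarrow> \<one>\<^bsub>R_ring I\<^esub> | _ \<Rightarrow> \<zero>\<^bsub>R_ring I\<^esub>))"
  unfolding rgen_def
  by (subst Abs_rfam_inverse)
     (auto simp: R_cls_closed PV_closed cring.cring_simprules(2,6)[OF cring_R_ring] split: pvar.splits)

interpretation rscal: comm_scalars "rscal :: 'k::field \<Rightarrow> ('i, 'k) rfam"
proof
  fix a b :: 'k and x :: "('i, 'k) rfam"
  have "PC (a + b) = (PC a + PC b :: ('i, 'k) mpoly)" by (simp add: PC_def single_add)
  then show "rscal (a + b) = (rscal a + rscal b :: ('i, 'k) rfam)"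
    by (intro rfam_eqI) (simp add: rcomp_simps rcomp_rscal R_cls_add PC_closed)
  have "PC (a * b) = (PC a * PC b :: ('i, 'k) mpoly)" by (simp add: PC_def mult_single)
  then show "rscal (a * b) = (rscal a * rscal b :: ('i, 'k) rfam)"
    by (intro rfam_eqI) (simp add: rcomp_simps rcomp_rscal R_cls_mult PC_closed)
  have "PC 1 = (1 :: ('i, 'k) mpoly)" by (simp add: PC_def)
  then show "rscal 1 = (1 :: ('i, 'k) rfam)"
    by (intro rfam_eqI) (simp add: rcomp_simps rcomp_rscal R_cls_one)
qed (rule mult.commute)

abbreviation reval :: "('i, 'k::field) mpoly \<Rightarrow> ('i, 'k) rfam" where
  "reval \<equiv> rscal.eval rgen"

lemma rcomp_reval: "p \<in> carrier (poly_ring I) \<Longrightarrow> rcomp (reval p) I = R_cls I p"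
  by (induction p rule: poly_ring_induct)
     (simp_all add: rcomp_rscal rcomp_rgen rscal.eval_add rscal.eval_mult rcomp_simps R_cls_add R_cls_mult)

section \<open>The relations for arbitrary indices, component by component\<close>

definition rvanish :: "'i set \<Rightarrow> ('i, 'k::field) rfam \<Rightarrow> bool" where
  "rvanish I x \<longleftrightarrow> rcomp x I = \<zero>\<^bsub>R_ring I\<^esub>"

lemma eq_zero_if_rvanish: "(\<And>I. rvanish I x) \<Longrightarrow> x = 0"
  by (rule rfam_eqI) (simp add: rvanish_def rcomp_simps)

lemma rvanish_add: "rvanish I x \<Longrightarrow> rvanish I y \<Longrightarrow> rvanish I (x + y)"
  by (simp add: rvanish_def rcomp_simps ring.ring_simprules(2,8)[OF cring.axioms(1)[OF cring_R_ring]])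

lemma rvanish_mult:
  assumes "rvanish I x \<or> rvanish I y"
  shows "rvanish I (x * y)"
proof -
  interpret R: cring "R_ring I :: ('a, 'b) mpoly set ring" by (rule cring_R_ring)
  show ?thesis
    using assms R.l_null[OF rcomp_closed, of y] R.r_null[OF rcomp_closed, of x]
    unfolding rvanish_def times_rfam.rep_eq by metis
qed

lemma rvanish_diff: "rvanish I x \<Longrightarrow> rvanish I y \<Longrightarrow> rvanish I (x - y)"
  using rvanish_add[of I x "- 1 * y"] rvanish_mult[of I "- 1" y] by simp

lemma rvanish_diff_eq: "rcomp x I = rcomp y I \<Longrightarrow> rvanish I (x - y)"
  unfolding rvanish_def minus_rfam_def plus_rfam.rep_eq uminus_rfam.rep_eq
  by (simp add: ring.ring_simprules(16)[OF cring.axioms(1)[OF cring_R_ring]])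

lemma rvanish_rel: "r \<in> R_rels I \<Longrightarrow> rvanish I (reval r)"
  using R_rels_closed[of I] by (auto simp: rvanish_def rcomp_reval R_cls_rel)

definition rm :: "'i \<Rightarrow> 'i \<Rightarrow> ('i, 'k::field) rfam" where "rm i j = rgen (Mv i j)"
definition rw :: "'i \<Rightarrow> 'i \<Rightarrow> 'i \<Rightarrow> ('i, 'k::field) rfam" where "rw i j k = rgen (Wv i j k)"

lemma rvanish_rm: "i \<notin> I \<or> j \<notin> I \<Longrightarrow> rvanish I (rm i j)"
  by (auto simp: rvanish_def rm_def rcomp_rgen)

lemma rvanish_rw: "i \<notin> I \<or> j \<notin> I \<or> k \<notin> I \<Longrightarrow> rvanish I (rw i j k)"
  by (auto simp: rvanish_def rw_def rcomp_rgen)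

lemmas reval_simps = rscal.eval_add rscal.eval_diff rscal.eval_mult rscal.eval_power rscal.eval_det3
lemmas rvanish_intros = rvanish_add rvanish_diff rvanish_mult rvanish_rm rvanish_rw

lemma rfam_half: "rscal (1/2) + rscal (1/2) = (1 :: ('i, 'k::field_char_0) rfam)"
proof -
  have "rscal (1/2 + 1/2) = (1 :: ('i, 'k) rfam)" by simp
  then show ?thesis by (simp only: rscal.add)
qed

lemma rfam_double_cancel: "x + x = y + y \<Longrightarrow> x = (y :: ('i, 'k::field_char_0) rfam)"
  by (metis rfam_half distrib_left distrib_right mult_1)

lemma R_rels_intros:
  "i \<in> I \<Longrightarrow> j \<in> I \<Longrightarrow> PV (Mv i j) - PV (Mv j i) \<in> R_rels I"
  "i \<in> I \<Longrightarrow> j \<in> I \<Longrightarrow> k \<in> I \<Longrightarrow> PV (Wv i j k) - PV (Wv k i j) \<in> R_rels I"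
  "i \<in> I \<Longrightarrow> j \<in> I \<Longrightarrow> k \<in> I \<Longrightarrow> PV (Wv i j k) + PV (Wv k j i) \<in> R_rels I"
  "i \<in> I \<Longrightarrow> PV (Mv i i) - (1 - PV (Lam i) ^ 2) \<in> R_rels I"
  "i \<in> I \<Longrightarrow> j \<in> I \<Longrightarrow> k \<in> I \<Longrightarrow> l \<in> I \<Longrightarrow> s \<in> I \<Longrightarrow>
    PV (Wv j k l) * PV (Mv i s) - PV (Wv i k l) * PV (Mv j s)
    + PV (Wv i j l) * PV (Mv k s) - PV (Wv i j k) * PV (Mv l s) \<in> R_rels I"
  "i \<in> I \<Longrightarrow> j \<in> I \<Longrightarrow> k \<in> I \<Longrightarrow> l \<in> I \<Longrightarrow> s \<in> I \<Longrightarrow> t \<in> I \<Longrightarrow>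
    PV (Wv i j k) * PV (Wv l s t)
    - det3 (PV (Mv i l)) (PV (Mv i s)) (PV (Mv i t))
           (PV (Mv j l)) (PV (Mv j s)) (PV (Mv j t))
           (PV (Mv k l)) (PV (Mv k s)) (PV (Mv k t)) \<in> R_rels I"
  unfolding R_rels_def by blast+

lemma rm_self: "rm i i = (1 - rgen (Lam i) ^ 2 :: ('i, 'k::field) rfam)"
proof -
  let ?l = "rgen (Lam i) :: ('i, 'k) rfam"
  have "rvanish I (rm i i - (1 - ?l ^ 2))" for I
  proof (cases "i \<in> I")
    case True
    from rvanish_rel[OF R_rels_intros(4)[OF this]] show ?thesis
      by (simp add: reval_simps rm_def)
  next
    case False
    then have "rcomp (?l ^ 2) I = rcomp 1 I"
      by (simp add: power2_eq_square rcomp_simps rcomp_rgen ring.ring_simprules(6,12)[OF cring.axioms(1)[OF cring_R_ring]])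
    then have "rvanish I (1 - ?l ^ 2)"
      by (intro rvanish_diff_eq) simp
    then show ?thesis by (rule rvanish_diff[OF rvanish_rm, rotated]) (use False in simp)
  qed
  from eq_zero_if_rvanish[OF this] show ?thesis by simp
qed

interpretation R: vector_relations "rm :: 'i \<Rightarrow> 'i \<Rightarrow> ('i, 'k::field_char_0) rfam" rw
proof
  fix i j k l s t :: 'i
  have "rvanish I (rm i j - rm j i :: ('i, 'k) rfam)" for I
  proof (cases "{i, j} \<subseteq> I")
    case True
    then show ?thesis using rvanish_rel[OF R_rels_intros(1)[of i I j]] by (simp add: reval_simps rm_def)
  qed (auto intro!: rvanish_intros)
  from eq_zero_if_rvanish[OF this] show "rm i j = (rm j i :: ('i, 'k) rfam)" by simp
  have rot: "rw i j k = (rw k i j :: ('i, 'k) rfam)" for i j k :: 'i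
  proof -
    have "rvanish I (rw i j k - rw k i j :: ('i, 'k) rfam)" for I
    proof (cases "{i, j, k} \<subseteq> I")
      case True
      then show ?thesis using rvanish_rel[OF R_rels_intros(2)[of i I j k]] by (simp add: reval_simps rw_def)
    qed (auto intro!: rvanish_intros)
    from eq_zero_if_rvanish[OF this] show ?thesis by simp
  qed
  then show "rw i j k = (rw k i j :: ('i, 'k) rfam)" .
  have rev: "rw i j k = - (rw k j i :: ('i, 'k) rfam)" for i j k :: 'i
  proof -
    have "rvanish I (rw i j k + rw k j i :: ('i, 'k) rfam)" for I
    proof (cases "{i, j, k} \<subseteq> I")
      case True
      then show ?thesis using rvanish_rel[OF R_rels_intros(3)[of i I j k]] by (simp add: reval_simps rw_def)
    qed (auto intro!: rvanish_intros)
    from eq_zero_if_rvanish[OF this] show ?thesis by (simp add: eq_neg_iff_add_eq_0)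
  qed
  then show "rw i j k = - (rw k j i :: ('i, 'k) rfam)" .
  have "rw i i k + rw i i k = (0 + 0 :: ('i, 'k) rfam)"
    using rot[of i i k] rev[of k i i] by simp
  then show "rw i i k = (0 :: ('i, 'k) rfam)" by (rule rfam_double_cancel)
  let ?e = "rw j k l * rm i s - rw i k l * rm j s + rw i j l * rm k s - rw i j k * rm l s :: ('i, 'k) rfam"
  have "rvanish I ?e" for I
  proof (cases "{i, j, k, l, s} \<subseteq> I")
    case True
    then show ?thesis using rvanish_rel[OF R_rels_intros(5)[of i I j k l s]]
      by (simp add: reval_simps rw_def rm_def)
  next
    case False
    \<comment> \<open>Every monomial of (R3) contains all five indices, so a single one outside
      \<open>I\<close> makes each term vanish in this component. The same happens with the six
      indices of (R4).\<close>
    then consider "i \<notin> I" | "j \<notin> I" | "k \<notin> I" | "l \<notin> I" | "s \<notin> I" by auto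
    then show ?thesis by cases (simp_all add: rvanish_intros)
  qed
  from eq_zero_if_rvanish[OF this] show "?e = 0" .
  let ?d = "det3 (rm i l) (rm i s) (rm i t) (rm j l) (rm j s) (rm j t) (rm k l) (rm k s) (rm k t)
    :: ('i, 'k) rfam"
  have "rvanish I (rw i j k * rw l s t - ?d)" for I
  proof (cases "{i, j, k, l, s, t} \<subseteq> I")
    case True
    then show ?thesis using rvanish_rel[OF R_rels_intros(6)[of i I j k l s t]]
      by (simp add: reval_simps rw_def rm_def)
  next
    case False
    then consider "i \<notin> I" | "j \<notin> I" | "k \<notin> I" | "l \<notin> I" | "s \<notin> I" | "t \<notin> I" by auto
    then show ?thesis by cases (simp_all add: rvanish_intros det3_def)
  qed
  from eq_zero_if_rvanish[OF this] show "rw i j k * rw l s t = ?d" by simp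
qed

section \<open>The representation of the free group\<close>

abbreviation rmod :: "('i midx \<Rightarrow> ('i, 'k::field_char_0) rfam) set" where
  "rmod \<equiv> R.vmod"

lemma rmod_zero: "(\<lambda>d. 0) \<in> rmod"
  by (simp add: R.vmod_def det3_def)

lemma rmod_add: "x \<in> rmod \<Longrightarrow> y \<in> rmod \<Longrightarrow> (\<lambda>d. x d + y d) \<in> rmod"
  using R.vmod_lincomb[of x y 1 1] by simp

lemma rmod_scale: "x \<in> rmod \<Longrightarrow> (\<lambda>d. a * x d) \<in> rmod"
  using R.vmod_lincomb[of x x a 0] by simp

lemma rmod_minus: "x \<in> rmod \<Longrightarrow> (\<lambda>d. - x d) \<in> rmod"
  using rmod_scale[of x "- 1"] by simp

text \<open>The coordinates of the ring element 1. A scalar operator applied to it returns the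
  scalar, which is how \<open>escal_eq_zero\<close> is obtained.\<close>

definition runit :: "'i midx \<Rightarrow> ('i, 'k::field_char_0) rfam" where
  "runit d = (if d = Scal then 1 else 0)"

lemma runit_mem: "runit \<in> rmod"
  by (simp add: R.vmod_def runit_def[abs_def] det3_def)

text \<open>Endomorphisms of the module \<open>rmod\<close>, made unique by the value \<open>0\<close> outside it.\<close>
typedef (overloaded) ('i, 'k) rend =
  "{T :: ('i midx \<Rightarrow> ('i, 'k::field_char_0) rfam) \<Rightarrow> 'i midx \<Rightarrow> ('i, 'k) rfam.
     (\<forall>x\<in>rmod. T x \<in> rmod) \<and> (\<forall>x. x \<notin> rmod \<longrightarrow> T x = (\<lambda>d. 0)) \<and>
     (\<forall>x\<in>rmod. \<forall>y\<in>rmod. T (\<lambda>d. x d + y d) = (\<lambda>d. T x d + T y d)) \<and>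
     (\<forall>a. \<forall>x\<in>rmod. T (\<lambda>d. a * x d) = (\<lambda>d. a * T x d))}"
  morphisms rapp Abs_rend
  by (rule exI[of _ "\<lambda>x d. 0"]) (simp add: rmod_zero)

lemma rapp_closed: "x \<in> rmod \<Longrightarrow> rapp T x \<in> rmod"
  and rapp_outside: "x \<notin> rmod \<Longrightarrow> rapp T x = (\<lambda>d. 0)"
  and rapp_add: "x \<in> rmod \<Longrightarrow> y \<in> rmod \<Longrightarrow> rapp T (\<lambda>d. x d + y d) = (\<lambda>d. rapp T x d + rapp T y d)"
  and rapp_scale: "x \<in> rmod \<Longrightarrow> rapp T (\<lambda>d. a * x d) = (\<lambda>d. a * rapp T x d)"
  using rapp[of T] by simp_all

lemma rend_eqI:
  assumes "\<And>x d. x \<in> rmod \<Longrightarrow> rapp S x d = rapp T x d"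
  shows "S = T"
proof -
  have "rapp S x = rapp T x" for x
    using assms rapp_outside[of x] by (cases "x \<in> rmod") auto
  then have "rapp S = rapp T" by (rule ext)
  then show ?thesis by (simp add: rapp_inject)
qed

definition rend_of where
  "rend_of f = Abs_rend (\<lambda>x. if x \<in> rmod then f x else (\<lambda>d. 0))"

lemma rapp_rend_of:
  assumes "\<And>x. x \<in> rmod \<Longrightarrow> f x \<in> rmod"
    and "\<And>x y. x \<in> rmod \<Longrightarrow> y \<in> rmod \<Longrightarrow> f (\<lambda>d. x d + y d) = (\<lambda>d. f x d + f y d)"
    and "\<And>a x. x \<in> rmod \<Longrightarrow> f (\<lambda>d. a * x d) = (\<lambda>d. a * f x d)"
    and "x \<in> rmod"
  shows "rapp (rend_of f) x = f x"
  unfolding rend_of_def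
  by (subst Abs_rend_inverse) (use assms in \<open>auto simp: rmod_add rmod_scale\<close>)

instantiation rend :: (type, field_char_0) ring_1
begin

definition "0 = rend_of (\<lambda>x d. 0)"
definition "1 = rend_of (\<lambda>x. x)"
definition "S + T = rend_of (\<lambda>x d. rapp S x d + rapp T x d)"
definition "S * T = rend_of (\<lambda>x. rapp S (rapp T x))"
definition "- T = rend_of (\<lambda>x d. - rapp T x d)"
definition minus_rend :: "('a, 'b) rend \<Rightarrow> ('a, 'b) rend \<Rightarrow> ('a, 'b) rend" where
  "minus_rend S T = S + - T"

lemma rapp_ring_ops:
  fixes S T :: "('a, 'b) rend"
  assumes "x \<in> rmod"
  shows "rapp (0 :: ('a, 'b) rend) x = (\<lambda>d. 0)" "rapp (1 :: ('a, 'b) rend) x = x"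
    "rapp (S + T) x = (\<lambda>d. rapp S x d + rapp T x d)"
    "rapp (S * T) x = rapp S (rapp T x)" "rapp (- T) x = (\<lambda>d. - rapp T x d)"
    "rapp (S - T) x = (\<lambda>d. rapp S x d - rapp T x d)"
proof -
  note c = assms rmod_zero rmod_add rmod_scale rmod_minus rapp_closed rapp_add rapp_scale
  show "rapp (0 :: ('a, 'b) rend) x = (\<lambda>d. 0)" unfolding zero_rend_def
    by (rule rapp_rend_of) (simp_all add: c)
  show "rapp (1 :: ('a, 'b) rend) x = x" unfolding one_rend_def
    by (rule rapp_rend_of) (simp_all add: c)
  show plus: "rapp (S + T) x = (\<lambda>d. rapp S x d + rapp T x d)" for S T :: "('a, 'b) rend"
    unfolding plus_rend_def by (rule rapp_rend_of) (simp_all add: c algebra_simps)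
  show "rapp (S * T) x = rapp S (rapp T x)"
    unfolding times_rend_def by (rule rapp_rend_of) (simp_all add: c)
  show minus: "rapp (- T) x = (\<lambda>d. - rapp T x d)"
    unfolding uminus_rend_def by (rule rapp_rend_of) (simp_all add: c)
  show "rapp (S - T) x = (\<lambda>d. rapp S x d - rapp T x d)"
    unfolding minus_rend_def by (simp add: plus minus)
qed

instance
proof
  fix a b c :: "('a, 'b) rend"
  note r = rapp_ring_ops rapp_closed rapp_add
  show "a + b + c = a + (b + c)" by (rule rend_eqI) (simp add: r ac_simps)
  show "a + b = b + a" by (rule rend_eqI) (simp add: r ac_simps)
  show "0 + a = a" by (rule rend_eqI) (simp add: r)
  show "- a + a = 0" by (rule rend_eqI) (simp add: r)
  show "a * b * c = a * (b * c)" by (rule rend_eqI) (simp add: r)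
  show "1 * a = a" by (rule rend_eqI) (simp add: r)
  show "a * 1 = a" by (rule rend_eqI) (simp add: r)
  show "(a + b) * c = a * c + b * c" by (rule rend_eqI) (simp add: r)
  show "a * (b + c) = a * b + a * c" by (rule rend_eqI) (simp add: r)
  show "a - b = a + - b" by (simp add: minus_rend_def)
  have "rapp (0 :: ('a, 'b) rend) runit Scal \<noteq> rapp 1 runit Scal"
    by (simp add: r runit_mem) (simp add: runit_def)
  then show "(0 :: ('a, 'b) rend) \<noteq> 1" by auto
qed

end

definition escal :: "('i, 'k::field_char_0) rfam \<Rightarrow> ('i, 'k) rend" where
  "escal a = rend_of (\<lambda>x d. a * x d)"

definition evec :: "'i \<Rightarrow> ('i, 'k::field_char_0) rend" where
  "evec i = rend_of (R.vop i)"

lemma rapp_escal: "x \<in> rmod \<Longrightarrow> rapp (escal a) x = (\<lambda>d. a * x d)"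
  unfolding escal_def by (rule rapp_rend_of) (simp_all add: rmod_scale algebra_simps)

lemma rapp_evec: "x \<in> rmod \<Longrightarrow> rapp (evec i) x = R.vop i x"
  unfolding evec_def
  by (rule rapp_rend_of)
     (auto simp: R.vop_closed R.vop_def fun_eq_iff algebra_simps split: midx.splits)

lemma escal_add: "escal (a + b) = escal a + escal b"
  by (rule rend_eqI) (simp add: rapp_ring_ops rapp_escal algebra_simps)

lemma escal_mult: "escal (a * b) = escal a * escal b"
  by (rule rend_eqI) (simp add: rapp_ring_ops rapp_escal rmod_scale algebra_simps)

lemma escal_one [simp]: "escal 1 = 1"
  by (rule rend_eqI) (simp add: rapp_ring_ops rapp_escal)

lemma escal_commute: "escal a * T = T * escal a"
  by (rule rend_eqI) (simp add: rapp_ring_ops rapp_escal rapp_closed rapp_scale)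

lemma escal_zero [simp]: "escal 0 = 0"
  using escal_add[of 0 0] by simp

lemma escal_minus: "escal (- a) = - escal a"
  using escal_add[of a "- a"] by (simp add: eq_neg_iff_add_eq_0 add.commute)

lemma escal_sum: "escal (sum f A) = (\<Sum>x\<in>A. escal (f x))"
  by (induction A rule: infinite_finite_induct) (simp_all add: escal_add)

lemma escal_eq_zero:
  assumes "escal a = 0"
  shows "a = 0"
proof -
  have "rapp (escal a) runit Scal = rapp 0 runit Scal" using assms by simp
  then have "a * runit Scal = 0" by (simp only: rapp_escal rapp_ring_ops runit_mem)
  then show ?thesis by (simp add: runit_def)
qed

lemma escal_half: "escal (rscal (1/2)) * x + escal (rscal (1/2)) * x = x"
  by (simp add: rfam_half flip: distrib_right escal_add)

lemma evec_anticommute: "evec i * evec j + evec j * evec i = escal (- 2 * rm i j)"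
  by (rule rend_eqI)
     (simp add: rapp_ring_ops rapp_evec rapp_escal R.vop_closed R.vop_anticommute)

lemma evec_volume:
  "evec i * (evec j * evec k - evec k * evec j) + (evec j * evec k - evec k * evec j) * evec i =
    escal (- 4 * rw i j k)"
proof (rule rend_eqI)
  fix x :: "'a midx \<Rightarrow> ('a, 'b) rfam" and d
  assume x: "x \<in> rmod"
  then have "rapp (evec j * evec k - evec k * evec j) x = (\<lambda>d. R.vop j (R.vop k x) d - R.vop k (R.vop j x) d)"
    and "rapp (evec j * evec k - evec k * evec j) (R.vop i x) =
      (\<lambda>d. R.vop j (R.vop k (R.vop i x)) d - R.vop k (R.vop j (R.vop i x)) d)"
    by (simp_all add: rapp_ring_ops rapp_evec R.vop_closed)
  moreover have "(\<lambda>d. R.vop j (R.vop k x) d - R.vop k (R.vop j x) d) \<in> rmod"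
    using R.vmod_lincomb[of "R.vop j (R.vop k x)" "R.vop k (R.vop j x)" 1 "- 1"] x
    by (simp add: R.vop_closed)
  ultimately show "rapp (evec i * (evec j * evec k - evec k * evec j) + (evec j * evec k - evec k * evec j) * evec i) x d =
      rapp (escal (- 4 * rw i j k)) x d"
    using x R.vop_volume[OF x, of i j k d]
    by (simp add: rapp_ring_ops(3,4) rapp_evec rapp_escal)
qed

section \<open>Vector-like operators and the conjugation of words\<close>

inductive_set evspan :: "('i, 'k::field_char_0) rend set" where
  vec: "evec i \<in> evspan"
| bivec: "evec j * evec k - evec k * evec j \<in> evspan"
| plus: "X \<in> evspan \<Longrightarrow> Y \<in> evspan \<Longrightarrow> X + Y \<in> evspan"
| scale: "X \<in> evspan \<Longrightarrow> escal a * X \<in> evspan"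

lemma escal_left_commute: "X * (escal a * Y) = escal a * (X * Y)"
  by (metis escal_commute mult.assoc)

text \<open>On vectors and brackets the anticommutators are the scalars found in
  \<open>vop_anticommute\<close> and \<open>vop_volume\<close>, and \<open>double_commutator\<close>
  reduces the commutator of a vector with a bracket to vectors.\<close>

lemma evspan_evec:
  fixes X :: "('i, 'k::field_char_0) rend"
  assumes "X \<in> evspan"
  shows "(\<exists>a. evec i * X + X * evec i = escal a) \<and> evec i * X - X * evec i \<in> evspan"
  using assms
proof induction
  case (vec j)
  show ?case
    by (rule conjI[OF exI[of _ "- 2 * rm i j"]]) (rule evec_anticommute, rule evspan.bivec)
next
  case (bivec j k)
  let ?v = "evec :: 'i \<Rightarrow> ('i, 'k) rend"
  have M: "escal p * ?v k + escal p * ?v k + (escal q * ?v j + escal q * ?v j) \<in> evspan" for p q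
    by (intro evspan.plus evspan.scale evspan.vec)
  let ?p = "- 2 * rm i j" and ?q = "- 2 * rm i k"
  have "?v i * (?v j * ?v k - ?v k * ?v j) - (?v j * ?v k - ?v k * ?v j) * ?v i =
      2 * (escal ?p * ?v k - escal ?q * ?v j)"
    by (rule double_commutator) (simp_all only: evec_anticommute escal_commute)
  also have "2 * (escal p * K - escal q * J) =
      (escal p * K + escal p * K) + (escal (- q) * J + escal (- q) * J)" for p q and K J :: "('i, 'k) rend"
    by (simp only: mult_2 escal_minus) (simp add: algebra_simps)
  finally have "?v i * (?v j * ?v k - ?v k * ?v j) - (?v j * ?v k - ?v k * ?v j) * ?v i \<in> evspan"
    by (simp only: M)
  then show ?case
    by (rule conjI[OF exI[of _ "- 4 * rw i j k"], rotated]) (rule evec_volume)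
next
  case (plus X Y)
  then obtain a b where "evec i * X + X * evec i = escal a" "evec i * Y + Y * evec i = escal b" by blast
  then have "evec i * (X + Y) + (X + Y) * evec i = escal (a + b)"
    by (simp add: escal_add algebra_simps)
  moreover have "evec i * (X + Y) - (X + Y) * evec i = (evec i * X - X * evec i) + (evec i * Y - Y * evec i)"
    by (simp add: algebra_simps)
  ultimately show ?case using plus evspan.plus by metis
next
  case (scale X c)
  then obtain a where "evec i * X + X * evec i = escal a" by blast
  then have "evec i * (escal c * X) + escal c * X * evec i = escal (c * a)"
    by (simp add: escal_left_commute[of "evec i"] mult.assoc escal_mult flip: distrib_left)
  moreover have "evec i * (escal c * X) - escal c * X * evec i = escal c * (evec i * X - X * evec i)"
    by (simp add: escal_left_commute[of "evec i"] mult.assoc right_diff_distrib)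
  ultimately show ?case using scale evspan.scale by metis
qed

definition egen :: "'i \<times> bool \<Rightarrow> ('i, 'k::field_char_0) rend" where
  "egen x = escal (rgen (Lam (fst x))) + escal (if snd x then 1 else - 1) * evec (fst x)"

lemma evec_square: "evec i * evec i = (escal (- rm i i) :: ('i, 'k::field_char_0) rend)"
proof -
  let ?h = "escal (rscal (1/2)) :: ('i, 'k) rend"
  have "evec i * evec i = ?h * (evec i * evec i + evec i * evec i)"
    by (simp only: distrib_left escal_half)
  also have "\<dots> = ?h * escal (- rm i i) + ?h * escal (- rm i i)"
  proof -
    have "escal (- 2 * r) = escal (- r) + (escal (- r) :: ('i, 'k) rend)" for r
      by (simp flip: escal_add)
    then show ?thesis unfolding evec_anticommute by (simp only: distrib_left)
  qed
  finally show ?thesis by (simp only: escal_half)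
qed

text \<open>The product of l + v and l - v is l^2 - v^2 with v^2 = -\<open>rm i i\<close>, and (R2)
  makes it 1.\<close>

lemma egen_inv: "egen x * egen (inv_letter x) = 1"
proof -
  obtain i b where x: "x = (i, b)" by (cases x)
  let ?l = "rgen (Lam i) :: ('a, 'b) rfam"
  have "egen x * egen (inv_letter x) = escal ?l * escal ?l - evec i * evec i"
    unfolding x egen_def
    by (cases b) (simp_all add: escal_minus algebra_simps escal_commute[of ?l "evec i"])
  also have "\<dots> = escal (?l * ?l + rm i i)"
    by (simp add: evec_square escal_minus escal_add escal_mult)
  finally show ?thesis by (simp add: rm_self power2_eq_square)
qed

text \<open>As for quaternions of norm one, inverting a word only changes the sign of its vector
  part. That this part lies in \<open>evspan\<close> is carried through the induction, because
  prefixing a letter needs its commutator and anticommutator with a vector.\<close>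

lemma word_prod_egen_split:
  "\<exists>a. \<exists>X \<in> (evspan :: ('i, 'k::field_char_0) rend set). word_prod egen w = escal a + X \<and> word_prod egen (inv_word w) = escal a - X"
proof (induction w)
  case Nil
  have "escal 0 * evec undefined \<in> evspan" by (intro evspan.intros)
  then have "0 \<in> evspan" by simp
  then show ?case by (intro exI[of _ 1] bexI[of _ 0]) simp_all
next
  case (Cons x w)
  then obtain a X where X: "(X :: ('i, 'k) rend) \<in> evspan" and w: "word_prod egen w = escal a + X"
    and w': "word_prod egen (inv_word w) = escal a - X" by blast
  obtain i b where x: "x = (i, b)" by (cases x)
  define e :: "('i, 'k) rfam" where "e = (if b then 1 else - 1)"
  let ?l = "rgen (Lam i) :: ('i, 'k) rfam" and ?h = "rscal (1/2) :: ('i, 'k) rfam"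
  obtain t where t: "evec i * X + X * evec i = escal t" and c: "evec i * X - X * evec i \<in> evspan"
    using evspan_evec[OF X] by blast
  \<comment> \<open>The vector part of (l + ev)(a + X), where e is the exponent of the letter: half
    of the anticommutator \<open>t\<close> of v and X goes to the scalar part, half of their
    commutator stays here. For the inverse word v and X are multiplied in the opposite order, which
    flips just the commutator.\<close>
  let ?Y = "escal ?l * X + (escal (a * e) * evec i + escal (e * ?h) * (evec i * X - X * evec i))"
  have VX: "evec i * X = escal ?h * escal t + escal ?h * (evec i * X - X * evec i)"
    and XV: "X * evec i = escal ?h * escal t - escal ?h * (evec i * X - X * evec i)"
    using escal_half[of "evec i * X"] escal_half[of "X * evec i"]
    by (simp_all add: algebra_simps flip: t)
  have g: "egen x = escal ?l + escal e * evec i" "egen (inv_letter x) = escal ?l - escal e * evec i"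
    by (simp_all add: x egen_def e_def escal_minus)
  have "word_prod egen (x # w) = escal ?l * escal a + escal ?l * X + escal a * (escal e * evec i)
      + escal e * (evec i * X)"
    by (simp add: w g distrib_left distrib_right mult.assoc escal_commute[of a] add.assoc)
  also have "\<dots> = escal (?l * a + e * ?h * t) + ?Y"
    by (subst VX) (simp only: escal_add escal_mult distrib_left mult.assoc add.assoc add.commute add.left_commute)
  finally have 1: "word_prod egen (x # w) = escal (?l * a + e * ?h * t) + ?Y" .
  have "word_prod egen (inv_word (x # w)) = escal ?l * escal a - escal ?l * X - escal a * (escal e * evec i)
      + escal e * (X * evec i)"
    by (simp add: w' g left_diff_distrib right_diff_distrib mult.assoc escal_commute[of ?l]
        escal_left_commute[of X])
  also have "\<dots> = escal (?l * a + e * ?h * t) - ?Y"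
    by (subst XV) (simp add: escal_add escal_mult distrib_left mult.assoc right_diff_distrib)
  finally have 2: "word_prod egen (inv_word (x # w)) = escal (?l * a + e * ?h * t) - ?Y" .
  have "?Y \<in> evspan" using X c by (intro evspan.intros)
  with 1 2 show ?case by blast
qed

section \<open>The representation of the group ring\<close>

definition ecoeff :: "'k::field_char_0 \<Rightarrow> ('i, 'k) rend" where
  "ecoeff c = escal (rscal c)"

interpretation ecoeff: central_scalars "ecoeff :: 'k::field_char_0 \<Rightarrow> ('i, 'k) rend"
  by standard (simp_all add: ecoeff_def rscal.add rscal.mult escal_add escal_mult, rule escal_commute)

abbreviation erep :: "(('i \<times> bool) list \<Rightarrow> 'k::field_char_0) \<Rightarrow> ('i, 'k) rend" where
  "erep \<equiv> ecoeff.lift (word_prod egen)"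

text \<open>The coefficients at a word and at its inverse agree, so twice the operator is a
  combination of sums over a word and its inverse, and these sums are scalars by
  \<open>word_prod_egen_split\<close>.\<close>

lemma erep_symmetric:
  fixes f :: "('i \<times> bool) list \<Rightarrow> 'k::field_char_0"
  assumes f: "f \<in> carrier (group_ring (free_group I))" and star: "gr_star (free_group I) f = f"
  shows "\<exists>a. erep f = escal a"
proof -
  have supp: "supp f \<subseteq> carrier (free_group I)" using f by (simp add: carrier_group_ring)
  have inv: "f (inv_word w) = f w" if "w \<in> carrier (free_group I)" for w
    using fun_cong[OF star, of w] that by (simp add: gr_star_def inv_free_group)
  have bij: "bij_betw inv_word (supp f) (supp f)"
    by (rule bij_betwI[of _ _ _ inv_word]) (use supp inv in \<open>auto simp: supp_def\<close>)
  have "(erep f :: ('i, 'k) rend) = (\<Sum>w\<in>supp f. ecoeff (f (inv_word w)) * word_prod egen (inv_word w))"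
    unfolding ecoeff.lift_def by (rule sum.reindex_bij_betw[OF bij, symmetric])
  also have "\<dots> = (\<Sum>w\<in>supp f. ecoeff (f w) * word_prod egen (inv_word w))"
    using supp inv by (intro sum.cong) auto
  finally have "erep f + erep f =
      (\<Sum>w\<in>supp f. ecoeff (f w) * (word_prod egen w + word_prod egen (inv_word w)))"
    by (simp add: ecoeff.lift_def distrib_left sum.distrib)
  moreover have "\<exists>a. word_prod egen w + word_prod egen (inv_word w) = (escal a :: ('i, 'k) rend)" for w
  proof -
    obtain a and X :: "('i, 'k) rend" where "word_prod egen w = escal a + X"
      "word_prod egen (inv_word w) = escal a - X"
      using word_prod_egen_split by blast
    then have "word_prod egen w + word_prod egen (inv_word w) = escal (a + a)"
      by (simp only: escal_add) simp
    then show ?thesis by blast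
  qed
  then obtain a where "\<And>w. word_prod egen w + word_prod egen (inv_word w) = (escal (a w) :: ('i, 'k) rend)"
    by metis
  ultimately have double: "erep f + erep f = escal (\<Sum>w\<in>supp f. rscal (f w) * a w)"
    by (simp add: escal_sum escal_mult ecoeff_def)
  have "erep f = escal (rscal (1/2)) * (erep f + erep f)"
    by (simp add: distrib_left escal_half)
  then show ?thesis unfolding double by (metis escal_mult)
qed

lemma erep_mult:
  assumes "f \<in> carrier (group_ring (free_group I))" "g \<in> carrier (group_ring (free_group I))"
  shows "erep (f \<otimes>\<^bsub>group_ring (free_group I)\<^esub> g) = erep f * erep g"
  using assms by (rule ecoeff.lift_mult) (simp add: word_prod_reduce egen_inv)

text \<open>The operator of a symmetric element is a scalar and commutes with every operator, so the
  generators of the ideal act as 0.\<close>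

lemma erep_star_ideal:
  fixes f :: "('i \<times> bool) list \<Rightarrow> 'k::field_char_0"
  assumes "f \<in> star_ideal (free_group I)"
  shows "erep f = 0"
proof -
  interpret G: group "free_group I" by (rule group_free_group)
  interpret K: ring "group_ring (free_group I) :: (('i \<times> bool) list \<Rightarrow> 'k) ring"
    by (rule G.ring_group_ring)
  let ?J = "{f :: ('i \<times> bool) list \<Rightarrow> 'k. f \<in> carrier (group_ring (free_group I)) \<and> erep f = 0}"
  have add: "erep (gr_add x y) = erep x + erep y"
    if "x \<in> carrier (group_ring (free_group I))" "y \<in> carrier (group_ring (free_group I))" for x y
    using that ecoeff.lift_add[of x y] by (simp add: carrier_group_ring gr_add_def)
  have zero: "erep (\<lambda>x. 0) = 0" by (simp add: ecoeff.lift_def supp_def)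
  have "ideal ?J (group_ring (free_group I))"
    by (rule K.ideal_of_closed)
       (auto simp del: free_group_simps simp: add zero erep_mult gr_add_closed G.gr_mult_closed)
  moreover have "gr_sub (x \<otimes>\<^bsub>group_ring (free_group I)\<^esub> y) (y \<otimes>\<^bsub>group_ring (free_group I)\<^esub> x) \<in> ?J"
    if "x \<in> carrier (group_ring (free_group I))" "y \<in> carrier (group_ring (free_group I))"
      "gr_star (free_group I) y = y" for x y :: "('i \<times> bool) list \<Rightarrow> 'k"
    using that erep_symmetric[OF that(2,3)] escal_commute[of _ "erep x"]
    by (auto simp: gr_sub_closed G.gr_mult_closed ecoeff.lift_sub[where G = "free_group I"] erep_mult)
  ultimately show ?thesis using G.star_ideal_minimal[of ?J] assms by blast
qed

section \<open>The isomorphism\<close>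

context central_scalars
begin

lemma lift_gr_scale:
  "f \<in> carrier (group_ring G) \<Longrightarrow> lift h (gr_scale a f) = c a * lift h f"
  by (simp add: lift_scale carrier_group_ring)

lemma lift_gr_add:
  "f \<in> carrier (group_ring G) \<Longrightarrow> g \<in> carrier (group_ring G) \<Longrightarrow>
    lift h (gr_add f g) = lift h f + lift h g"
  by (simp add: gr_add_def lift_add carrier_group_ring)

lemma lift_gdot:
  assumes "group G" "\<And>u v. u \<in> carrier G \<Longrightarrow> v \<in> carrier G \<Longrightarrow> h (u \<otimes>\<^bsub>G\<^esub> v) = h u * h v"
    and "f \<in> carrier (group_ring G)" "g \<in> carrier (group_ring G)"
  shows "lift h (gdot G f g) = - (c (1/2) * (lift h f * lift h g + lift h g * lift h f))"
  using assms
  by (simp add: gdot_def group.gr_mult_closed lift_gr_scale[of _ G] lift_gr_add[of _ G] gr_add_closed lift_mult minus)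

lemma lift_gbrk:
  assumes "group G" "\<And>u v. u \<in> carrier G \<Longrightarrow> v \<in> carrier G \<Longrightarrow> h (u \<otimes>\<^bsub>G\<^esub> v) = h u * h v"
    and "f \<in> carrier (group_ring G)" "g \<in> carrier (group_ring G)"
  shows "lift h (gbrk G f g) = c (1/2) * (lift h f * lift h g - lift h g * lift h f)"
  using assms
  by (simp add: gbrk_def group.gr_mult_closed lift_gr_scale[of _ G] lift_sub[of _ G] gr_sub_closed lift_mult)

lemma lift_gvec_basis:
  assumes "group G" "g \<in> carrier G"
  shows "lift h (gvec G (gr_basis g)) = c (1/2) * (h g - h (inv\<^bsub>G\<^esub> g))"
  using assms
  by (simp add: gvec_def lift_gr_scale[of _ G] lift_sub[of _ G] gr_sub_closed gr_basis_closed
      group.gr_star_basis group.inv_closed)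

lemma lift_gbar_basis:
  assumes "group G" "g \<in> carrier G"
  shows "lift h (gbar G (gr_basis g)) = c (1/2) * (h g + h (inv\<^bsub>G\<^esub> g))"
  using assms
  by (simp add: gbar_def lift_gr_scale[of _ G] lift_gr_add[of _ G] gr_add_closed gr_basis_closed
      group.gr_star_basis group.inv_closed)

end

lemma (in group) gdot_closed:
  "f \<in> carrier (group_ring G) \<Longrightarrow> g \<in> carrier (group_ring G) \<Longrightarrow> gdot G f g \<in> carrier (group_ring G)"
  by (simp add: gdot_def gr_scale_closed gr_add_closed gr_mult_closed)

lemma (in group) gbrk_closed:
  "f \<in> carrier (group_ring G) \<Longrightarrow> g \<in> carrier (group_ring G) \<Longrightarrow> gbrk G f g \<in> carrier (group_ring G)"
  by (simp add: gbrk_def gr_scale_closed gr_sub_closed gr_mult_closed)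

lemma (in group) gvec_closed:
  "f \<in> carrier (group_ring G) \<Longrightarrow> gvec G f \<in> carrier (group_ring G)"
  by (simp add: gvec_def gr_scale_closed gr_sub_closed gr_star_closed)

lemma (in group) gbar_closed:
  "f \<in> carrier (group_ring G) \<Longrightarrow> gbar G f \<in> carrier (group_ring G)"
  by (simp add: gbar_def gr_scale_closed gr_add_closed gr_star_closed)

lemma free_gen_closed: "i \<in> I \<Longrightarrow> free_gen i \<in> carrier (free_group I)"
  by (simp add: free_gen_def carrier_free_group)

lemma word_prod_mult:
  assumes "\<And>x. h x * h (inv_letter x) = 1"
  shows "word_prod h (u \<otimes>\<^bsub>free_group I\<^esub> v) = word_prod h u * word_prod h v"
  by (simp add: word_prod_reduce assms)

lemma word_prod_free_gen:
  assumes "i \<in> I"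
  shows "word_prod h (free_gen i) = h (i, True)"
    "word_prod h (inv\<^bsub>free_group I\<^esub> (free_gen i)) = h (i, False)"
  using inv_free_group[OF free_gen_closed[OF assms]] by (simp_all add: free_gen_def)

lemma word_prod_agen_mult:
  "word_prod agen (u \<otimes>\<^bsub>free_group I\<^esub> v) = word_prod agen u * word_prod agen v"
  by (rule word_prod_mult) (rule agen_inv)

lemma word_prod_egen_mult:
  "word_prod egen (u \<otimes>\<^bsub>free_group I\<^esub> v) = word_prod egen u * word_prod egen v"
  by (rule word_prod_mult) (rule egen_inv)

lemma alift_gvec: "i \<in> I \<Longrightarrow>
    ascal.lift (word_prod agen) (gvec (free_group I) (gr_basis (free_gen i))) = avec i"
  by (simp add: ascal.lift_gvec_basis group_free_group free_gen_closed word_prod_free_gen avec_def)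

lemma alift_gbar: "i \<in> I \<Longrightarrow>
    ascal.lift (word_prod agen) (gbar (free_group I) (gr_basis (free_gen i))) = sval (slam i)"
  by (simp add: ascal.lift_gbar_basis group_free_group free_gen_closed word_prod_free_gen sval_slam)

lemma alift_gdot:
  assumes "f \<in> carrier (group_ring (free_group I))" "g \<in> carrier (group_ring (free_group I))"
  shows "ascal.lift (word_prod agen) (gdot (free_group I) f g) =
    A.dot (ascal.lift (word_prod agen) f) (ascal.lift (word_prod agen) g)"
  unfolding A.dot_def
  by (rule ascal.lift_gdot[OF group_free_group word_prod_agen_mult assms])

lemma alift_gbrk:
  assumes "f \<in> carrier (group_ring (free_group I))" "g \<in> carrier (group_ring (free_group I))"
  shows "ascal.lift (word_prod agen) (gbrk (free_group I) f g) =
    A.brk (ascal.lift (word_prod agen) f) (ascal.lift (word_prod agen) g)"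
  unfolding A.brk_def
  by (rule ascal.lift_gbrk[OF group_free_group word_prod_agen_mult assms])

lemma erep_gvec: "i \<in> I \<Longrightarrow> erep (gvec (free_group I) (gr_basis (free_gen i))) = evec i"
  by (simp add: ecoeff.lift_gvec_basis group_free_group free_gen_closed word_prod_free_gen
      egen_def escal_minus ecoeff_def distrib_left escal_half)

lemma erep_gbar: "i \<in> I \<Longrightarrow>
    erep (gbar (free_group I) (gr_basis (free_gen i))) = escal (rgen (Lam i))"
  by (simp add: ecoeff.lift_gbar_basis group_free_group free_gen_closed word_prod_free_gen
      egen_def escal_minus ecoeff_def distrib_left escal_half)

lemma erep_gdot:
  assumes "f \<in> carrier (group_ring (free_group I))" "g \<in> carrier (group_ring (free_group I))"
  shows "erep (gdot (free_group I) f g) =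
    - (escal (rscal (1/2)) * (erep f * erep g + erep g * erep f))"
  using ecoeff.lift_gdot[OF group_free_group word_prod_egen_mult assms]
  by (simp only: ecoeff_def)

lemma erep_gbrk:
  assumes "f \<in> carrier (group_ring (free_group I))" "g \<in> carrier (group_ring (free_group I))"
  shows "erep (gbrk (free_group I) f g) =
    escal (rscal (1/2)) * (erep f * erep g - erep g * erep f)"
  using ecoeff.lift_gbrk[OF group_free_group word_prod_egen_mult assms]
  by (simp only: ecoeff_def)

section \<open>Images of the variables, represented in the group ring\<close>

definition xvec :: "'i set \<Rightarrow> 'i \<Rightarrow> ('i \<times> bool) list \<Rightarrow> 'k::field" where
  "xvec I i = gvec (free_group I) (gr_basis (free_gen i))"

fun xgen :: "'i set \<Rightarrow> 'i pvar \<Rightarrow> ('i \<times> bool) list \<Rightarrow> 'k::field" where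
  "xgen I (Lam i) = gbar (free_group I) (gr_basis (free_gen i))"
| "xgen I (Mv i j) = gdot (free_group I) (xvec I i) (xvec I j)"
| "xgen I (Wv i j k) = gdot (free_group I) (gbrk (free_group I) (xvec I i) (xvec I j)) (xvec I k)"

lemma xvec_closed: "i \<in> I \<Longrightarrow> xvec I i \<in> carrier (group_ring (free_group I))"
  by (simp add: xvec_def group.gvec_closed[OF group_free_group] gr_basis_closed free_gen_closed)

lemma xgen_closed:
  assumes "pvar_idx v \<subseteq> I"
  shows "xgen I v \<in> carrier (group_ring (free_group I))"
  using assms
  by (cases v)
     (simp_all add: group.gbar_closed[OF group_free_group] group.gdot_closed[OF group_free_group]
       group.gbrk_closed[OF group_free_group] xvec_closed gr_basis_closed free_gen_closed)

lemma alift_xgen: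
  assumes "pvar_idx v \<subseteq> I"
  shows "ascal.lift (word_prod agen) (xgen I v) = sval (sgen v)"
  using assms
  by (cases v)
     (simp_all add: alift_gbar alift_gdot alift_gbrk xvec_closed group.gbrk_closed[OF group_free_group]
       xvec_def[symmetric] sval_sdot sval_striple A.triple_def alift_gvec[folded xvec_def])

lemma A_cls_xgen: "pvar_idx v \<subseteq> I \<Longrightarrow> A_cls (free_group I) (xgen I v) = acomp (sval (sgen v)) I"
  using acomp_lift[OF xgen_closed] by (metis alift_xgen)

lemma erep_xgen:
  fixes v :: "'i pvar"
  assumes "pvar_idx v \<subseteq> I"
  shows "erep (xgen I v) = (escal (rgen v) :: ('i, 'k::field_char_0) rend)"
proof (cases v)
  case (Lam i)
  then show ?thesis using assms by (simp add: erep_gbar)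
next
  case (Mv i j)
  then have "erep (xgen I v) = - (escal (rscal (1/2)) * (evec i * evec j + evec j * evec i) :: ('i, 'k) rend)"
    using assms by (simp add: erep_gdot xvec_closed erep_gvec[folded xvec_def])
  also have "\<dots> = escal (rscal (1/2) * (rm i j + rm i j))"
    by (simp add: evec_anticommute flip: escal_mult escal_minus)
  also have "rscal (1/2) * (rm i j + rm i j) = (rm i j :: ('i, 'k) rfam)"
    by (simp only: distrib_left flip: distrib_right) (simp add: rfam_half)
  finally show ?thesis using Mv by (simp add: rm_def)
next
  case (Wv i j k)
  let ?h = "rscal (1/2) :: ('i, 'k) rfam" and ?b = "evec i * evec j - evec j * evec i :: ('i, 'k) rend"
  have "erep (xgen I v) = - (escal ?h * (escal ?h * ?b * evec k + evec k * (escal ?h * ?b)))"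
    using assms Wv
    by (simp add: erep_gdot erep_gbrk xvec_closed group.gbrk_closed[OF group_free_group]
        erep_gvec[folded xvec_def])
  also have "\<dots> = - (escal ?h * (escal ?h * (evec k * ?b + ?b * evec k)))"
    by (simp only: escal_left_commute[of "evec k"] mult.assoc distrib_left add.commute)
  \<comment> \<open>The factors -1/2 of the dot product, 1/2 of the bracket and -4 of
    \<open>evec_volume\<close> multiply to 1; the index order k, i, j is undone by
    \<open>w_rotate\<close>.\<close>
  also have "\<dots> = escal (?h * (?h * (4 * rw k i j)))"
    unfolding evec_volume by (simp flip: escal_mult escal_minus)
  also have "?h * (?h * (4 * rw k i j)) = ((?h + ?h) * (?h + ?h)) * rw k i j"
    by (simp add: algebra_simps)
  also have "\<dots> = rw i j k"
    by (simp add: rfam_half R.w_rotate[of i j k])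
  finally show ?thesis using Wv by (simp add: rw_def)
qed

text \<open>The link between the two evaluations of p: one element of the group ring that represents
  the image of p in \<open>A\<close> and acts as the scalar \<open>reval p\<close>. Existence is
  enough, since by \<open>erep_star_ideal\<close> the operator depends only on the class.\<close>

lemma erep_eq_reval:
  fixes p :: "('i, 'k::field_char_0) mpoly"
  assumes "p \<in> carrier (poly_ring I)"
  shows "\<exists>x \<in> carrier (group_ring (free_group I)).
    A_cls (free_group I) x = acomp (sval (seval p)) I \<and> erep x = escal (reval p)"
  using assms
proof (induction p rule: poly_ring_induct)
  case (PC a)
  have "erep (gr_scale a (gr_basis [])) = (escal (rscal a) :: ('i, 'k) rend)"
    by (simp add: ecoeff.lift_scale ecoeff_def)
  then show ?case
    by (intro bexI[of _ "gr_scale a (gr_basis [])"])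
       (simp_all add: sval_sscal ascal.rep_eq gr_scale_closed gr_basis_closed Nil_free_group)
next
  case (PV v)
  then show ?case
    by (intro bexI[of _ "xgen I v"]) (simp_all add: A_cls_xgen erep_xgen xgen_closed)
next
  case (add p q)
  then obtain x y where xy: "x \<in> carrier (group_ring (free_group I))"
      "A_cls (free_group I) x = acomp (sval (seval p)) I" "erep x = escal (reval p)"
      "y \<in> carrier (group_ring (free_group I))"
      "A_cls (free_group I) y = acomp (sval (seval q)) I" "erep y = escal (reval q)"
    by blast
  then show ?case
    by (intro bexI[of _ "gr_add x y"])
       (simp_all add: sscal.eval_add rscal.eval_add sval_simps acomp_simps escal_add gr_add_closed
         group.A_cls_add[OF group_free_group] ecoeff.lift_gr_add[of _ "free_group I"])
next
  case (mult p q)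
  then obtain x y where xy: "x \<in> carrier (group_ring (free_group I))"
      "A_cls (free_group I) x = acomp (sval (seval p)) I" "erep x = escal (reval p)"
      "y \<in> carrier (group_ring (free_group I))"
      "A_cls (free_group I) y = acomp (sval (seval q)) I" "erep y = escal (reval q)"
    by blast
  then show ?case
    by (intro bexI[of _ "x \<otimes>\<^bsub>group_ring (free_group I)\<^esub> y"])
       (simp_all add: sscal.eval_mult rscal.eval_mult sval_simps acomp_simps escal_mult
         group.gr_mult_closed[OF group_free_group] group.A_cls_mult[OF group_free_group] erep_mult)
qed

text \<open>If the image of p is 0, its lift lies in the ideal and acts as 0; but it also acts as
  the scalar \<open>reval p\<close>, whose component at \<open>I\<close> is the class of p.\<close>

lemma seval_eq_zeroD:
  fixes p :: "('i, 'k::field_char_0) mpoly"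
  assumes p: "p \<in> carrier (poly_ring I)" and "acomp (sval (seval p)) I = \<zero>\<^bsub>A_ring (free_group I)\<^esub>"
  shows "R_cls I p = \<zero>\<^bsub>R_ring I\<^esub>"
proof -
  obtain x where x: "x \<in> carrier (group_ring (free_group I))"
    "A_cls (free_group I) x = acomp (sval (seval p)) I" "erep x = escal (reval p)"
    using erep_eq_reval[OF p] by blast
  then have "x \<in> star_ideal (free_group I)"
    using assms(2) group.A_cls_eq_zero_iff[OF group_free_group x(1)] by simp
  then have "erep x = 0" by (rule erep_star_ideal)
  then have "escal (reval p) = 0" using x(3) by simp
  then have "reval p = 0" by (rule escal_eq_zero)
  then show ?thesis using rcomp_reval[OF p] by (simp add: rcomp_simps)
qed

text \<open>A representative of the class is chosen; \<open>seval_R_ideal\<close> makes the value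
  independent of the choice.\<close>

definition iso_map :: "'i set \<Rightarrow> ('i, 'k::field_char_0) mpoly set \<Rightarrow> (('i \<times> bool) list \<Rightarrow> 'k) set" where
  "iso_map I P = acomp (sval (seval (SOME p. p \<in> P))) I"

lemma iso_map_R_cls: "iso_map I (R_cls I p) = acomp (sval (seval p)) I"
proof -
  have "(SOME q. q \<in> R_cls I p) \<in> R_cls I p" using mem_R_cls_self by (rule someI)
  then obtain r where "r \<in> R_ideal I" "(SOME q. q \<in> R_cls I p) = r + p" by (rule mem_R_clsE)
  then show ?thesis by (simp add: iso_map_def sscal.eval_add seval_R_ideal)
qed

lemma acomp_sval_sharp: "acomp (sval x) I \<in> sharp (free_group I)"
  using astar_sval[of x] fun_cong[OF astar.rep_eq[of "sval x"], of I] by (simp add: sharp_def)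

lemma iso_map_ring_iso:
  "iso_map I \<in> ring_iso (R_ring I :: ('i, 'k::field_char_0) mpoly set ring)
     ((A_ring (free_group I)) \<lparr>carrier := sharp (free_group I)\<rparr>)"
proof -
  let ?S = "(A_ring (free_group I)) \<lparr>carrier := sharp (free_group I)\<rparr> ::
    (('i \<times> bool) list \<Rightarrow> 'k) set ring"
  have "iso_map I \<in> ring_hom (R_ring I) ?S"
  proof (rule ring_hom_memI)
    show "iso_map I \<one>\<^bsub>R_ring I\<^esub> = \<one>\<^bsub>?S\<^esub>"
      by (simp add: iso_map_R_cls sval_simps acomp_simps flip: R_cls_one)
  next
    fix X Y :: "('i, 'k) mpoly set"
    assume "X \<in> carrier (R_ring I)"
    then obtain p where p: "p \<in> carrier (poly_ring I)" "X = R_cls I p" by (auto simp: carrier_R_ring)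
    then show "iso_map I X \<in> carrier ?S" by (simp add: iso_map_R_cls acomp_sval_sharp)
    assume "Y \<in> carrier (R_ring I)"
    then obtain q where q: "q \<in> carrier (poly_ring I)" "Y = R_cls I q" by (auto simp: carrier_R_ring)
    show "iso_map I (X \<otimes>\<^bsub>R_ring I\<^esub> Y) = iso_map I X \<otimes>\<^bsub>?S\<^esub> iso_map I Y"
      using p q by (simp add: iso_map_R_cls sscal.eval_mult sval_simps acomp_simps flip: R_cls_mult)
    show "iso_map I (X \<oplus>\<^bsub>R_ring I\<^esub> Y) = iso_map I X \<oplus>\<^bsub>?S\<^esub> iso_map I Y"
      using p q by (simp add: iso_map_R_cls sscal.eval_add sval_simps acomp_simps flip: R_cls_add)
  qed
  moreover have "bij_betw (iso_map I) (carrier (R_ring I)) (carrier ?S)"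
    unfolding bij_betw_def
  proof
    show "inj_on (iso_map I) (carrier (R_ring I) :: ('i, 'k) mpoly set set)"
    proof (rule inj_onI)
      fix X Y :: "('i, 'k) mpoly set"
      assume "X \<in> carrier (R_ring I)" "Y \<in> carrier (R_ring I)" and eq: "iso_map I X = iso_map I Y"
      then obtain p q where p: "p \<in> carrier (poly_ring I)" "X = R_cls I p"
        and q: "q \<in> carrier (poly_ring I)" "Y = R_cls I q"
        by (auto simp: carrier_R_ring)
      \<comment> \<open>The subtraction is carried out in the type class ring and then read at the
        component \<open>I\<close>, where alone the two images are known to agree.\<close>
      have "acomp (sval (seval (p - q)) + sval (seval q)) I = acomp (0 + sval (seval q)) I"
        using eq p q by (simp add: iso_map_R_cls sscal.eval_diff sval_simps)
      then have "acomp (sval (seval (p - q)) + sval (seval q) + - sval (seval q)) I =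
          acomp (0 + sval (seval q) + - sval (seval q)) I"
        by (simp only: plus_afam.rep_eq)
      then have "acomp (sval (seval (p - q))) I = \<zero>\<^bsub>A_ring (free_group I)\<^esub>"
        by (simp add: zero_afam.rep_eq)
      then have "R_cls I (p - q) = \<zero>\<^bsub>R_ring I\<^esub>"
        using p q by (intro seval_eq_zeroD poly_diff_closed)
      then have "R_cls I (p - q + q) = \<zero>\<^bsub>R_ring I\<^esub> \<oplus>\<^bsub>R_ring I\<^esub> R_cls I q"
        using p q by (subst R_cls_add) (simp_all add: poly_diff_closed)
      then show "X = Y"
        using p q cring.cring_simprules(8)[OF cring_R_ring R_cls_closed[OF q(1)]] by simp
    qed
    show "iso_map I ` carrier (R_ring I) = carrier ?S"
    proof
      show "iso_map I ` carrier (R_ring I) \<subseteq> carrier ?S"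
        by (auto simp: carrier_R_ring iso_map_R_cls acomp_sval_sharp)
      show "carrier ?S \<subseteq> iso_map I ` carrier (R_ring I)"
      proof
        fix X assume "X \<in> carrier ?S"
        then obtain p where "p \<in> carrier (poly_ring I)" "X = acomp (sval (seval p)) I"
          by (auto elim: sharp_eq_seval)
        then show "X \<in> iso_map I ` carrier (R_ring I)"
          by (auto simp: carrier_R_ring iso_map_R_cls intro!: image_eqI[of _ _ "R_cls I p"])
      qed
    qed
  qed
  ultimately show ?thesis by (simp add: ring_iso_def)
qed

theorem mainTheorem14:
  fixes I :: "'i set"
  shows "\<exists>\<phi>. \<phi> \<in> ring_iso (R_ring I :: ('i, 'k::field_char_0) mpoly set ring)
                     ((A_ring (free_group I)) \<lparr>carrier := sharp (free_group I)\<rparr>)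
     \<and> (\<forall>c. \<phi> (R_cls I (PC c)) = A_cls (free_group I) (gr_scale c (gr_basis [])))
     \<and> (\<forall>i\<in>I. \<phi> (R_cls I (PV (Lam i))) =
            A_cls (free_group I) (gbar (free_group I) (gr_basis (free_gen i))))
     \<and> (\<forall>i\<in>I. \<forall>j\<in>I. \<phi> (R_cls I (PV (Mv i j))) =
            A_cls (free_group I) (gdot (free_group I)
               (gvec (free_group I) (gr_basis (free_gen i)))
               (gvec (free_group I) (gr_basis (free_gen j)))))
     \<and> (\<forall>i\<in>I. \<forall>j\<in>I. \<forall>k\<in>I. \<phi> (R_cls I (PV (Wv i j k))) =
            A_cls (free_group I) (gdot (free_group I)
               (gbrk (free_group I)
                  (gvec (free_group I) (gr_basis (free_gen i)))
                  (gvec (free_group I) (gr_basis (free_gen j))))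
               (gvec (free_group I) (gr_basis (free_gen k)))))"
proof -
  have const: "iso_map I (R_cls I (PC c)) = A_cls (free_group I) (gr_scale c (gr_basis []))" for c :: 'k
    by (simp add: iso_map_R_cls sval_sscal ascal.rep_eq)
  have gen: "iso_map I (R_cls I (PV v)) = A_cls (free_group I) (xgen I v :: _ \<Rightarrow> 'k)"
    if "pvar_idx v \<subseteq> I" for v
    by (simp add: iso_map_R_cls A_cls_xgen[OF that])
  show ?thesis
    by (intro exI[of _ "iso_map I"] conjI iso_map_ring_iso) (simp_all add: const gen xvec_def)
qed

end
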